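(* Let $\sigma\colon\Sigma\to\Sigma$ be a mixing sub-shift of finite type and $\varphi\colon\Sigma\to\mathbb{R}$ a continuous function. Let $\alpha$ and $\beta$ be the infimum and maximum, respectively, of $\int\varphi\,d\mu$ over the set of $\sigma$-invariant probability measures $\mu$ (or equivalently of the Birkhoff averages of $\varphi$ along periodic orbits). Then for every $t\in(\alpha,\beta)$ the following holds: (1) There is a $\sigma$-invariant compact set $K_t\subset\Sigma$ with positive topological entropy such that the Birkhoff average $\lim_{n\to\infty}\frac1n\sum_{i=0}^{n-1}\varphi(\sigma^i(x))$ of $\varphi$ along the orbit of any point $x\in K_t$ is $t$. (2) There is an ergodic $\sigma$-invariant measure $\mu_t$ with full support in $\Sigma$ such that $\int\varphi\,d\mu_t=t$.
   Context: Sub-shifts here are two-sided, so that $\sigma$ is a homeomorphism of the compact space $\Sigma$. *)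

theory Defs
  imports "HOL-Probability.Probability"
begin

section \<open>Dynamics on topological and measure spaces\<close>

definition birkhoff_average :: "('b \<Rightarrow> 'b) \<Rightarrow> ('b \<Rightarrow> real) \<Rightarrow> nat \<Rightarrow> 'b \<Rightarrow> real" where
  "birkhoff_average T \<phi> n x = (1 / real n) * (\<Sum>i<n. \<phi> ((T ^^ i) x))"

definition periodic_orbit_averages ::
    "'b set \<Rightarrow> ('b \<Rightarrow> 'b) \<Rightarrow> ('b \<Rightarrow> real) \<Rightarrow> real set" where
  "periodic_orbit_averages X T \<phi> =
     {birkhoff_average T \<phi> n x | n x. x \<in> X \<and> n > 0 \<and> (T ^^ n) x = x}"

definition topologically_mixing_on :: "'b::topological_space set \<Rightarrow> ('b \<Rightarrow> 'b) \<Rightarrow> bool" where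
  "topologically_mixing_on X T \<longleftrightarrow>
     (\<forall>U V. openin (top_of_set X) U \<and> openin (top_of_set X) V \<and> U \<noteq> {} \<and> V \<noteq> {} \<longrightarrow>
        (\<exists>N. \<forall>n\<ge>N. (T ^^ n) ` U \<inter> V \<noteq> {}))"

text \<open>Topological entropy of \<open>T\<close> on a compact set \<open>K\<close> with \<open>T ` K \<subseteq> K\<close>, in the open cover
  formulation of Adler, Konheim and McAndrew. \<open>cover_join T K \<C> n\<close> is the common refinement
  of the preimages of \<open>\<C>\<close> under the iterates \<open>T ^^ i\<close>, \<open>i < n\<close>.\<close>

definition open_covers :: "'b::topological_space set \<Rightarrow> 'b set set set" where
  "open_covers K = {\<C>. (\<forall>U\<in>\<C>. openin (top_of_set K) U) \<and> \<Union>\<C> = K}"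

definition cover_join :: "('b \<Rightarrow> 'b) \<Rightarrow> 'b set \<Rightarrow> 'b set set \<Rightarrow> nat \<Rightarrow> 'b set set" where
  "cover_join T K \<C> n = {K \<inter> (\<Inter>i<n. (T ^^ i) -` c i) | c. \<forall>i<n. c i \<in> \<C>}"

definition cover_number :: "'b set \<Rightarrow> 'b set set \<Rightarrow> nat" where
  "cover_number K \<C> = (LEAST m. \<exists>\<D>\<subseteq>\<C>. finite \<D> \<and> card \<D> = m \<and> K \<subseteq> \<Union>\<D>)"

text \<open>By subadditivity the sequence below converges, so \<open>limsup\<close> is its limit.\<close>

definition cover_entropy :: "('b \<Rightarrow> 'b) \<Rightarrow> 'b set \<Rightarrow> 'b set set \<Rightarrow> ereal" where
  "cover_entropy T K \<C> =
     limsup (\<lambda>n. ereal (ln (real (cover_number K (cover_join T K \<C> n))) / real n))"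

definition topological_entropy :: "'b::topological_space set \<Rightarrow> ('b \<Rightarrow> 'b) \<Rightarrow> ereal" where
  "topological_entropy K T = (SUP \<C>\<in>open_covers K. cover_entropy T K \<C>)"

definition invariant_measures :: "'b::topological_space set \<Rightarrow> ('b \<Rightarrow> 'b) \<Rightarrow> 'b measure set" where
  "invariant_measures X T =
     {M. sets M = sets (restrict_space borel X) \<and> prob_space M \<and>
         T \<in> measurable M M \<and> distr M M T = M}"

definition ergodic_measures :: "'b::topological_space set \<Rightarrow> ('b \<Rightarrow> 'b) \<Rightarrow> 'b measure set" where
  "ergodic_measures X T =
     {M \<in> invariant_measures X T.
        \<forall>B\<in>sets M. T -` B \<inter> space M = B \<longrightarrow> measure M B = 0 \<or> measure M B = 1}"

definition measure_support :: "'b::topological_space measure \<Rightarrow> 'b set" where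
  "measure_support M =
     {x \<in> space M. \<forall>U. open U \<and> x \<in> U \<longrightarrow> emeasure M (U \<inter> space M) > 0}"

section \<open>Two-sided subshifts of finite type\<close>

text \<open>Letters come from a type with the discrete topology, which need not be finite; each
  subshift uses a finite set \<open>A\<close> of letters. The topology on \<^typ>\<open>int \<Rightarrow> 'a\<close> is the product
  topology.\<close>

definition left_shift :: "(int \<Rightarrow> 'a) \<Rightarrow> int \<Rightarrow> 'a" where
  "left_shift x = (\<lambda>i. x (i + 1))"

definition occurs_in :: "'a list \<Rightarrow> (int \<Rightarrow> 'a) \<Rightarrow> bool" where
  "occurs_in w x \<longleftrightarrow> (\<exists>i. \<forall>k<length w. x (i + int k) = w ! k)"

definition subshift_of_finite_type :: "(int \<Rightarrow> 'a) set \<Rightarrow> bool" where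
  "subshift_of_finite_type X \<longleftrightarrow> X \<noteq> {} \<and>
     (\<exists>A F. finite A \<and> finite F \<and> F \<subseteq> lists A \<and>
        X = {x. range x \<subseteq> A \<and> (\<forall>w\<in>F. \<not> occurs_in w x)})"

end

theory Submission
  imports Defs
begin

text \<open>
  Mixing gives a gluing property: any finite piece of a point lies in a loop, that is, a word that
  leads from a fixed window back to it, with exactly \<open>2 * N\<close> letters to spare. Bi-infinite
  concatenations of loops are again points of the subshift. An orbit sum of \<open>\<phi>\<close> over \<open>n\<close> steps is
  determined by the letters in these steps up to an error \<open>o(n)\<close>. Hence for every invariant measure
  \<open>\<mu>\<close> and \<open>c < \<integral>\<phi> d\<mu>\<close> there are loops all of whose occurrences have \<open>\<phi>\<close>-average at least \<open>c\<close>
  (\<open>ex_loop_above\<close>); repeating such a loop periodically shows that periodic orbits give the same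
  supremum as invariant measures. The supremum is attained (\<open>ex_maximizing_measure\<close>) by a cluster
  point of almost maximizing measures, regarded as set functions on the algebra of sets that depend
  on finitely many coordinates; countable additivity is automatic there, by compactness.

  For \<open>\<alpha> < t < \<beta>\<close>, replace \<open>\<phi>\<close> by \<open>\<phi> - t\<close> and take loops \<open>P\<close> and \<open>Q\<close> of equal length with
  positive and negative averages in all their occurrences.

  The compact set (\<open>ex_compact_zero_averages\<close>). Consider concatenations of \<open>P\<close> and \<open>Q\<close> in which a
  periodic set of places is filled by free bits, and the other places by control bits, the latter
  being so numerous that they decide the signs of block sums. By a discrete intermediate value
  argument, control bits can be chosen at one scale after the other (\<open>steering_step\<close>,
  \<open>steering\<close>) such that block averages tend to \<open>0\<close> at a rate independent of the free bits. All
  points that obey these rates form a compact invariant set on which averages tend to \<open>0\<close>, and the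
  free bits give it positive entropy.

  The ergodic measure (\<open>ex_ergodic_zero_integral\<close>). Concatenate independent random loops: mostly
  \<open>P\<close> with probability \<open>\<theta>\<close> and \<open>Q\<close> otherwise, but every loop with positive probability, so that
  every word occurs. The iid shift is ergodic (\<open>iid_ergodic\<close>), hence so is the tower measure over it
  (\<open>ex_tower_measure\<close>). Its integral is continuous in \<open>\<theta>\<close> and changes sign, so it vanishes for
  some \<open>\<theta>\<close>.
\<close>


section \<open>Translations and orbit sums\<close>

text \<open>The \<open>k\<close>-th power of the left shift, for any integer \<open>k\<close>.\<close>

definition translate :: "int \<Rightarrow> (int \<Rightarrow> 'a) \<Rightarrow> int \<Rightarrow> 'a" where
  "translate k x = (\<lambda>i. x (i + k))"

lemma translate_apply [simp]: "translate k x i = x (i + k)"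
  by (simp add: translate_def)

lemma translate_0 [simp]: "translate 0 x = x"
  by (simp add: translate_def)

lemma translate_translate [simp]: "translate j (translate k x) = translate (j + k) x"
  by (simp add: translate_def algebra_simps)

lemma left_shift_eq_translate: "left_shift = translate 1"
  by (simp add: left_shift_def translate_def fun_eq_iff)

lemma left_shift_funpow: "left_shift ^^ n = translate (int n)"
  by (induction n) (simp_all add: left_shift_eq_translate fun_eq_iff algebra_simps)

lemma continuous_on_translate: "continuous_on S (translate k :: (int \<Rightarrow> 'a::topological_space) \<Rightarrow> _)"
  unfolding translate_def
  by (intro continuous_on_coordinatewise_then_product
        continuous_on_subset[OF continuous_on_product_coordinates]) auto

text \<open>The sum of \<open>f\<close> over the piece of the orbit of \<open>x\<close> with times in \<open>[i, j)\<close>.\<close>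

definition orbit_sum :: "((int \<Rightarrow> 'a) \<Rightarrow> real) \<Rightarrow> (int \<Rightarrow> 'a) \<Rightarrow> int \<Rightarrow> int \<Rightarrow> real" where
  "orbit_sum f x i j = (\<Sum>p\<in>{i..<j}. f (translate p x))"

lemma orbit_sum_append:
  "i \<le> j \<Longrightarrow> j \<le> k \<Longrightarrow> orbit_sum f x i k = orbit_sum f x i j + orbit_sum f x j k"
  unfolding orbit_sum_def
  by (subst sum.union_disjoint[symmetric]) (auto intro!: sum.cong)

lemma orbit_sum_translate:
  "orbit_sum f (translate k x) i j = orbit_sum f x (i + k) (j + k)"
  unfolding orbit_sum_def
  by (rule sum.reindex_bij_witness[of _ "\<lambda>p. p - k" "\<lambda>p. p + k"]) auto

lemma orbit_sum_empty [simp]: "orbit_sum f x i i = 0"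
  by (simp add: orbit_sum_def)

lemma orbit_sum_eq_birkhoff_average:
  "birkhoff_average left_shift f n x = orbit_sum f x 0 (int n) / real n"
proof -
  have "(\<Sum>i<n. f ((left_shift ^^ i) x)) = orbit_sum f x 0 (int n)"
    unfolding orbit_sum_def left_shift_funpow
    by (rule sum.reindex_bij_witness[of _ nat int]) auto
  thus ?thesis by (simp add: birkhoff_average_def)
qed

lemma orbit_sum_bound:
  assumes "\<And>p. i \<le> p \<Longrightarrow> p < j \<Longrightarrow> \<bar>f (translate p x)\<bar> \<le> C" and "i \<le> j"
  shows "\<bar>orbit_sum f x i j\<bar> \<le> C * real_of_int (j - i)"
proof -
  have "\<bar>orbit_sum f x i j\<bar> \<le> (\<Sum>p\<in>{i..<j}. C)"
    unfolding orbit_sum_def by (rule order_trans[OF sum_abs sum_mono]) (use assms in auto)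
  thus ?thesis using \<open>i \<le> j\<close> by (simp add: mult.commute)
qed

lemma orbit_sum_uminus: "orbit_sum (\<lambda>x. - f x) x i j = - orbit_sum f x i j"
  by (simp add: orbit_sum_def sum_negf)

section \<open>Bi-infinite concatenations of words\<close>

text \<open>\<open>start u n\<close> is the position at which the word \<open>u n\<close> begins when the words
  \<open>u i\<close>, for all integers \<open>i\<close>, are written one after the other and \<open>u 0\<close> begins at position \<open>0\<close>.
  Of the two sums below at most one is nonempty.\<close>

definition start :: "(int \<Rightarrow> 'a list) \<Rightarrow> int \<Rightarrow> int" where
  "start u n = (\<Sum>i\<in>{0..<n}. int (length (u i))) - (\<Sum>i\<in>{n..<0}. int (length (u i)))"

lemma start_0 [simp]: "start u 0 = 0"
  by (simp add: start_def)

lemma start_Suc: "start u (n + 1) = start u n + int (length (u n))"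
proof (cases "n \<ge> 0")
  case True
  hence "{0..<n + 1} = insert n {0..<n}" by auto
  with True show ?thesis by (simp add: start_def)
next
  case False
  hence "{n..<0} = insert n {n + 1..<0}" by auto
  with False show ?thesis by (simp add: start_def)
qed

text \<open>The index of the word that covers the position \<open>j\<close>, and the resulting sequence.\<close>

definition block_at :: "(int \<Rightarrow> 'a list) \<Rightarrow> int \<Rightarrow> int" where
  "block_at u j = (THE n. start u n \<le> j \<and> j < start u (n + 1))"

definition concatenation :: "(int \<Rightarrow> 'a list) \<Rightarrow> int \<Rightarrow> 'a" where
  "concatenation u j = u (block_at u j) ! nat (j - start u (block_at u j))"

context
  fixes u :: "int \<Rightarrow> 'a list"
  assumes nonempty: "\<And>n. u n \<noteq> []"
begin

lemma start_diff_ge: "m \<le> n \<Longrightarrow> start u n - start u m \<ge> n - m"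
proof (induction n rule: int_ge_induct)
  case (step n)
  have "length (u n) \<ge> 1" using nonempty[of n] by (cases "u n") auto
  with step show ?case by (simp add: start_Suc)
qed simp

lemma start_mono: "m \<le> n \<Longrightarrow> start u m \<le> start u n"
  using start_diff_ge[of m n] by simp

lemma ex_block: "\<exists>n. start u n \<le> j \<and> j < start u (n + 1)"
proof -
  have ge: "start u n \<ge> n" if "n \<ge> 0" for n
    using start_diff_ge[of 0 n] that by simp
  have le: "start u n \<le> n" if "n \<le> 0" for n
    using start_diff_ge[of n 0] that by simp
  define S where "S = {n. start u n \<le> j \<and> - \<bar>j\<bar> \<le> n}"
  have "n \<le> \<bar>j\<bar>" if "n \<in> S" for n
    using ge[of n] that by (cases "n \<ge> 0") (auto simp: S_def)
  hence "S \<subseteq> {- \<bar>j\<bar>..\<bar>j\<bar>}" by (auto simp: S_def)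
  hence fin: "finite S" by (rule finite_subset) auto
  have "- \<bar>j\<bar> \<in> S" using le[of "- \<bar>j\<bar>"] by (auto simp: S_def)
  hence "S \<noteq> {}" by auto
  hence "Max S \<in> S" using fin by (rule Max_in[rotated])
  moreover have "Max S + 1 \<notin> S" using Max_ge[OF fin, of "Max S + 1"] by auto
  ultimately have "start u (Max S) \<le> j \<and> j < start u (Max S + 1)"
    by (auto simp: S_def)
  thus ?thesis by blast
qed

lemma block_at_eqI:
  assumes "start u n \<le> j" "j < start u (n + 1)"
  shows "block_at u j = n"
  unfolding block_at_def
proof (rule the_equality)
  fix m assume m: "start u m \<le> j \<and> j < start u (m + 1)"
  show "m = n"
    using assms m start_mono[of "m + 1" n] start_mono[of "n + 1" m] by linarith
qed (use assms in auto)

lemma concatenation_eq: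
  assumes "k < length (u n)"
  shows "concatenation u (start u n + int k) = u n ! k"
proof -
  have "block_at u (start u n + int k) = n"
    by (rule block_at_eqI) (use assms in \<open>auto simp: start_Suc\<close>)
  thus ?thesis by (simp add: concatenation_def)
qed

end

text \<open>Dropping the first \<open>m\<close> words translates the concatenation by their total length.\<close>

lemma concatenation_translate:
  fixes u :: "int \<Rightarrow> 'a list"
  assumes ne: "\<And>n. u n \<noteq> []"
  shows "concatenation (\<lambda>n. u (n + m)) = translate (start u m) (concatenation u)"
proof
  let ?v = "\<lambda>n. u (n + m)"
  have st: "start ?v n = start u (n + m) - start u m" for n
  proof (induction n rule: int_induct[where k = 0])
    case (step1 i)
    thus ?case using start_Suc[of ?v i] start_Suc[of u "i + m"] by (simp add: algebra_simps)
  next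
    case (step2 i)
    thus ?case using start_Suc[of ?v "i - 1"] start_Suc[of u "i - 1 + m"] by (simp add: algebra_simps)
  qed simp
  fix j
  obtain n where n: "start ?v n \<le> j" "j < start ?v (n + 1)"
    using ex_block[of ?v j] ne by auto
  define k where "k = nat (j - start ?v n)"
  have k: "k < length (u (n + m))" "j = start ?v n + int k"
    using n start_Suc[of ?v n] by (auto simp: k_def)
  have "concatenation ?v j = u (n + m) ! k"
    using concatenation_eq[of ?v k n] ne k by simp
  also have "\<dots> = concatenation u (start u (n + m) + int k)"
    using concatenation_eq[of u k "n + m"] ne k by simp
  also have "start u (n + m) + int k = j + start u m" using k st[of n] by simp
  finally show "concatenation ?v j = translate (start u m) (concatenation u) j" by simp
qed

lemma start_const_length:
  assumes "\<And>n. length (u n) = L"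
  shows "start u n = n * int L"
proof (induction n rule: int_induct[where k = 0])
  case (step1 i)
  thus ?case using start_Suc[of u i] assms by (simp add: algebra_simps)
next
  case (step2 i)
  thus ?case using start_Suc[of u "i - 1"] assms by (simp add: algebra_simps)
qed simp


section \<open>Mixing shift spaces with a local rule\<close>

text \<open>A closed translation invariant set of sequences over the finite alphabet \<open>A\<close> which contains
  every sequence all of whose windows of length \<open>w\<close> occur in it, and in which any two windows of
  length \<open>w\<close> occur in one point at distance exactly \<open>N\<close>. That the set is closed follows from
  these conditions.\<close>

locale mixing_shift =
  fixes X :: "(int \<Rightarrow> 'a::discrete_topology) set" and A :: "'a set" and w N :: int
  assumes finite_alphabet: "finite A"
    and letters: "\<And>x i. x \<in> X \<Longrightarrow> x i \<in> A"
    and nonempty: "X \<noteq> {}"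
    and translate_mem: "\<And>x k. x \<in> X \<Longrightarrow> translate k x \<in> X"
    and window_pos: "w > 0"
    and local_rule: "\<And>x. (\<And>i. \<exists>y\<in>X. \<forall>k\<in>{0..<w}. x (i + k) = y k) \<Longrightarrow> x \<in> X"
    and gap: "N \<ge> w"
    and connect: "\<And>x y. x \<in> X \<Longrightarrow> y \<in> X \<Longrightarrow>
      \<exists>z\<in>X. (\<forall>k\<in>{0..<w}. z k = x k) \<and> (\<forall>k\<in>{0..<w}. z (N + k) = y k)"

lemma open_if_finite_coordinates:
  fixes U :: "(int \<Rightarrow> 'a::discrete_topology) set"
  assumes "finite J" and "\<And>x y. x \<in> U \<Longrightarrow> (\<forall>i\<in>J. y i = x i) \<Longrightarrow> y \<in> U"
  shows "open U"
proof (subst open_subopen, intro ballI)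
  fix x assume x: "x \<in> U"
  have "open {x i}" for i by (rule discrete_topology_class.open_discrete)
  hence "open {y. \<forall>i\<in>J. y i \<in> {x i}}"
    using product_topology_basis'[OF assms(1), where U = "\<lambda>i. {x i}" and x = "\<lambda>i. i"] by blast
  moreover have "{y. \<forall>i\<in>J. y i \<in> {x i}} \<subseteq> U" using assms(2)[OF x] by auto
  ultimately show "\<exists>T. open T \<and> x \<in> T \<and> T \<subseteq> U" by blast
qed

lemma closed_if_finite_coordinates:
  fixes U :: "(int \<Rightarrow> 'a::discrete_topology) set"
  assumes "finite J" and "\<And>x y. x \<in> U \<Longrightarrow> (\<forall>i\<in>J. y i = x i) \<Longrightarrow> y \<in> U"
  shows "closed U"
  unfolding closed_def
proof (rule open_if_finite_coordinates[OF assms(1)])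
  fix x y assume "x \<in> - U" "\<forall>i\<in>J. y i = x i"
  thus "y \<in> - U" using assms(2)[of y x] by auto
qed

lemma open_contains_cylinder:
  fixes U :: "(int \<Rightarrow> 'a::topological_space) set"
  assumes "open U" "x \<in> U"
  obtains r :: nat where "\<And>y. (\<forall>i\<in>{-int r..int r}. y i = x i) \<Longrightarrow> y \<in> U"
proof -
  from assms have "openin (product_topology (\<lambda>i. euclidean) UNIV) U" by (simp add: open_fun_def)
  from product_topology_open_contains_basis[OF this \<open>x \<in> U\<close>]
  obtain V where V: "x \<in> (\<Pi>\<^sub>E i\<in>UNIV. V i)" "finite {i. V i \<noteq> UNIV}" "(\<Pi>\<^sub>E i\<in>UNIV. V i) \<subseteq> U"
    by auto
  define r where "r = nat (Max (insert 0 (abs ` {i. V i \<noteq> UNIV})))"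
  have r: "i \<in> {-int r..int r}" if "V i \<noteq> UNIV" for i
  proof -
    have "\<bar>i\<bar> \<le> Max (insert 0 (abs ` {i. V i \<noteq> UNIV}))"
      by (rule Max_ge) (use V that in auto)
    thus ?thesis by (auto simp: r_def)
  qed
  show ?thesis
  proof
    fix y assume y: "\<forall>i\<in>{-int r..int r}. y i = x i"
    have "y i \<in> V i" for i
      using V(1) y r[of i] by (cases "V i = UNIV") (auto simp: PiE_iff)
    thus "y \<in> U" using V(3) by auto
  qed
qed

lemma (in mixing_shift) closed: "closed X"
proof -
  define W where "W i = {x. \<exists>y\<in>X. \<forall>k\<in>{0..<w}. x (i + k) = y k}" for i :: int
  have "X = (\<Inter>i. W i)"
  proof
    show "X \<subseteq> (\<Inter>i. W i)"
    proof (intro subsetI INT_I)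
      fix x i assume "x \<in> X"
      hence "translate i x \<in> X" by (rule translate_mem)
      thus "x \<in> W i" by (auto simp: W_def add.commute intro!: bexI[of _ "translate i x"])
    qed
    show "(\<Inter>i. W i) \<subseteq> X" using local_rule by (auto simp: W_def)
  qed
  moreover have "closed (W i)" for i
  proof (rule closed_if_finite_coordinates[of "{i..<i + w}"])
    fix x y assume "x \<in> W i" "\<forall>j\<in>{i..<i + w}. y j = x j"
    thus "y \<in> W i" by (auto simp: W_def)
  qed simp
  ultimately show ?thesis by auto
qed

lemma (in mixing_shift) compact: "compact X"
proof -
  have "compactin (product_topology (\<lambda>i::int. euclidean) UNIV) (PiE UNIV (\<lambda>_. A))"
    unfolding compactin_PiE using finite_imp_compact[OF finite_alphabet] by auto
  hence "compact (PiE (UNIV::int set) (\<lambda>_. A))"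
    by (simp add: euclidean_product_topology)
  moreover have "X = PiE UNIV (\<lambda>_. A) \<inter> X" using letters by auto
  ultimately show ?thesis using closed by (metis compact_Int_closed)
qed

text \<open>Two points that agree on a window of length \<open>w\<close> can be glued there.\<close>

lemma (in mixing_shift) glue:
  assumes "x \<in> X" "y \<in> X" and "\<And>k. k \<in> {a..<a + w} \<Longrightarrow> x k = y k"
  shows "(\<lambda>k. if k < a + w then x k else y k) \<in> X"
proof (rule local_rule)
  fix i
  let ?z = "\<lambda>k. if k < a + w then x k else y k"
  show "\<exists>v\<in>X. \<forall>k\<in>{0..<w}. ?z (i + k) = v k"
  proof (cases "i \<le> a")
    case True
    have "\<forall>k\<in>{0..<w}. ?z (i + k) = translate i x k" using True by (auto simp: add.commute)
    thus ?thesis using translate_mem[OF assms(1)] by blast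
  next
    case False
    have "\<forall>k\<in>{0..<w}. ?z (i + k) = translate i y k"
      using False assms(3) by (auto simp: add.commute)
    thus ?thesis using translate_mem[OF assms(2)] by blast
  qed
qed

section \<open>Loops\<close>

context mixing_shift
begin

text \<open>An arbitrary reference point.\<close>

definition base :: "int \<Rightarrow> 'a" where
  "base = (SOME x. x \<in> X)"

lemma base_mem: "base \<in> X"
  unfolding base_def using nonempty by (simp add: some_in_eq)

text \<open>The window of \<open>base\<close> at \<open>[0, w)\<close> plays the part of a vertex: a loop is a word that leads from
  this window to another copy of it.\<close>

definition loop :: "'a list \<Rightarrow> bool" where
  "loop l \<longleftrightarrow> w \<le> int (length l) \<and> (\<exists>x\<in>X. (\<forall>k<length l. x (int k) = l ! k) \<and>
     (\<forall>k\<in>{0..<w}. x k = base k) \<and> (\<forall>k\<in>{0..<w}. x (int (length l) + k) = base k))"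

lemma loop_nonempty: "loop l \<Longrightarrow> l \<noteq> []"
  using window_pos by (auto simp: loop_def)

lemma loop_nth_base: "loop l \<Longrightarrow> k \<in> {0..<w} \<Longrightarrow> l ! nat k = base k"
  by (auto simp: loop_def) (metis (no_types) atLeastLessThan_iff int_nat_eq linorder_not_less nat_less_iff order.strict_trans2)

text \<open>Every window of a concatenation of loops is a window of the point that witnesses one of
  the loops, because the next loop begins with the base window.\<close>

lemma concatenation_mem:
  assumes "\<And>n. loop (u n)"
  shows "concatenation u \<in> X"
proof (rule local_rule)
  have ne: "\<And>n. u n \<noteq> []" using assms loop_nonempty by blast
  fix i
  obtain n where n: "start u n \<le> i" "i < start u (n + 1)" using ex_block[of u i] ne by auto
  obtain x where x: "x \<in> X" "\<And>k. k < length (u n) \<Longrightarrow> x (int k) = u n ! k"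
      "\<And>k. k \<in> {0..<w} \<Longrightarrow> x (int (length (u n)) + k) = base k"
    using assms[of n] by (auto simp: loop_def)
  have "concatenation u (start u n + k) = x k" if "0 \<le> k" "k < int (length (u n)) + w" for k
  proof (cases "k < int (length (u n))")
    case True
    thus ?thesis using concatenation_eq[of u "nat k" n] ne x(2)[of "nat k"] that by simp
  next
    case False
    define k' where "k' = nat (k - int (length (u n)))"
    have k': "int k' \<in> {0..<w}" "k = int (length (u n)) + int k'" using False that by (auto simp: k'_def)
    have "k' < length (u (n + 1))" using k' assms[of "n + 1"] by (auto simp: loop_def)
    hence "concatenation u (start u (n + 1) + int k') = u (n + 1) ! k'"
      using concatenation_eq[of u k' "n + 1"] ne by blast
    also have "\<dots> = x k" using loop_nth_base[OF assms[of "n + 1"] k'(1)] x(3)[OF k'(1)] k'(2) by simp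
    finally show ?thesis using start_Suc[of u n] k'(2) by (simp add: add.assoc)
  qed
  from this[of "i - start u n + _"]
  have "\<forall>k\<in>{0..<w}. concatenation u (i + k) = translate (i - start u n) x k"
    using n start_Suc[of u n] by (auto simp: algebra_simps)
  thus "\<exists>y\<in>X. \<forall>k\<in>{0..<w}. concatenation u (i + k) = y k" using translate_mem[OF x(1)] by blast
qed

text \<open>Any finite piece of a point lies in a loop, with exactly \<open>2 * N\<close> letters to spare.\<close>

lemma ex_loop:
  assumes x: "x \<in> X"
  obtains l where "loop l" "int (length l) = int n + 2 * N" "\<And>k. k < n \<Longrightarrow> l ! (nat N + k) = x (int k)"
proof -
  obtain y where y: "y \<in> X" "\<And>k. k \<in> {0..<w} \<Longrightarrow> y k = base k" "\<And>k. k \<in> {0..<w} \<Longrightarrow> y (N + k) = x k"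
    using connect[OF base_mem x] by auto
  obtain z where z: "z \<in> X" "\<And>k. k \<in> {0..<w} \<Longrightarrow> z k = translate (int n) x k"
      "\<And>k. k \<in> {0..<w} \<Longrightarrow> z (N + k) = base k"
    using connect[OF translate_mem[OF x, of "int n"] base_mem] by auto
  define a where "a = (\<lambda>k. if k < N + w then y k else translate (-N) x k)"
  have a: "a \<in> X" unfolding a_def
    by (rule glue[OF y(1) translate_mem[OF x]]) (use y(3)[of "_ - N"] in auto)
  have ax: "a (N + k) = x k" if "k \<ge> 0" for k
    using y(3)[of k] that by (auto simp: a_def)
  define b where "b = (\<lambda>k. if k < N + int n + w then a k else translate (-N - int n) z k)"
  have b: "b \<in> X" unfolding b_def
  proof (rule glue[OF a translate_mem[OF z(1)]])
    fix k assume k: "k \<in> {N + int n..<N + int n + w}"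
    have "a k = x (k - N)" using ax[of "k - N"] k by simp
    also have "\<dots> = z (k - N - int n)" using z(2)[of "k - N - int n"] k by simp
    finally show "a k = translate (-N - int n) z k" by (simp add: algebra_simps)
  qed
  have bx: "b (N + k) = x k" if "k \<ge> 0" "k < int n" for k
    using ax[of k] that window_pos by (auto simp: b_def)
  have b0: "b k = base k" if "k \<in> {0..<w}" for k
    using that y(2)[OF that] gap by (auto simp: b_def a_def)
  have b1: "b (int n + 2 * N + k) = base k" if "k \<in> {0..<w}" for k
    using that z(3)[OF that] gap by (auto simp: b_def algebra_simps)
  define l where "l = map (\<lambda>k. b (int k)) [0..<nat (int n + 2 * N)]"
  have N: "N > 0" using gap window_pos by simp
  have len: "int (length l) = int n + 2 * N" using N by (simp add: l_def)
  show ?thesis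
  proof
    show "loop l" unfolding loop_def
    proof (intro conjI bexI[of _ b] ballI allI impI)
      show "w \<le> int (length l)" using len gap N by linarith
      show "b (int k) = l ! k" if "k < length l" for k using that by (simp add: l_def)
      show "b k = base k" if "k \<in> {0..<w}" for k using b0[OF that] .
      show "b (int (length l) + k) = base k" if "k \<in> {0..<w}" for k using b1[OF that] len by simp
    qed (rule b)
    show "l ! (nat N + k) = x (int k)" if "k < n" for k
    proof -
      have "nat N + k < nat (int n + 2 * N)" "int (nat N + k) = N + int k" using that N by auto
      thus ?thesis using that bx[of "int k"] by (simp add: l_def)
    qed
  qed (rule len)
qed

end


section \<open>Continuous observables\<close>

text \<open>A continuous function on the shift space, with a bound for its absolute value.\<close>

locale shift_observable = mixing_shift X A w N
  for X :: "(int \<Rightarrow> 'a::discrete_topology) set" and A w N +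
  fixes f :: "(int \<Rightarrow> 'a) \<Rightarrow> real" and C :: real
  assumes cont: "continuous_on X f"
    and bound: "\<And>x. x \<in> X \<Longrightarrow> \<bar>f x\<bar> \<le> C"

context shift_observable
begin

lemma bound_nonneg: "C \<ge> 0"
  using bound nonempty by (metis abs_ge_zero all_not_in_conv order_trans)

lemma uniformly_continuous:
  assumes "e > 0"
  obtains r :: nat where
    "\<And>x y. x \<in> X \<Longrightarrow> y \<in> X \<Longrightarrow> (\<forall>i\<in>{-int r..int r}. x i = y i) \<Longrightarrow> \<bar>f x - f y\<bar> < e"
proof -
  have "\<exists>r::nat. \<forall>y\<in>X. (\<forall>i\<in>{-int r..int r}. y i = x i) \<longrightarrow> \<bar>f y - f x\<bar> < e / 2" if x: "x \<in> X" for x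
  proof -
    have "open (ball (f x) (e / 2))" "f x \<in> ball (f x) (e / 2)" using \<open>e > 0\<close> by auto
    then obtain U where U: "open U" "x \<in> U" "\<And>y. y \<in> X \<Longrightarrow> y \<in> U \<Longrightarrow> f y \<in> ball (f x) (e / 2)"
      using cont[unfolded continuous_on_topological] x by metis
    obtain r :: nat where r: "\<And>y. (\<forall>i\<in>{-int r..int r}. y i = x i) \<Longrightarrow> y \<in> U"
      using open_contains_cylinder[OF U(1,2)] by blast
    show ?thesis using U(3) r by (intro exI[of _ r]) (auto simp: dist_real_def abs_minus_commute)
  qed
  then obtain r where r: "\<And>x y. x \<in> X \<Longrightarrow> y \<in> X \<Longrightarrow>
      (\<forall>i\<in>{-int (r x)..int (r x)}. y i = x i) \<Longrightarrow> \<bar>f y - f x\<bar> < e / 2" by metis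
  define V where "V x = {y. \<forall>i\<in>{-int (r x)..int (r x)}. y i = x i}" for x
  have "open (V x)" for x
    by (rule open_if_finite_coordinates[of "{-int (r x)..int (r x)}"]) (auto simp: V_def)
  moreover have "X \<subseteq> (\<Union>x\<in>X. V x)" by (auto simp: V_def)
  ultimately obtain F where F: "F \<subseteq> X" "finite F" "X \<subseteq> (\<Union>x\<in>F. V x)"
    using compactE_image[OF compact, of X V] by metis
  \<comment> \<open>Finitely many cylinders cover \<open>X\<close>, and every point shares its cylinder with the points that
    agree with it on the largest of the radii.\<close>
  define R where "R = Max (insert 0 (r ` F))"
  have R: "r z \<le> R" if "z \<in> F" for z unfolding R_def using F(2) that by (intro Max_ge) auto
  show ?thesis
  proof
    fix x y assume xy: "x \<in> X" "y \<in> X" "\<forall>i\<in>{-int R..int R}. x i = y i"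
    obtain z where z: "z \<in> F" "x \<in> V z" using F(3) xy(1) by auto
    have "y i = z i" if "i \<in> {-int (r z)..int (r z)}" for i
    proof -
      have "i \<in> {-int R..int R}" using that R[OF z(1)] by auto
      hence "x i = y i" using xy(3) by blast
      thus ?thesis using z(2) that by (auto simp: V_def)
    qed
    hence "\<bar>f y - f z\<bar> < e / 2" using r z(1) F(1) xy(2) by blast
    moreover have "\<bar>f x - f z\<bar> < e / 2" using r[of z x] z F(1) xy(1) by (auto simp: V_def)
    ultimately show "\<bar>f x - f y\<bar> < e" by linarith
  qed
qed

text \<open>An orbit sum over \<open>[i, j)\<close> is determined, up to an error that is sublinear in \<open>j - i\<close>, by the
  letters at the positions in \<open>[i, j)\<close>.\<close>

lemma orbit_sum_context:
  assumes "e > 0"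
  obtains R where "R \<ge> 0" "\<And>x y i j. x \<in> X \<Longrightarrow> y \<in> X \<Longrightarrow> i \<le> j \<Longrightarrow> (\<forall>k\<in>{i..<j}. x k = y k) \<Longrightarrow>
    \<bar>orbit_sum f x i j - orbit_sum f y i j\<bar> \<le> e * real_of_int (j - i) + R"
proof -
  obtain r :: nat where r: "\<And>x y. x \<in> X \<Longrightarrow> y \<in> X \<Longrightarrow> (\<forall>i\<in>{-int r..int r}. x i = y i) \<Longrightarrow> \<bar>f x - f y\<bar> < e"
    using uniformly_continuous[OF assms] by blast
  \<comment> \<open>Only the \<open>2 * r\<close> times within \<open>r\<close> of an end of the interval see letters outside it.\<close>
  show ?thesis
  proof
    show "4 * C * real r \<ge> 0" using bound_nonneg by simp
    fix x y :: "int \<Rightarrow> 'a" and i j :: int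
    assume xy: "x \<in> X" "y \<in> X" "i \<le> j" "\<forall>k\<in>{i..<j}. x k = y k"
    define B where "B = {i..<i + int r} \<union> {j - int r..<j}"
    have "\<bar>f (translate p x) - f (translate p y)\<bar> \<le> e + (if p \<in> B then 2 * C else 0)"
      if p: "p \<in> {i..<j}" for p
    proof (cases "p \<in> B")
      case True
      have "\<bar>f (translate p x)\<bar> \<le> C" "\<bar>f (translate p y)\<bar> \<le> C"
        using bound translate_mem xy by blast+
      with True assms show ?thesis by simp
    next
      case False
      have "\<forall>k\<in>{-int r..int r}. translate p x k = translate p y k"
        using False p xy(4) by (auto simp: B_def)
      hence "\<bar>f (translate p x) - f (translate p y)\<bar> < e"
        by (rule r[OF translate_mem[OF xy(1)] translate_mem[OF xy(2)]])
      moreover have "(if p \<in> B then 2 * C else 0) = 0" using False by (rule if_not_P)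
      ultimately show ?thesis by linarith
    qed
    hence "\<bar>orbit_sum f x i j - orbit_sum f y i j\<bar> \<le> (\<Sum>p\<in>{i..<j}. e + (if p \<in> B then 2 * C else 0))"
      unfolding orbit_sum_def sum_subtractf[symmetric] by (intro order_trans[OF sum_abs sum_mono]) auto
    also have "\<dots> = e * real_of_int (j - i) + 2 * C * real (card ({i..<j} \<inter> B))"
      using xy(3) by (simp add: sum.distrib sum.If_cases)
    also have "card ({i..<j} \<inter> B) \<le> card B" by (intro card_mono) (auto simp: B_def)
    also have "card B \<le> card {i..<i + int r} + card {j - int r..<j}" by (unfold B_def, rule card_Un_le)
    also have "\<dots> = 2 * r" by simp
    finally show "\<bar>orbit_sum f x i j - orbit_sum f y i j\<bar> \<le> e * real_of_int (j - i) + 4 * C * real r"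
      using bound_nonneg by (simp add: mult_left_mono)
  qed
qed

lemma orbit_sum_le:
  assumes "x \<in> X" "i \<le> j"
  shows "\<bar>orbit_sum f x i j\<bar> \<le> C * real_of_int (j - i)"
  by (rule orbit_sum_bound) (use assms bound translate_mem in auto)

lemma shift_observable_uminus: "shift_observable X A w N (\<lambda>x. - f x) C"
  by unfold_locales (auto intro: continuous_on_minus cont bound)

end


section \<open>The Borel sets of a shift space\<close>

text \<open>The algebra of the subsets of \<open>X\<close> that depend on finitely many coordinates.\<close>

definition finite_coordinate_sets :: "(int \<Rightarrow> 'a) set \<Rightarrow> (int \<Rightarrow> 'a) set set" where
  "finite_coordinate_sets X = {B. B \<subseteq> X \<and>
     (\<exists>r::nat. \<forall>x\<in>X. \<forall>y\<in>X. (\<forall>i\<in>{-int r..int r}. x i = y i) \<longrightarrow> x \<in> B \<longrightarrow> y \<in> B)}"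

lemma finite_coordinate_setsE:
  assumes "B \<in> finite_coordinate_sets X"
  obtains r :: nat where "B \<subseteq> X"
    "\<And>x y s. r \<le> s \<Longrightarrow> x \<in> X \<Longrightarrow> y \<in> X \<Longrightarrow> (\<forall>i\<in>{-int s..int s}. x i = y i) \<Longrightarrow> x \<in> B \<longleftrightarrow> y \<in> B"
proof -
  obtain r :: nat where r: "B \<subseteq> X"
    "\<forall>x\<in>X. \<forall>y\<in>X. (\<forall>i\<in>{-int r..int r}. x i = y i) \<longrightarrow> x \<in> B \<longrightarrow> y \<in> B"
    using assms by (auto simp: finite_coordinate_sets_def)
  show ?thesis
  proof
    fix x y s assume "r \<le> s" "x \<in> X" "y \<in> X" "\<forall>i\<in>{-int s..int s}. x i = y i"
    moreover from this have "\<forall>i\<in>{-int r..int r}. x i = y i" by auto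
    moreover from this have "\<forall>i\<in>{-int r..int r}. y i = x i" by auto
    ultimately show "x \<in> B \<longleftrightarrow> y \<in> B" using r(2) by blast
  qed (rule r(1))
qed

lemma algebra_finite_coordinate_sets: "algebra X (finite_coordinate_sets X)"
proof (rule algebra_iff_Un[THEN iffD2], intro conjI ballI)
  show "finite_coordinate_sets X \<subseteq> Pow X" "{} \<in> finite_coordinate_sets X"
    by (auto simp: finite_coordinate_sets_def)
next
  fix B assume "B \<in> finite_coordinate_sets X"
  then obtain r :: nat where "B \<subseteq> X"
    "\<And>x y s. r \<le> s \<Longrightarrow> x \<in> X \<Longrightarrow> y \<in> X \<Longrightarrow> (\<forall>i\<in>{-int s..int s}. x i = y i) \<Longrightarrow> x \<in> B \<longleftrightarrow> y \<in> B"
    by (rule finite_coordinate_setsE) blast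
  thus "X - B \<in> finite_coordinate_sets X"
    unfolding finite_coordinate_sets_def by (auto intro!: exI[of _ r])
next
  fix B D assume "B \<in> finite_coordinate_sets X" "D \<in> finite_coordinate_sets X"
  obtain r :: nat where r: "B \<subseteq> X"
    "\<And>x y t. r \<le> t \<Longrightarrow> x \<in> X \<Longrightarrow> y \<in> X \<Longrightarrow> (\<forall>i\<in>{-int t..int t}. x i = y i) \<Longrightarrow> x \<in> B \<longleftrightarrow> y \<in> B"
    using \<open>B \<in> _\<close> by (rule finite_coordinate_setsE) blast
  obtain s :: nat where s: "D \<subseteq> X"
    "\<And>x y t. s \<le> t \<Longrightarrow> x \<in> X \<Longrightarrow> y \<in> X \<Longrightarrow> (\<forall>i\<in>{-int t..int t}. x i = y i) \<Longrightarrow> x \<in> D \<longleftrightarrow> y \<in> D"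
    using \<open>D \<in> _\<close> by (rule finite_coordinate_setsE) blast
  show "B \<union> D \<in> finite_coordinate_sets X"
    unfolding finite_coordinate_sets_def
  proof (intro CollectI conjI exI[of _ "max r s"] ballI impI)
    fix x y assume "x \<in> X" "y \<in> X" "\<forall>i\<in>{-int (max r s)..int (max r s)}. x i = y i" "x \<in> B \<union> D"
    thus "y \<in> B \<union> D" using r(2)[OF max.cobounded1] s(2)[OF max.cobounded2] by blast
  qed (use r(1) s(1) in simp)
qed

lemma finite_coordinate_sets_open:
  fixes X :: "(int \<Rightarrow> 'a::discrete_topology) set"
  assumes "B \<in> finite_coordinate_sets X"
  obtains U where "open U" "B = X \<inter> U"
proof -
  obtain r :: nat where r: "B \<subseteq> X"
    "\<And>x y s. r \<le> s \<Longrightarrow> x \<in> X \<Longrightarrow> y \<in> X \<Longrightarrow> (\<forall>i\<in>{-int s..int s}. x i = y i) \<Longrightarrow> x \<in> B \<longleftrightarrow> y \<in> B"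
    using assms by (rule finite_coordinate_setsE) blast
  let ?U = "{y. \<exists>x\<in>B. \<forall>i\<in>{-int r..int r}. y i = x i}"
  have "open ?U" by (rule open_if_finite_coordinates[of "{-int r..int r}"]) auto
  moreover have "B = X \<inter> ?U"
  proof
    show "B \<subseteq> X \<inter> ?U" using r(1) by auto
    show "X \<inter> ?U \<subseteq> B"
    proof
      fix y assume "y \<in> X \<inter> ?U"
      then obtain x where "x \<in> B" "y \<in> X" "\<forall>i\<in>{-int r..int r}. y i = x i" by blast
      thus "y \<in> B" using r(2)[OF order_refl, of y x] r(1) by blast
    qed
  qed
  ultimately show ?thesis by (rule that)
qed

lemma (in mixing_shift) sets_borel_eq:
  "sets (restrict_space borel X) = sigma_sets X (finite_coordinate_sets X)"
proof
  have "X \<in> sigma_sets UNIV {S. open S}" using closed by (simp add: sets_borel[symmetric])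
  hence eq: "sets (restrict_space borel X) = sigma_sets X ((\<inter>) X ` {S. open S})"
    unfolding sets_restrict_space sets_borel by (rule sigma_sets_Int) simp
  interpret algebra X "finite_coordinate_sets X" by (rule algebra_finite_coordinate_sets)
  \<comment> \<open>An open set is the union over \<open>r\<close> of the sets of points whose window \<open>[-r, r]\<close> forces
    membership.\<close>
  show "sets (restrict_space borel X) \<subseteq> sigma_sets X (finite_coordinate_sets X)"
    unfolding eq
  proof (rule sigma_sets_mono, safe)
    fix U :: "(int \<Rightarrow> 'a) set" assume U: "open U"
    define B where "B r = {x\<in>X. \<forall>y\<in>X. (\<forall>i\<in>{-int r..int r}. x i = y i) \<longrightarrow> y \<in> U}" for r :: nat
    have "B r \<in> finite_coordinate_sets X" for r
      unfolding finite_coordinate_sets_def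
    proof (intro CollectI conjI exI[of _ r] ballI impI)
      fix x y assume "x \<in> X" "y \<in> X" "\<forall>i\<in>{-int r..int r}. x i = y i" "x \<in> B r"
      thus "y \<in> B r" by (simp add: B_def)
    qed (auto simp: B_def)
    hence "(\<Union>r. B r) \<in> sigma_sets X (finite_coordinate_sets X)"
      by (intro sigma_sets.Union sigma_sets.Basic)
    moreover have "X \<inter> U = (\<Union>r. B r)"
    proof
      show "X \<inter> U \<subseteq> (\<Union>r. B r)"
      proof
        fix x assume x: "x \<in> X \<inter> U"
        obtain r :: nat where "\<And>y. (\<forall>i\<in>{-int r..int r}. y i = x i) \<Longrightarrow> y \<in> U"
          using open_contains_cylinder[OF U, of x] x by auto
        hence "x \<in> B r" using x by (auto simp: B_def)
        thus "x \<in> (\<Union>r. B r)" by blast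
      qed
    qed (auto simp: B_def)
    ultimately show "X \<inter> U \<in> sigma_sets X (finite_coordinate_sets X)" by simp
  qed
  show "sigma_sets X (finite_coordinate_sets X) \<subseteq> sets (restrict_space borel X)"
  proof (rule sets.sigma_sets_subset')
    show "finite_coordinate_sets X \<subseteq> sets (restrict_space borel X)"
    proof
      fix B assume "B \<in> finite_coordinate_sets X"
      then obtain U where "open U" "B = X \<inter> U" by (rule finite_coordinate_sets_open)
      thus "B \<in> sets (restrict_space borel X)" by (auto simp: sets_restrict_space)
    qed
    show "X \<in> sets (restrict_space borel X)" by (auto simp: sets_restrict_space)
  qed
qed

lemma space_restrict_borel [simp]: "space (restrict_space borel X) = X"
  by (simp add: space_restrict_space)

text \<open>Since the alphabet is finite, a map into \<open>X\<close> is measurable as soon as its coordinates are.\<close>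

lemma (in mixing_shift) measurable_into_shift:
  assumes mem: "\<And>\<omega>. \<omega> \<in> space M \<Longrightarrow> h \<omega> \<in> X"
    and coord: "\<And>i a. {\<omega>\<in>space M. h \<omega> i = a} \<in> sets M"
  shows "h \<in> measurable M (restrict_space borel X)"
proof -
  have "h \<in> measurable M (sigma X (finite_coordinate_sets X))"
  proof (rule measurable_sigma_sets[where A = "finite_coordinate_sets X" and \<Omega> = X])
    show "sets (sigma X (finite_coordinate_sets X)) = sigma_sets X (finite_coordinate_sets X)"
      by (rule sets_measure_of) (auto simp: finite_coordinate_sets_def)
    fix B assume B: "B \<in> finite_coordinate_sets X"
    obtain r :: nat where r: "B \<subseteq> X"
      "\<And>x y s. r \<le> s \<Longrightarrow> x \<in> X \<Longrightarrow> y \<in> X \<Longrightarrow> (\<forall>i\<in>{-int s..int s}. x i = y i) \<Longrightarrow> x \<in> B \<longleftrightarrow> y \<in> B"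
      using B by (rule finite_coordinate_setsE) blast
    let ?I = "{-int r..int r}"
    have "finite ((\<lambda>x. restrict x ?I) ` B)"
      by (rule finite_subset[of _ "PiE ?I (\<lambda>_. A)"])
         (use r(1) letters finite_alphabet in \<open>auto intro!: finite_PiE\<close>)
    moreover have "(\<Inter>i\<in>?I. {\<omega>\<in>space M. h \<omega> i = v i}) \<in> sets M" for v
      by (rule sets.finite_INT) (auto intro: coord)
    ultimately have "(\<Union>v\<in>(\<lambda>x. restrict x ?I) ` B. \<Inter>i\<in>?I. {\<omega>\<in>space M. h \<omega> i = v i}) \<in> sets M"
      by (rule sets.finite_UN)
    also have "(\<Union>v\<in>(\<lambda>x. restrict x ?I) ` B. \<Inter>i\<in>?I. {\<omega>\<in>space M. h \<omega> i = v i}) = h -` B \<inter> space M"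
    proof (intro set_eqI iffI)
      fix \<omega> assume "\<omega> \<in> (\<Union>v\<in>(\<lambda>x. restrict x ?I) ` B. \<Inter>i\<in>?I. {\<omega>\<in>space M. h \<omega> i = v i})"
      then obtain x where x: "x \<in> B" "\<And>i. i \<in> ?I \<Longrightarrow> \<omega> \<in> space M \<and> h \<omega> i = x i" by auto
      have "\<omega> \<in> space M" using x(2)[of 0] by simp
      moreover from this have "h \<omega> \<in> B" using r(2)[of r x "h \<omega>"] x r(1) mem by auto
      ultimately show "\<omega> \<in> h -` B \<inter> space M" by simp
    qed (auto simp: image_iff intro!: bexI[of _ "h _"])
    finally show "h -` B \<inter> space M \<in> sets M" .
  qed (use mem in \<open>auto simp: finite_coordinate_sets_def\<close>)
  moreover have "sets (sigma X (finite_coordinate_sets X)) = sets (restrict_space borel X)"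
    unfolding sets_borel_eq by (rule sets_measure_of) (auto simp: finite_coordinate_sets_def)
  ultimately show ?thesis by (metis measurable_cong_sets)
qed

lemma (in mixing_shift) measurable_translate [measurable]:
  "translate k \<in> measurable (restrict_space borel X) (restrict_space borel X)"
proof (rule measurable_into_shift)
  fix i and a :: 'a
  have "{x. x (i + k) = a} \<in> sets borel"
    by (rule borel_open, rule open_if_finite_coordinates[of "{i + k}"]) auto
  moreover have "{x \<in> space (restrict_space borel X). translate k x i = a} = X \<inter> {x. x (i + k) = a}"
    by auto
  ultimately show "{x \<in> space (restrict_space borel X). translate k x i = a} \<in> sets (restrict_space borel X)"
    by (auto simp: sets_restrict_space)
qed (auto intro: translate_mem)

lemma (in mixing_shift) measure_eqI_shift:
  assumes "sets M = sets (restrict_space borel X)" "sets M' = sets (restrict_space borel X)"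
    and "prob_space M"
    and "\<And>B. B \<in> finite_coordinate_sets X \<Longrightarrow> emeasure M B = emeasure M' B"
  shows "M = M'"
proof (rule measure_eqI_generator_eq)
  interpret M: prob_space M by fact
  interpret algebra X "finite_coordinate_sets X" by (rule algebra_finite_coordinate_sets)
  show "Int_stable (finite_coordinate_sets X)" by (auto simp: Int_stable_def)
  show "finite_coordinate_sets X \<subseteq> Pow X" by (rule space_closed)
  show "range (\<lambda>_::nat. X) \<subseteq> finite_coordinate_sets X" by auto
  show "sets M = sigma_sets X (finite_coordinate_sets X)"
    "sets M' = sigma_sets X (finite_coordinate_sets X)" using assms sets_borel_eq by auto
  show "emeasure M X \<noteq> \<infinity>" using M.emeasure_finite by simp
qed (use assms in auto)


section \<open>Invariant measures and periodic orbits\<close>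

lemma invariant_measuresD:
  assumes "M \<in> invariant_measures X T"
  shows "sets M = sets (restrict_space borel X)" "space M = X" "prob_space M"
    "T \<in> measurable M M" "distr M M T = M"
proof -
  show s: "sets M = sets (restrict_space borel X)" using assms by (simp add: invariant_measures_def)
  show "space M = X" using sets_eq_imp_space_eq[OF s] by simp
qed (use assms in \<open>auto simp: invariant_measures_def\<close>)

context shift_observable
begin

lemma measurable_observable:
  assumes "sets M = sets (restrict_space borel X)"
  shows "f \<in> borel_measurable M" "(\<lambda>x. f (translate k x)) \<in> borel_measurable M"
proof -
  have [measurable]: "f \<in> borel_measurable (restrict_space borel X)"
    by (rule borel_measurable_continuous_on_restrict[OF cont])
  show "f \<in> borel_measurable M" "(\<lambda>x. f (translate k x)) \<in> borel_measurable M"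
    using assms by (auto cong: measurable_cong_sets)
qed

lemma integrable_observable:
  assumes "M \<in> invariant_measures X left_shift"
  shows "integrable M (\<lambda>x. f (translate k x))"
proof -
  interpret prob_space M by (rule invariant_measuresD[OF assms])
  show ?thesis
    by (rule integrable_const_bound[where B = C])
       (use measurable_observable invariant_measuresD[OF assms] bound translate_mem in auto)
qed

lemma integral_orbit_sum:
  assumes M: "M \<in> invariant_measures X left_shift"
  shows "(\<integral>x. orbit_sum f x 0 (int n) \<partial>M) = real n * integral\<^sup>L M f"
proof -
  note M' = invariant_measuresD[OF M]
  have *: "(\<integral>x. f (translate (int k) x) \<partial>M) = integral\<^sup>L M f" for k :: nat
  proof (induction k)
    case (Suc k)
    have "(\<integral>x. f (translate (int k) x) \<partial>M) = (\<integral>x. f (translate (int k) x) \<partial>distr M M left_shift)"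
      using M'(5) by simp
    also have "\<dots> = (\<integral>x. f (translate (int k) (left_shift x)) \<partial>M)"
      by (rule integral_distr[OF M'(4)]) (use measurable_observable M' in auto)
    also have "(\<lambda>x. f (translate (int k) (left_shift x))) = (\<lambda>x. f (translate (int (Suc k)) x))"
      unfolding left_shift_eq_translate translate_translate by (simp add: add.commute)
    finally have "(\<integral>x. f (translate (int k) x) \<partial>M) = (\<integral>x. f (translate (int (Suc k)) x) \<partial>M)" .
    from this[symmetric] Suc.IH show ?case by (rule trans)
  qed simp
  have "(\<integral>x. f (translate p x) \<partial>M) = integral\<^sup>L M f" if "p \<in> {0..<int n}" for p
    using *[of "nat p"] that by simp
  hence "(\<integral>x. orbit_sum f x 0 (int n) \<partial>M) = (\<Sum>p\<in>{0..<int n}. integral\<^sup>L M f)"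
    unfolding orbit_sum_def by (subst Bochner_Integration.integral_sum) (auto intro: integrable_observable M)
  thus ?thesis by simp
qed

lemma integral_bound:
  assumes M: "M \<in> invariant_measures X left_shift"
  shows "\<bar>integral\<^sup>L M f\<bar> \<le> C"
proof -
  interpret prob_space M by (rule invariant_measuresD[OF M])
  have "integrable M f" using integrable_observable[OF M, of 0] by simp
  thus ?thesis unfolding abs_le_iff
    using invariant_measuresD(2)[OF M] bound
    by (auto intro!: integral_le_const integral_ge_const simp: abs_le_iff minus_le_iff[of C]
             simp flip: Bochner_Integration.integral_minus)
qed

end

text \<open>A loop all of whose occurrences have orbit sums at least \<open>c\<close> times the length.\<close>

definition (in mixing_shift) loop_above :: "((int \<Rightarrow> 'a) \<Rightarrow> real) \<Rightarrow> real \<Rightarrow> 'a list \<Rightarrow> bool" where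
  "loop_above f c l \<longleftrightarrow> loop l \<and> (\<forall>y\<in>X. \<forall>i. (\<forall>k<length l. y (i + int k) = l ! k) \<longrightarrow>
     c * real (length l) \<le> orbit_sum f y i (i + int (length l)))"

context shift_observable
begin

text \<open>Every value below the integral of an invariant measure is exceeded by the averages over long
  loops: some point has an orbit sum of length \<open>n\<close> that is at least \<open>n\<close> times the integral, and the
  loop through it adds only boundedly many letters.\<close>

lemma ex_loop_above:
  assumes M: "M \<in> invariant_measures X left_shift" and c: "c < integral\<^sup>L M f"
  obtains n0 where "\<And>n. n \<ge> n0 \<Longrightarrow> \<exists>l. loop_above f c l \<and> int (length l) = int n + 2 * N"
proof -
  note M' = invariant_measuresD[OF M]
  interpret prob_space M by (rule M'(3))
  define I where "I = integral\<^sup>L M f"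
  define e where "e = (I - c) / 2"
  have e: "e > 0" using c by (simp add: e_def I_def)
  obtain R where R: "R \<ge> 0" "\<And>x y i j. x \<in> X \<Longrightarrow> y \<in> X \<Longrightarrow> i \<le> j \<Longrightarrow> (\<forall>k\<in>{i..<j}. x k = y k) \<Longrightarrow>
      \<bar>orbit_sum f x i j - orbit_sum f y i j\<bar> \<le> e * real_of_int (j - i) + R"
    using orbit_sum_context[OF e] by blast
  have N: "N > 0" using gap window_pos by simp
  define D where "D = R + 2 * C * N + 2 * N * c"
  have "\<exists>l. loop_above f c l \<and> int (length l) = int n + 2 * N" if n: "n \<ge> nat \<lceil>D / e\<rceil>" for n
  proof -
    have "D / e \<le> real n" using n by linarith
    hence nD: "D \<le> e * real n" using e by (simp add: field_simps)
    have "\<exists>x\<in>X. real n * I \<le> orbit_sum f x 0 (int n)"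
    proof (rule ccontr)
      assume "\<not> ?thesis"
      hence less: "orbit_sum f x 0 (int n) < real n * I" if "x \<in> X" for x using that by force
      have "integrable M (\<lambda>x. orbit_sum f x 0 (int n))"
        unfolding orbit_sum_def by (intro Bochner_Integration.integrable_sum integrable_observable M)
      hence "expectation (\<lambda>x. orbit_sum f x 0 (int n)) < real n * I"
        by (rule expectation_less) (use less M'(2) in auto)
      thus False using integral_orbit_sum[OF M, of n] by (simp add: I_def)
    qed
    then obtain x where x: "x \<in> X" "real n * I \<le> orbit_sum f x 0 (int n)" by blast
    obtain l where l: "loop l" "int (length l) = int n + 2 * N"
        "\<And>k. k < n \<Longrightarrow> l ! (nat N + k) = x (int k)"
      using ex_loop[OF x(1)] by blast
    have len: "real (length l) = real n + 2 * real_of_int N"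
      using arg_cong[OF l(2), of real_of_int] by simp
    have "c * real (length l) \<le> orbit_sum f y i (i + int (length l))"
      if y: "y \<in> X" "\<And>k. k < length l \<Longrightarrow> y (i + int k) = l ! k" for y i
    proof -
      have "y (k + (i + N)) = x k" if "k \<in> {0..<int n}" for k
      proof -
        have "nat N + nat k < length l" using that l(2) N by auto
        hence "y (i + int (nat N + nat k)) = l ! (nat N + nat k)" by (rule y(2))
        moreover have "nat k < n" using that by auto
        ultimately show ?thesis using l(3)[of "nat k"] that N by (simp add: algebra_simps)
      qed
      hence "\<bar>orbit_sum f (translate (i + N) y) 0 (int n) - orbit_sum f x 0 (int n)\<bar> \<le> e * real_of_int (int n - 0) + R"
        by (intro R(2)) (use translate_mem y x in auto)
      hence 1: "orbit_sum f y (i + N) (i + N + int n) \<ge> real n * I - e * real n - R"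
        using x(2) by (simp add: orbit_sum_translate add.commute)
      have 2: "orbit_sum f y i (i + N) \<ge> - C * N"
        using orbit_sum_le[OF y(1), of i "i + N"] N by simp
      have 3: "orbit_sum f y (i + N + int n) (i + int (length l)) \<ge> - C * N"
        using orbit_sum_le[OF y(1), of "i + N + int n" "i + int (length l)"] N l(2) by simp
      have "orbit_sum f y i (i + int (length l)) = orbit_sum f y i (i + N) +
          orbit_sum f y (i + N) (i + N + int n) + orbit_sum f y (i + N + int n) (i + int (length l))"
        using N l(2) orbit_sum_append[of i "i + N + int n" "i + int (length l)" f y]
          orbit_sum_append[of i "i + N" "i + N + int n" f y] by simp
      with 1 2 3 have "orbit_sum f y i (i + int (length l)) \<ge> real n * (I - e) - R - 2 * C * N"
        by (simp add: algebra_simps)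
      also have "real n * (I - e) = real n * c + e * real n" by (simp add: e_def field_simps)
      finally show ?thesis using nD by (simp add: len D_def algebra_simps)
    qed
    thus ?thesis using l(1,2) by (auto simp: loop_above_def)
  qed
  thus ?thesis by (rule that)
qed

end

lemma (in mixing_shift) periodic_point_from_loop:
  assumes "loop l"
  shows "concatenation (\<lambda>_. l) \<in> X" "(left_shift ^^ length l) (concatenation (\<lambda>_. l)) = concatenation (\<lambda>_. l)"
    "k < length l \<Longrightarrow> concatenation (\<lambda>_. l) (int k) = l ! k"
proof -
  have ne: "l \<noteq> []" using assms loop_nonempty by simp
  show "concatenation (\<lambda>_. l) \<in> X" using assms by (rule concatenation_mem)
  show "(left_shift ^^ length l) (concatenation (\<lambda>_. l)) = concatenation (\<lambda>_. l)"
    using concatenation_translate[of "\<lambda>_. l" 1] start_Suc[of "\<lambda>_. l" 0] ne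
    by (simp add: left_shift_funpow)
  show "k < length l \<Longrightarrow> concatenation (\<lambda>_. l) (int k) = l ! k"
    using concatenation_eq[of "\<lambda>_. l" k 0] ne by simp
qed

context mixing_shift
begin

lemma ex_periodic_point: "\<exists>x\<in>X. \<exists>n>0. (left_shift ^^ n) x = x"
proof -
  obtain l where "loop l" using ex_loop[OF base_mem] by blast
  thus ?thesis using periodic_point_from_loop[of l] loop_nonempty[of l] by blast
qed

text \<open>The uniform distribution on a periodic orbit.\<close>

lemma periodic_orbit_measure:
  assumes x: "x \<in> X" and n: "n > 0" and per: "(left_shift ^^ n) x = x"
  obtains M where "M \<in> invariant_measures X left_shift"
    "\<And>f C. shift_observable X A w N f C \<Longrightarrow> integral\<^sup>L M f = birkhoff_average left_shift f n x"
proof -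
  define p where "p = pmf_of_set {..<n}"
  define h where "h i = translate (int i) x" for i :: nat
  define M where "M = distr (measure_pmf p) (restrict_space borel X) h"
  have fin: "finite {..<n}" "{..<n} \<noteq> {}" using n by auto
  have h_mem: "h i \<in> X" for i unfolding h_def by (rule translate_mem[OF x])
  have h [measurable]: "h \<in> measurable (measure_pmf p) (restrict_space borel X)"
    by (rule measurable_into_shift) (auto simp: h_mem)
  have h_mod: "h (i mod n) = h i" for i
  proof -
    have per': "translate (int n) x = x" using per by (simp add: left_shift_funpow)
    have "translate (int (k * n)) x = x" for k
    proof (induction k)
      case (Suc k)
      have "translate (int (Suc k * n)) x = translate (int (k * n)) (translate (int n) x)"
        by (simp add: algebra_simps)
      thus ?case using Suc per' by simp
    qed simp
    from this[of "i div n"] have "h (i mod n) = translate (int (i mod n)) (translate (int (i div n * n)) x)"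
      by (simp add: h_def)
    also have "\<dots> = translate (int (i mod n + i div n * n)) x"
      by (simp only: translate_translate of_nat_add)
    also have "\<dots> = h i" by (simp only: h_def mod_div_mult_eq)
    finally show ?thesis .
  qed
  have sets_M [simp]: "sets M = sets (restrict_space borel X)" by (simp add: M_def)
  have [measurable]: "left_shift \<in> measurable (restrict_space borel X) (restrict_space borel X)"
    unfolding left_shift_eq_translate by (rule measurable_translate)
  have "distr M M left_shift = distr (measure_pmf p) (restrict_space borel X) (\<lambda>i. left_shift (h i))"
    unfolding M_def by (subst distr_distr) (auto simp: comp_def h_mem cong: distr_cong)
  also have "(\<lambda>i. left_shift (h i)) = h \<circ> (\<lambda>i. Suc i mod n)"
    by (simp add: fun_eq_iff h_mod) (simp add: h_def left_shift_eq_translate add.commute)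
  also have "distr (measure_pmf p) (restrict_space borel X) (h \<circ> (\<lambda>i. Suc i mod n)) =
      distr (measure_pmf (map_pmf (\<lambda>i. Suc i mod n) p)) (restrict_space borel X) h"
    unfolding map_pmf_rep_eq by (subst distr_distr) (auto simp: measurable_def h_mem)
  also have "map_pmf (\<lambda>i. Suc i mod n) p = p"
  proof -
    have "inj_on (\<lambda>i. Suc i mod n) {..<n}"
    proof (rule inj_onI)
      fix i j assume "i \<in> {..<n}" "j \<in> {..<n}" "Suc i mod n = Suc j mod n"
      thus "i = j" by (auto simp: mod_Suc split: if_splits)
    qed
    moreover have "(\<lambda>i. Suc i mod n) ` {..<n} \<subseteq> {..<n}" using n by auto
    ultimately have "bij_betw (\<lambda>i. Suc i mod n) {..<n} {..<n}"
      using endo_inj_surj[OF fin(1)] unfolding bij_betw_def by blast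
    thus ?thesis unfolding p_def using fin by (intro map_pmf_of_set_bij_betw)
  qed
  finally have inv: "distr M M left_shift = M" by (simp add: M_def)
  show ?thesis
  proof
    show "M \<in> invariant_measures X left_shift"
      unfolding invariant_measures_def
      using inv measure_pmf.prob_space_distr[OF h] by (auto simp: M_def h_mem cong: measurable_cong_sets)
    fix f C assume "shift_observable X A w N f C"
    then interpret shift_observable X A w N f C .
    have "integral\<^sup>L M f = (\<integral>i. f (h i) \<partial>measure_pmf p)"
      unfolding M_def by (rule integral_distr) (auto intro!: measurable_observable(1) simp: h_mem)
    also have "\<dots> = (\<Sum>i<n. f (h i)) / real n"
      unfolding p_def using fin by (subst integral_pmf_of_set) auto
    finally show "integral\<^sup>L M f = birkhoff_average left_shift f n x"
      by (simp add: birkhoff_average_def h_def left_shift_funpow)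
  qed
qed

lemma invariant_measures_nonempty: "invariant_measures X left_shift \<noteq> {}"
  using ex_periodic_point periodic_orbit_measure by (metis empty_iff)

end

context shift_observable
begin

lemma bdd_above_integrals: "bdd_above ((\<lambda>\<mu>. integral\<^sup>L \<mu> f) ` invariant_measures X left_shift)"
  by (rule bdd_aboveI[of _ C]) (use integral_bound in \<open>force simp: abs_le_iff\<close>)

text \<open>Periodic orbits carry invariant measures, and conversely the loops with averages close to the
  integral can be repeated periodically.\<close>

theorem Sup_integrals_eq_Sup_periodic:
  "(SUP \<mu>\<in>invariant_measures X left_shift. integral\<^sup>L \<mu> f) = Sup (periodic_orbit_averages X left_shift f)"
proof (rule antisym)
  let ?P = "periodic_orbit_averages X left_shift f"
  have per: "v \<le> (SUP \<mu>\<in>invariant_measures X left_shift. integral\<^sup>L \<mu> f)" if "v \<in> ?P" for v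
  proof -
    obtain n x where v: "v = birkhoff_average left_shift f n x" "x \<in> X" "n > 0" "(left_shift ^^ n) x = x"
      using \<open>v \<in> ?P\<close> unfolding periodic_orbit_averages_def by blast
    obtain M where "M \<in> invariant_measures X left_shift" "integral\<^sup>L M f = v"
      using periodic_orbit_measure[OF v(2-4)] v(1) shift_observable_axioms by metis
    thus ?thesis using bdd_above_integrals by (auto intro: cSUP_upper2)
  qed
  have ne: "?P \<noteq> {}" using ex_periodic_point by (auto simp: periodic_orbit_averages_def)
  show "Sup ?P \<le> (SUP \<mu>\<in>invariant_measures X left_shift. integral\<^sup>L \<mu> f)"
    by (rule cSup_least[OF ne per])
  have bdd: "bdd_above ?P" by (rule bdd_aboveI[OF per])
  show "(SUP \<mu>\<in>invariant_measures X left_shift. integral\<^sup>L \<mu> f) \<le> Sup ?P"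
  proof (rule cSUP_least[OF invariant_measures_nonempty])
    fix M assume M: "M \<in> invariant_measures X left_shift"
    show "integral\<^sup>L M f \<le> Sup ?P"
    proof (rule dense_le)
      fix c assume "c < integral\<^sup>L M f"
      then obtain l where l: "loop_above f c l" using ex_loop_above[OF M] by blast
      hence loop: "loop l" by (simp add: loop_above_def)
      let ?x = "concatenation (\<lambda>_. l)"
      note x = periodic_point_from_loop[OF loop]
      have len: "length l > 0" using loop_nonempty[OF loop] by simp
      have "\<forall>k<length l. ?x (0 + int k) = l ! k" using x(3) by simp
      hence "c * real (length l) \<le> orbit_sum f ?x 0 (0 + int (length l))"
        using l x(1) unfolding loop_above_def by blast
      hence "c \<le> birkhoff_average left_shift f (length l) ?x"
        using len by (simp add: orbit_sum_eq_birkhoff_average field_simps)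
      also have "\<dots> \<le> Sup ?P"
        using x len by (intro cSup_upper bdd) (auto simp: periodic_orbit_averages_def)
      finally show "c \<le> Sup ?P" .
    qed
  qed
qed

end

lemma birkhoff_average_uminus: "birkhoff_average T (\<lambda>x. - f x) n x = - birkhoff_average T f n x"
  by (simp add: birkhoff_average_def sum_negf)

theorem (in shift_observable) Inf_integrals_eq_Inf_periodic:
  "(INF \<mu>\<in>invariant_measures X left_shift. integral\<^sup>L \<mu> f) = Inf (periodic_orbit_averages X left_shift f)"
proof -
  interpret neg: shift_observable X A w N "\<lambda>x. - f x" C by (rule shift_observable_uminus)
  have 1: "uminus ` (\<lambda>\<mu>. integral\<^sup>L \<mu> f) ` invariant_measures X left_shift =
      (\<lambda>\<mu>. integral\<^sup>L \<mu> (\<lambda>x. - f x)) ` invariant_measures X left_shift"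
    by (auto simp: image_image)
  have 2: "uminus ` periodic_orbit_averages X left_shift f = periodic_orbit_averages X left_shift (\<lambda>x. - f x)"
    unfolding periodic_orbit_averages_def birkhoff_average_uminus by blast
  show ?thesis unfolding Inf_real_def 1 2 using neg.Sup_integrals_eq_Sup_periodic by simp
qed


section \<open>A maximizing measure\<close>

context shift_observable
begin

text \<open>Up to \<open>e\<close>, integrals of \<open>f\<close> depend only on the measures of finitely many sets that depend on
  finitely many coordinates.\<close>

lemma integral_approximation:
  assumes "e > 0"
  obtains \<P> c where "finite \<P>" "\<P> \<subseteq> finite_coordinate_sets X"
    "\<And>M. sets M = sets (restrict_space borel X) \<Longrightarrow> prob_space M \<Longrightarrow>
      \<bar>integral\<^sup>L M f - (\<Sum>P\<in>\<P>. c P * measure M P)\<bar> \<le> e"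
proof -
  obtain r :: nat where r: "\<And>x y. x \<in> X \<Longrightarrow> y \<in> X \<Longrightarrow> (\<forall>i\<in>{-int r..int r}. x i = y i) \<Longrightarrow> \<bar>f x - f y\<bar> < e"
    using uniformly_continuous[OF assms] by blast
  let ?I = "{-int r..int r}"
  define cls where "cls x = {y\<in>X. \<forall>i\<in>?I. y i = x i}" for x
  define \<P> where "\<P> = cls ` X"
  define c where "c P = f (SOME x. x \<in> P)" for P
  have "finite ((\<lambda>x. restrict x ?I) ` X)"
    by (rule finite_subset[of _ "PiE ?I (\<lambda>_. A)"])
       (use letters finite_alphabet in \<open>auto intro!: finite_PiE\<close>)
  moreover have "\<P> = (\<lambda>v. cls v) ` (\<lambda>x. restrict x ?I) ` X"
    unfolding \<P>_def image_image by (rule image_cong) (auto simp: cls_def)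
  ultimately have fin: "finite \<P>" by simp
  have sub: "\<P> \<subseteq> finite_coordinate_sets X"
    by (auto simp: \<P>_def cls_def finite_coordinate_sets_def intro!: exI[of _ r])
  have cls_eq: "P = cls x" if "P \<in> \<P>" "x \<in> P" for P x
    using that by (auto simp: \<P>_def cls_def)
  have c: "\<bar>f x - c P\<bar> < e" if "P \<in> \<P>" "x \<in> P" for P x
  proof -
    have "(SOME x. x \<in> P) \<in> P" using that(2) by (rule someI[of "\<lambda>x. x \<in> P"])
    hence 1: "(SOME x. x \<in> P) \<in> cls x" using cls_eq[OF that] by simp
    have 2: "x \<in> cls x" using cls_eq[OF that] that(2) by simp
    show ?thesis unfolding c_def
      by (rule r) (use 1 2 in \<open>auto simp: cls_def\<close>)
  qed
  have g: "(\<Sum>P\<in>\<P>. c P * indicator P x) = c (cls x)" if "x \<in> X" for x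
  proof -
    have cx: "cls x \<in> \<P>" "x \<in> cls x" using that by (auto simp: \<P>_def cls_def)
    have "(\<Sum>P\<in>\<P>. c P * indicator P x) = (\<Sum>P\<in>{cls x}. c P * indicator P x)"
    proof (rule sum.mono_neutral_right[OF fin])
      show "\<forall>P\<in>\<P> - {cls x}. c P * indicator P x = 0"
      proof
        fix P assume "P \<in> \<P> - {cls x}"
        hence "x \<notin> P" using cls_eq[of P x] by blast
        thus "c P * indicator P x = 0" by simp
      qed
    qed (use cx(1) in simp)
    thus ?thesis using cx by simp
  qed
  show ?thesis
  proof
    fix M assume M: "sets M = sets (restrict_space borel X)" "prob_space M"
    interpret prob_space M by fact
    have sp: "space M = X" using sets_eq_imp_space_eq[OF M(1)] by simp
    have P_sets: "P \<in> sets M" if "P \<in> \<P>" for P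
      using that sub unfolding M(1) sets_borel_eq by auto
    have int_f: "integrable M f"
      by (rule integrable_const_bound[where B = C])
         (use measurable_observable(1)[OF M(1)] sp bound in auto)
    have int_P: "integrable M (\<lambda>x. c P * indicator P x)" if "P \<in> \<P>" for P
      using P_sets[OF that] by (auto simp: integrable_indicator_iff emeasure_eq_measure)
    define g where "g x = (\<Sum>P\<in>\<P>. c P * indicator P x)" for x
    have int_g: "integrable M g"
      unfolding g_def using int_P by auto
    have "integral\<^sup>L M g = (\<Sum>P\<in>\<P>. \<integral>x. c P * indicator P x \<partial>M)"
      unfolding g_def by (rule Bochner_Integration.integral_sum) (use int_P in auto)
    also have "\<dots> = (\<Sum>P\<in>\<P>. c P * measure M P)"
      by (rule sum.cong) (use P_sets sets.Int_space_eq2 in auto)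
    finally have "integral\<^sup>L M f - (\<Sum>P\<in>\<P>. c P * measure M P) = (\<integral>x. f x - g x \<partial>M)"
      using int_f int_g by simp
    also have "\<bar>\<dots>\<bar> \<le> (\<integral>x. \<bar>f x - g x\<bar> \<partial>M)" by (rule integral_abs_bound)
    also have "\<dots> \<le> e"
    proof (rule integral_le_const)
      show "AE x in M. \<bar>f x - g x\<bar> \<le> e"
      proof (rule AE_I2)
        fix x assume "x \<in> space M"
        hence x: "x \<in> X" using sp by simp
        hence "cls x \<in> \<P>" "x \<in> cls x" by (auto simp: \<P>_def cls_def)
        from c[OF this] show "\<bar>f x - g x\<bar> \<le> e" using g[OF x] by (simp add: g_def)
      qed
    qed (use int_f int_g in auto)
    finally show "\<bar>integral\<^sup>L M f - (\<Sum>P\<in>\<P>. c P * measure M P)\<bar> \<le> e" .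
  qed (use fin sub in auto)
qed

end

context mixing_shift
begin

text \<open>A finitely additive probability on the algebra of sets that depend on finitely many coordinates
  is countably additive there: those sets are compact, so a decreasing sequence of them with empty
  intersection is eventually empty.\<close>

lemma extend_finitely_additive:
  fixes m :: "(int \<Rightarrow> 'a) set \<Rightarrow> real"
  assumes nonneg: "\<And>B. m B \<ge> 0" and one: "m X = 1"
    and add: "\<And>B D. B \<in> finite_coordinate_sets X \<Longrightarrow> D \<in> finite_coordinate_sets X \<Longrightarrow> B \<inter> D = {} \<Longrightarrow>
      m (B \<union> D) = m B + m D"
  obtains M where "sets M = sets (restrict_space borel X)" "prob_space M"
    "\<And>B. B \<in> finite_coordinate_sets X \<Longrightarrow> measure M B = m B"
proof -
  interpret algebra X "finite_coordinate_sets X" by (rule algebra_finite_coordinate_sets)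
  have m0: "m {} = 0" using add[of "{}" "{}"] by auto
  let ?f = "\<lambda>B. ennreal (m B)"
  have "\<exists>\<mu> :: (int \<Rightarrow> 'a) set \<Rightarrow> ennreal. (\<forall>s \<in> finite_coordinate_sets X. \<mu> s = ?f s) \<and>
      measure_space X (sigma_sets X (finite_coordinate_sets X)) \<mu>"
  proof (rule caratheodory_empty_continuous)
    show "positive (finite_coordinate_sets X) ?f" by (simp add: positive_def m0)
    show "additive (finite_coordinate_sets X) ?f" by (auto simp: additive_def add nonneg ennreal_plus)
    fix B :: "nat \<Rightarrow> (int \<Rightarrow> 'a) set"
    assume B: "range B \<subseteq> finite_coordinate_sets X" "decseq B" "(\<Inter>i. B i) = {}"
    have "closed (B i)" for i
    proof -
      have "X - B i \<in> finite_coordinate_sets X" using B(1) by auto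
      then obtain U where "open U" "X - B i = X \<inter> U" by (rule finite_coordinate_sets_open)
      moreover have "B i \<subseteq> X" using B(1) space_closed by auto
      ultimately have "B i = X \<inter> - U" by auto
      thus ?thesis using closed \<open>open U\<close> by auto
    qed
    note cl = this
    have "\<exists>n. B n = {}"
    proof (rule ccontr)
      assume ne: "\<nexists>n. B n = {}"
      have "X \<inter> (\<Inter>i\<in>UNIV. B i) \<noteq> {}"
      proof (rule compact_imp_fip_image[OF compact])
        fix J :: "nat set" assume J: "finite J" "J \<subseteq> UNIV"
        have "B (Max (insert 0 J)) \<subseteq> X \<inter> (\<Inter>i\<in>J. B i)"
        proof (intro Int_greatest INT_greatest)
          show "B (Max (insert 0 J)) \<subseteq> X" using B(1) space_closed by blast
          show "B (Max (insert 0 J)) \<subseteq> B i" if "i \<in> J" for i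
            using that J(1) by (intro decseqD[OF B(2)] Max_ge) auto
        qed
        thus "X \<inter> (\<Inter>i\<in>J. B i) \<noteq> {}" using ne by blast
      qed (use cl in auto)
      thus False using B(3) by auto
    qed
    then obtain n where n: "B n = {}" by blast
    have "B i = {}" if "i \<ge> n" for i using decseqD[OF B(2) that] n by auto
    hence "eventually (\<lambda>i. ?f (B i) = 0) sequentially"
      unfolding eventually_sequentially by (intro exI[of _ n]) (simp add: m0)
    thus "(\<lambda>i. ?f (B i)) \<longlonglongrightarrow> 0" by (rule tendsto_eventually)
  qed auto
  then obtain \<mu> where \<mu>: "\<And>B. B \<in> finite_coordinate_sets X \<Longrightarrow> \<mu> B = ?f B"
      "measure_space X (sigma_sets X (finite_coordinate_sets X)) \<mu>" by blast
  define M where "M = measure_of X (sigma_sets X (finite_coordinate_sets X)) \<mu>"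
  have sub: "sigma_sets X (finite_coordinate_sets X) \<subseteq> Pow X"
    using sigma_sets_into_sp[OF space_closed] by blast
  have sets_M: "sets M = sigma_sets X (finite_coordinate_sets X)"
    unfolding M_def using sub by (simp add: sets_measure_of sigma_sets_sigma_sets_eq space_closed)
  have space_M: "space M = X" unfolding M_def by (rule space_measure_of[OF sub])
  have em: "emeasure M B = \<mu> B" if "B \<in> sigma_sets X (finite_coordinate_sets X)" for B
    unfolding M_def using \<mu>(2) that unfolding measure_space_def
    by (intro emeasure_measure_of_sigma) blast+
  have em': "emeasure M B = ?f B" if "B \<in> finite_coordinate_sets X" for B
    using em[OF sigma_sets.Basic[OF that]] \<mu>(1)[OF that] by simp
  show ?thesis
  proof
    show "sets M = sets (restrict_space borel X)" by (simp add: sets_M sets_borel_eq)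
    show "prob_space M"
      by (rule prob_spaceI) (simp add: space_M em' one)
    show "measure M B = m B" if "B \<in> finite_coordinate_sets X" for B
      using em'[OF that] nonneg by (simp add: measure_def)
  qed
qed

lemma translate_vimage_finite_coordinate_sets:
  assumes "B \<in> finite_coordinate_sets X"
  shows "translate 1 -` B \<inter> X \<in> finite_coordinate_sets X"
proof -
  obtain r :: nat where r: "B \<subseteq> X"
    "\<And>x y s. r \<le> s \<Longrightarrow> x \<in> X \<Longrightarrow> y \<in> X \<Longrightarrow> (\<forall>i\<in>{-int s..int s}. x i = y i) \<Longrightarrow> x \<in> B \<longleftrightarrow> y \<in> B"
    using assms by (rule finite_coordinate_setsE) blast
  show ?thesis unfolding finite_coordinate_sets_def
  proof (intro CollectI conjI exI[of _ "Suc r"] ballI impI)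
    fix x y assume xy: "x \<in> X" "y \<in> X" "\<forall>i\<in>{-int (Suc r)..int (Suc r)}. x i = y i"
      and x: "x \<in> translate 1 -` B \<inter> X"
    have "\<forall>i\<in>{-int r..int r}. translate 1 x i = translate 1 y i" using xy(3) by auto
    from r(2)[OF order_refl translate_mem[OF xy(1)] translate_mem[OF xy(2)] this]
    show "y \<in> translate 1 -` B \<inter> X" using x xy(2) by blast
  qed auto
qed

end

text \<open>Invariant measures with almost maximal integrals have a cluster point in the compact space of set
  functions with values in \<open>[0, 1]\<close>. The conditions of being normalized, additive and invariant on
  the algebra are closed, so they pass to the cluster point \<open>m\<close>.\<close>

theorem (in shift_observable) ex_maximizing_measure:
  "\<exists>M\<in>invariant_measures X left_shift.
     integral\<^sup>L M f = (SUP \<mu>\<in>invariant_measures X left_shift. integral\<^sup>L \<mu> f)"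
proof -
  let ?S = "SUP \<mu>\<in>invariant_measures X left_shift. integral\<^sup>L \<mu> f"
  have "\<exists>M\<in>invariant_measures X left_shift. ?S - 1 / real (Suc n) < integral\<^sup>L M f" for n
    using less_cSUP_iff[OF invariant_measures_nonempty bdd_above_integrals, of "?S - 1 / real (Suc n)"] by simp
  then obtain M where M: "\<And>n. M n \<in> invariant_measures X left_shift"
      "\<And>n. ?S - 1 / real (Suc n) < integral\<^sup>L (M n) f" by metis
  note M' = invariant_measuresD[OF M(1)]
  define F where "F = filtermap (\<lambda>n. measure (M n)) sequentially"
  have "compactin (product_topology (\<lambda>_::(int \<Rightarrow> 'a) set. euclidean) UNIV) (PiE UNIV (\<lambda>_. {0..1::real}))"
    unfolding compactin_PiE by auto
  hence comp: "compact (PiE (UNIV :: (int \<Rightarrow> 'a) set set) (\<lambda>_. {0..1::real}))"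
    by (simp add: euclidean_product_topology)
  have "measure (M n) \<in> PiE UNIV (\<lambda>_. {0..1})" for n
    using prob_space.prob_le_1[OF M'(3)[of n]] by (auto simp: PiE_iff)
  hence "eventually (\<lambda>m. m \<in> PiE UNIV (\<lambda>_. {0..1})) F" by (simp add: F_def eventually_filtermap)
  moreover have "F \<noteq> bot" by (simp add: F_def filtermap_bot_iff)
  ultimately obtain m where m: "inf (nhds m) F \<noteq> bot"
    using comp[unfolded compact_filter] by blast
  \<comment> \<open>closed conditions pass to the cluster point\<close>
  have limit: "m \<in> Q" if "closed Q" "eventually (\<lambda>n. measure (M n) \<in> Q) sequentially" for Q
  proof (rule ccontr)
    assume "m \<notin> Q"
    hence "eventually (\<lambda>x. x \<in> - Q) (nhds m)"
      using that(1) by (intro eventually_nhds_in_open) auto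
    moreover have "eventually (\<lambda>x. x \<in> Q) F" using that(2) by (simp add: F_def eventually_filtermap)
    ultimately have "eventually (\<lambda>x. False) (inf (nhds m) F)"
      unfolding eventually_inf by (intro exI conjI) auto
    thus False using m by (simp add: trivial_limit_def)
  qed
  interpret algebra X "finite_coordinate_sets X" by (rule algebra_finite_coordinate_sets)
  have sets_M: "B \<in> sets (M n)" if "B \<in> finite_coordinate_sets X" for B n
    using that unfolding M' sets_borel_eq by auto
  have nonneg: "m B \<ge> 0" for B
  proof -
    have "closed {m :: (int \<Rightarrow> 'a) set \<Rightarrow> real. 0 \<le> m B}"
      by (intro closed_Collect_le continuous_on_const continuous_on_product_coordinates)
    thus ?thesis using limit[of "{m. 0 \<le> m B}"] by simp
  qed
  have one: "m X = 1"
  proof -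
    have "measure (M n) X = 1" for n using prob_space.prob_space[OF M'(3)[of n]] M'(2) by simp
    moreover have "closed {m :: (int \<Rightarrow> 'a) set \<Rightarrow> real. m X = 1}"
      by (intro closed_Collect_eq continuous_on_const continuous_on_add continuous_on_product_coordinates)
    ultimately show ?thesis using limit[of "{m. m X = 1}"] by simp
  qed
  have add: "m (B \<union> D) = m B + m D"
    if "B \<in> finite_coordinate_sets X" "D \<in> finite_coordinate_sets X" "B \<inter> D = {}" for B D
  proof -
    have "measure (M n) (B \<union> D) = measure (M n) B + measure (M n) D" for n
      using that sets_M prob_space.finite_measure[OF M'(3)] by (intro finite_measure.finite_measure_Union)
    moreover have "closed {m :: (int \<Rightarrow> 'a) set \<Rightarrow> real. m (B \<union> D) = m B + m D}"
      by (intro closed_Collect_eq continuous_on_const continuous_on_add continuous_on_product_coordinates)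
    ultimately show ?thesis using limit[of "{m. m (B \<union> D) = m B + m D}"] by simp
  qed
  have shift: "m (translate 1 -` B \<inter> X) = m B" if "B \<in> finite_coordinate_sets X" for B
  proof -
    have "measure (M n) (translate 1 -` B \<inter> X) = measure (M n) B" for n
      using measure_distr[OF M'(4)[of n] sets_M[OF that]] M'(5)[of n] M'(2)[of n]
      by (simp add: left_shift_eq_translate)
    moreover have "closed {m :: (int \<Rightarrow> 'a) set \<Rightarrow> real. m (translate 1 -` B \<inter> X) = m B}"
      by (intro closed_Collect_eq continuous_on_const continuous_on_add continuous_on_product_coordinates)
    ultimately show ?thesis using limit[of "{m. m (translate 1 -` B \<inter> X) = m B}"] by simp
  qed
  obtain L where L: "sets L = sets (restrict_space borel X)" "prob_space L"
      "\<And>B. B \<in> finite_coordinate_sets X \<Longrightarrow> measure L B = m B"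
    using extend_finitely_additive[of m] nonneg one add by metis
  interpret L: prob_space L by fact
  have space_L: "space L = X" using sets_eq_imp_space_eq[OF L(1)] by simp
  have shift_meas: "left_shift \<in> measurable L L"
    unfolding left_shift_eq_translate using measurable_translate[of 1] L(1) by (simp cong: measurable_cong_sets)
  have "distr L L left_shift = L"
  proof (rule measure_eqI_shift)
    fix B assume B: "B \<in> finite_coordinate_sets X"
    hence "B \<in> sets L" unfolding L(1) sets_borel_eq by auto
    hence "emeasure (distr L L left_shift) B = emeasure L (translate 1 -` B \<inter> X)"
      using emeasure_distr[OF shift_meas] by (simp add: left_shift_eq_translate space_L)
    also have "\<dots> = emeasure L B"
      using B translate_vimage_finite_coordinate_sets[OF B] by (simp add: L.emeasure_eq_measure L(3) shift)
    finally show "emeasure (distr L L left_shift) B = emeasure L B" .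
  qed (use L L.prob_space_distr[OF shift_meas] in auto)
  hence inv: "L \<in> invariant_measures X left_shift"
    using L(1,2) shift_meas by (simp add: invariant_measures_def)
  have "?S \<le> integral\<^sup>L L f"
  proof (rule field_le_epsilon)
    fix d :: real assume "d > 0"
    define e where "e = d / 3"
    have e: "e > 0" using \<open>d > 0\<close> by (simp add: e_def)
    obtain \<P> c where P: "finite \<P>" "\<P> \<subseteq> finite_coordinate_sets X"
        "\<And>M. sets M = sets (restrict_space borel X) \<Longrightarrow> prob_space M \<Longrightarrow>
          \<bar>integral\<^sup>L M f - (\<Sum>P\<in>\<P>. c P * measure M P)\<bar> \<le> e"
      using integral_approximation[OF e] by blast
    obtain n0 where n0: "1 / real (Suc n0) < e" using nat_approx_posE[OF e] by blast
    have "m \<in> {m. ?S - 2 * e \<le> (\<Sum>P\<in>\<P>. c P * m P)}"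
    proof (rule limit)
      show "closed {m. ?S - 2 * e \<le> (\<Sum>P\<in>\<P>. c P * m P)}"
        by (intro closed_Collect_le continuous_intros) auto
      have "?S - 2 * e \<le> (\<Sum>P\<in>\<P>. c P * measure (M n) P)" if "n \<ge> n0" for n
      proof -
        have "1 / real (Suc n) \<le> 1 / real (Suc n0)" using that by (simp add: frac_le)
        thus ?thesis using M(2)[of n] n0 P(3)[OF M'(1) M'(3), of n] by linarith
      qed
      thus "eventually (\<lambda>n. measure (M n) \<in> {m. ?S - 2 * e \<le> (\<Sum>P\<in>\<P>. c P * m P)}) sequentially"
        by (auto simp: eventually_sequentially)
    qed
    moreover have "(\<Sum>P\<in>\<P>. c P * measure L P) = (\<Sum>P\<in>\<P>. c P * m P)"
      using P(2) L(3) by (intro sum.cong) auto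
    ultimately have "?S - 2 * e \<le> (\<Sum>P\<in>\<P>. c P * measure L P)" by simp
    moreover have "d = 3 * e" by (simp add: e_def)
    ultimately show "?S \<le> integral\<^sup>L L f + d" using P(3)[OF L(1,2)] by linarith
  qed
  moreover have "integral\<^sup>L L f \<le> ?S" by (rule cSUP_upper[OF inv bdd_above_integrals])
  ultimately show ?thesis using inv by (intro bexI[of _ L]) auto
qed


section \<open>Steering sums by control bits at all scales\<close>

text \<open>Interval functions \<open>D i j\<close> that are additive in the interval \<open>[i, j)\<close>.\<close>

lemma additive_blocks:
  fixes D :: "int \<Rightarrow> int \<Rightarrow> real"
  assumes add: "\<And>i j k. i \<le> j \<Longrightarrow> j \<le> k \<Longrightarrow> D i k = D i j + D j k" and "L \<ge> 0"
  shows "D a (a + int n * L) = (\<Sum>k<n. D (a + int k * L) (a + int k * L + L))"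
proof (induction n)
  case 0
  show ?case using add[of a a a] by simp
next
  case (Suc n)
  have "D a (a + int (Suc n) * L) = D a (a + int n * L) + D (a + int n * L) (a + int n * L + L)"
    using assms by (subst add[symmetric]) (auto simp: algebra_simps)
  thus ?case using Suc by simp
qed

lemma div_block:
  fixes L :: int
  assumes "L > 0"
  shows "p div L * L \<le> p" "p < p div L * L + L"
  using div_mult_mod_eq[of p L] pos_mod_bound[OF assms, of p] pos_mod_sign[OF assms, of p]
  by linarith+

text \<open>A bound on intervals whose ends are multiples of \<open>L\<close> gives one on all intervals.\<close>

lemma additive_round:
  fixes D :: "int \<Rightarrow> int \<Rightarrow> real"
  assumes add: "\<And>i j k. i \<le> j \<Longrightarrow> j \<le> k \<Longrightarrow> D i k = D i j + D j k" and L: "L > 0"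
    and C: "\<And>i j. i \<le> j \<Longrightarrow> \<bar>D i j\<bar> \<le> C * real_of_int (j - i)" "C \<ge> 0"
    and aligned: "\<And>a b. a \<le> b \<Longrightarrow> \<bar>D (a * L) (b * L)\<bar> \<le> \<kappa> * real_of_int (b * L - a * L) + B"
    and "\<kappa> \<ge> 0" "B \<ge> 0" "i \<le> j"
  shows "\<bar>D i j\<bar> \<le> \<kappa> * real_of_int (j - i) + (B + 2 * C * real_of_int L)"
proof -
  define a where "a = - ((- i) div L)"
  define b where "b = j div L"
  have "a * L = - ((- i) div L * L)" by (simp add: a_def)
  hence a: "i \<le> a * L" "a * L < i + L" using div_block[OF L, of "- i"] by linarith+
  have b: "b * L \<le> j" "j < b * L + L" using div_block[OF L, of j] by (auto simp: b_def)
  have CL: "\<bar>D p q\<bar> \<le> C * real_of_int L" if "p \<le> q" "q \<le> p + L" for p q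
    using C(1)[OF that(1)] mult_left_mono[OF _ C(2), of "real_of_int (q - p)" "real_of_int L"] that by simp
  have nonneg: "0 \<le> C * real_of_int L" "0 \<le> \<kappa> * real_of_int (j - i)" using C(2) L \<open>\<kappa> \<ge> 0\<close> \<open>i \<le> j\<close> by auto
  show ?thesis
  proof (cases "a \<le> b")
    case True
    hence le: "a * L \<le> b * L" using L by simp
    have "D i j = D i (a * L) + (D (a * L) (b * L) + D (b * L) j)"
      using add[OF a(1) order_trans[OF le b(1)]] add[OF le b(1)] by linarith
    moreover have "\<bar>D i (a * L)\<bar> \<le> C * real_of_int L" "\<bar>D (b * L) j\<bar> \<le> C * real_of_int L"
      using a b by (auto intro!: CL)
    moreover have "\<kappa> * real_of_int (b * L - a * L) \<le> \<kappa> * real_of_int (j - i)"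
      using a b \<open>\<kappa> \<ge> 0\<close> by (intro mult_left_mono) linarith+
    ultimately show ?thesis using aligned[OF True] by linarith
  next
    case False
    hence "(b + 1) * L \<le> a * L" using L by (intro mult_right_mono) auto
    hence "j \<le> i + L" using a b by (simp add: algebra_simps)
    hence "\<bar>D i j\<bar> \<le> C * real_of_int L" using \<open>i \<le> j\<close> by (intro CL)
    thus ?thesis using nonneg \<open>B \<ge> 0\<close> by linarith
  qed
qed

text \<open>A sum \<open>D s i j\<close> over \<open>[i, j)\<close> that depends on a sequence \<open>s\<close> of control bits, but on the bits
  outside \<open>[i, j)\<close> only up to a sublinear error.\<close>

definition controlled :: "real \<Rightarrow> (real \<Rightarrow> real) \<Rightarrow> ((int \<Rightarrow> bool) \<Rightarrow> int \<Rightarrow> int \<Rightarrow> real) \<Rightarrow> bool" where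
  "controlled C R D \<longleftrightarrow>
     (\<forall>s i j k. i \<le> j \<longrightarrow> j \<le> k \<longrightarrow> D s i k = D s i j + D s j k) \<and>
     (\<forall>s i j. i \<le> j \<longrightarrow> \<bar>D s i j\<bar> \<le> C * real_of_int (j - i)) \<and>
     (\<forall>e>0. \<forall>s s' i j. i \<le> j \<longrightarrow> (\<forall>p\<in>{i..<j}. s p = s' p) \<longrightarrow>
        \<bar>D s i j - D s' i j\<bar> \<le> e * real_of_int (j - i) + R e)"

text \<open>\<open>\<Phi>\<close> expands each bit of a sequence into a block of \<open>L\<close> bits, which may depend on the position.\<close>

definition blockwise :: "int \<Rightarrow> ((int \<Rightarrow> bool) \<Rightarrow> int \<Rightarrow> bool) \<Rightarrow> bool" where
  "blockwise L \<Phi> \<longleftrightarrow> (\<forall>b b' m. b m = b' m \<longrightarrow> (\<forall>p\<in>{m * L..<m * L + L}. \<Phi> b p = \<Phi> b' p))"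

text \<open>After the expansion \<open>\<Phi>\<close>, each bit decides the sign of the sum over its block, with mean at
  least \<open>\<delta>\<close> in absolute value.\<close>

definition steers :: "((int \<Rightarrow> bool) \<Rightarrow> int \<Rightarrow> int \<Rightarrow> real) \<Rightarrow> int \<Rightarrow> real \<Rightarrow> ((int \<Rightarrow> bool) \<Rightarrow> int \<Rightarrow> bool) \<Rightarrow> bool" where
  "steers D L \<delta> \<Phi> \<longleftrightarrow> blockwise L \<Phi> \<and> (\<forall>b m.
     (b m \<longrightarrow> \<delta> * real_of_int L \<le> D (\<Phi> b) (m * L) (m * L + L)) \<and>
     (\<not> b m \<longrightarrow> D (\<Phi> b) (m * L) (m * L + L) \<le> - (\<delta> * real_of_int L)))"

lemma discrete_ivt:
  fixes G :: "nat \<Rightarrow> real"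
  assumes "G 0 \<le> \<tau>" "\<tau> \<le> G M" and step: "\<And>i. i < M \<Longrightarrow> \<bar>G (Suc i) - G i\<bar> \<le> J" and "J \<ge> 0"
  obtains i where "i \<le> M" "\<bar>G i - \<tau>\<bar> \<le> J"
proof -
  define i where "i = (LEAST i. \<tau> \<le> G i)"
  have i: "\<tau> \<le> G i" unfolding i_def by (rule LeastI[of _ M]) fact
  have le: "i \<le> M" unfolding i_def by (rule Least_le) fact
  have "\<bar>G i - \<tau>\<bar> \<le> J"
  proof (cases i)
    case 0
    thus ?thesis using i assms by simp
  next
    case (Suc k)
    hence "\<not> \<tau> \<le> G k" unfolding i_def by (intro not_less_Least) auto
    thus ?thesis using i step[of k] Suc le by auto
  qed
  with le show ?thesis by (rule that)
qed

text \<open>The renormalization step. Within a block of \<open>M\<close> blocks of length \<open>L\<close>, the first \<open>i\<close> bits are set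
  to true and the others to false. As \<open>i\<close> grows from \<open>0\<close> to \<open>M\<close>, the mean moves from below \<open>-\<delta>\<close> to
  above \<open>\<delta>\<close> in steps that are small for large \<open>M\<close>, so it can be brought close to \<open>2 * d\<close> and to
  \<open>-2 * d\<close>: the larger blocks are steered again, with means between \<open>d\<close> and \<open>3 * d\<close>.\<close>

lemma steering_step:
  assumes L: "L > 0" and d: "d > 0" "2 * d \<le> \<delta>" and C: "C \<ge> 0" and R: "\<And>e. R e \<ge> 0"
  obtains M :: nat where "M > 0"
    "\<And>D \<Phi>. controlled C R D \<Longrightarrow> steers D L \<delta> \<Phi> \<Longrightarrow>
      \<exists>\<Psi>. steers D (L * int M) d (\<Phi> \<circ> \<Psi>) \<and>
        (\<forall>b m. \<bar>D (\<Phi> (\<Psi> b)) (m * (L * int M)) (m * (L * int M) + L * int M)\<bar> \<le> 3 * d * real_of_int (L * int M))"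
proof -
  define e where "e = d / 4"
  have e: "e > 0" using d by (simp add: e_def)
  define q where "q = (3 * R e + 2 * C * real_of_int L) / (d / 2 * real_of_int L)"
  define M where "M = Suc (nat \<lceil>q\<rceil>)"
  define T where "T = L * int M"
  have M0: "M > 0" by (simp add: M_def)
  hence T: "T > 0" using L by (simp add: T_def)
  have "q \<le> real M" unfolding M_def by linarith
  hence M: "3 * R e + 2 * C * real_of_int L \<le> d / 2 * real_of_int T"
    using d L by (simp add: q_def T_def field_simps)
  define J where "J = e * real_of_int T + 2 * R e + 2 * C * real_of_int L"
  have J0: "J \<ge> 0" unfolding J_def using e T R[of e] C L by simp
  have JT: "J + (e * real_of_int T + R e) \<le> d * real_of_int T"
    using M by (simp add: J_def e_def)
  show ?thesis
  proof
    show "M > 0" by (rule M0)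
    fix D \<Phi> assume D: "controlled C R D" and \<Phi>: "steers D L \<delta> \<Phi>"
    have add: "\<And>s i j k. i \<le> j \<Longrightarrow> j \<le> k \<Longrightarrow> D s i k = D s i j + D s j k"
      and bnd: "\<And>s i j. i \<le> j \<Longrightarrow> \<bar>D s i j\<bar> \<le> C * real_of_int (j - i)"
      and ctx: "\<And>s s' i j. i \<le> j \<Longrightarrow> (\<forall>p\<in>{i..<j}. s p = s' p) \<Longrightarrow>
        \<bar>D s i j - D s' i j\<bar> \<le> e * real_of_int (j - i) + R e"
      using D e unfolding controlled_def by blast+
    have block: "blockwise L \<Phi>" using \<Phi> unfolding steers_def by (rule conjunct1)
    have loc: "\<Phi> b p = \<Phi> b' p" if "b m = b' m" "m * L \<le> p" "p < m * L + L" for b b' m p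
      using block[unfolded blockwise_def, THEN spec[of _ b], THEN spec[of _ b'], THEN spec[of _ m]] that by simp
    note \<Phi>' = \<Phi>[unfolded steers_def, THEN conjunct2, THEN spec, THEN spec]
    have up: "\<delta> * real_of_int L \<le> D (\<Phi> b) (m * L) (m * L + L)" if "b m" for b m
      using \<Phi>'[of b m] that by simp
    have down: "D (\<Phi> b) (m * L) (m * L + L) \<le> - (\<delta> * real_of_int L)" if "\<not> b m" for b m
      using \<Phi>'[of b m] that by simp
    have agree: "\<Phi> b p = \<Phi> b' p" if "\<And>k. k \<in> {x..<y} \<Longrightarrow> b k = b' k" "x * L \<le> p" "p < y * L" for b b' x y p
    proof -
      note div_block[OF L, of p]
      moreover have "x \<le> p div L" using zdiv_mono1[OF that(2) L] L by simp
      moreover have "p div L < y" using le_less_trans[OF div_block(1)[OF L, of p] that(3)] L by simp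
      ultimately show ?thesis using loc[of b "p div L" b' p] that(1)[of "p div L"] by simp
    qed
    \<comment> \<open>In the \<open>m\<close>-th large block, \<open>bits m i\<close> has exactly \<open>i\<close> true bits; \<open>G m i\<close> is the sum over that
      block.\<close>
    define bits where "bits m i = (\<lambda>p. p < m * int M + int i)" for m :: int and i :: nat
    define G where "G m i = D (\<Phi> (bits m i)) (m * T) (m * T + T)" for m i
    have blocks: "D s (m * T) (m * T + T) = (\<Sum>k<M. D s ((m * int M + int k) * L) ((m * int M + int k) * L + L))" for s m
      using additive_blocks[of "D s", OF add less_imp_le[OF L], of "m * T" M]
      by (simp add: T_def algebra_simps)
    have "G m 0 \<le> (\<Sum>k<M. - (\<delta> * real_of_int L))" for m
      unfolding G_def blocks by (intro sum_mono down) (auto simp: bits_def)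
    hence G0: "G m 0 \<le> - (\<delta> * real_of_int T)" for m by (simp add: T_def algebra_simps)
    have "(\<Sum>k<M. \<delta> * real_of_int L) \<le> G m M" for m
      unfolding G_def blocks by (intro sum_mono up) (auto simp: bits_def)
    hence GM: "\<delta> * real_of_int T \<le> G m M" for m by (simp add: T_def algebra_simps)
    \<comment> \<open>Passing from \<open>i\<close> to \<open>i + 1\<close> changes a single small block; the sums to its left and right
      change only through their contexts.\<close>
    have step: "\<bar>G m (Suc i) - G m i\<bar> \<le> J" if "i < M" for m i
    proof -
      let ?s = "\<Phi> (bits m (Suc i))" and ?s' = "\<Phi> (bits m i)"
      define c where "c = m * int M + int i"
      have c: "m * T \<le> c * L" "(c + 1) * L \<le> m * T + T"
      proof -
        have "m * int M * L \<le> c * L" using L by (intro mult_right_mono) (auto simp: c_def)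
        thus "m * T \<le> c * L" by (simp add: T_def algebra_simps)
        have "(c + 1) * L \<le> (m * int M + int M) * L"
          using L that by (intro mult_right_mono) (auto simp: c_def)
        thus "(c + 1) * L \<le> m * T + T" by (simp add: T_def algebra_simps)
      qed
      have split: "D s (m * T) (m * T + T) = D s (m * T) (c * L) + D s (c * L) ((c + 1) * L)
          + D s ((c + 1) * L) (m * T + T)" for s
        using add[of "m * T" "c * L" "m * T + T" s] add[of "c * L" "(c + 1) * L" "m * T + T" s] c L
        by (simp add: algebra_simps)
      have 1: "\<bar>D ?s (m * T) (c * L) - D ?s' (m * T) (c * L)\<bar> \<le> e * real_of_int (c * L - m * T) + R e"
      proof (rule ctx[OF c(1)], intro ballI)
        fix p assume "p \<in> {m * T..<c * L}"
        thus "?s p = ?s' p"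
          by (intro agree[of "m * int M" c]) (auto simp: bits_def c_def T_def algebra_simps)
      qed
      have 2: "\<bar>D ?s ((c + 1) * L) (m * T + T) - D ?s' ((c + 1) * L) (m * T + T)\<bar>
          \<le> e * real_of_int (m * T + T - (c + 1) * L) + R e"
      proof (rule ctx[OF c(2)], intro ballI)
        fix p assume "p \<in> {(c + 1) * L..<m * T + T}"
        thus "?s p = ?s' p"
          by (intro agree[of "c + 1" "m * int M + int M"]) (auto simp: bits_def c_def T_def algebra_simps)
      qed
      have 3: "\<bar>D s (c * L) ((c + 1) * L)\<bar> \<le> C * real_of_int L" for s
        using bnd[of "c * L" "(c + 1) * L" s] L by (simp add: algebra_simps)
      have "e * real_of_int (c * L - m * T) + e * real_of_int (m * T + T - (c + 1) * L) \<le> e * real_of_int T"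
        unfolding distrib_left[symmetric] using e L by (intro mult_left_mono) (auto simp: algebra_simps)
      thus ?thesis using 1 2 3[of ?s] 3[of ?s'] unfolding G_def split J_def by linarith
    qed
    have "\<exists>i\<le>M. \<bar>G m i - (if v then 2 * d * real_of_int T else - (2 * d * real_of_int T))\<bar> \<le> J" for m v
    proof -
      have "2 * d * real_of_int T \<le> \<delta> * real_of_int T" using d T by (intro mult_right_mono) auto
      moreover have "0 \<le> 2 * d * real_of_int T" using d T by simp
      ultimately have "G m 0 \<le> (if v then 2 * d * real_of_int T else - (2 * d * real_of_int T))"
          "(if v then 2 * d * real_of_int T else - (2 * d * real_of_int T)) \<le> G m M"
        using G0[of m] GM[of m] by auto
      from discrete_ivt[OF this step J0] show ?thesis by blast
    qed
    then obtain pos where pos: "\<And>m v. pos m v \<le> M"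
        "\<And>m v. \<bar>G m (pos m v) - (if v then 2 * d * real_of_int T else - (2 * d * real_of_int T))\<bar> \<le> J"
      by metis
    define \<Psi> where "\<Psi> b = (\<lambda>p. bits (p div int M) (pos (p div int M) (b (p div int M))) p)" for b
    have \<Psi>: "\<Psi> b p = bits m (pos m (b m)) p" if "p \<in> {m * int M..<m * int M + int M}" for b p m
    proof -
      have "p div int M = m" using that by (intro int_div_pos_eq[of _ _ _ "p - m * int M"]) (auto simp: algebra_simps)
      thus ?thesis by (simp add: \<Psi>_def)
    qed
    have val: "\<bar>D (\<Phi> (\<Psi> b)) (m * T) (m * T + T) -
        (if b m then 2 * d * real_of_int T else - (2 * d * real_of_int T))\<bar> \<le> d * real_of_int T" for b m
    proof -
      have "\<bar>D (\<Phi> (\<Psi> b)) (m * T) (m * T + T) - G m (pos m (b m))\<bar> \<le> e * real_of_int (m * T + T - m * T) + R e"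
        unfolding G_def
      proof (rule ctx, use T in simp, intro ballI)
        fix p assume "p \<in> {m * T..<m * T + T}"
        thus "\<Phi> (\<Psi> b) p = \<Phi> (bits m (pos m (b m))) p"
          by (intro agree[of "m * int M" "m * int M + int M"] \<Psi>) (auto simp: T_def algebra_simps)
      qed
      thus ?thesis using pos(2)[of m "b m"] JT by simp
    qed
    have "blockwise T (\<Phi> \<circ> \<Psi>)"
      unfolding blockwise_def
    proof (intro allI impI ballI)
      fix b b' :: "int \<Rightarrow> bool" and m p assume "b m = b' m" "p \<in> {m * T..<m * T + T}"
      thus "(\<Phi> \<circ> \<Psi>) b p = (\<Phi> \<circ> \<Psi>) b' p" unfolding o_apply
        by (intro agree[of "m * int M" "m * int M + int M"]) (auto simp: \<Psi> T_def algebra_simps)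
    qed
    moreover have "d * real_of_int T \<le> D (\<Phi> (\<Psi> b)) (m * T) (m * T + T)" if "b m" for b m
      using val[of b m] that by simp
    moreover have "D (\<Phi> (\<Psi> b)) (m * T) (m * T + T) \<le> - (d * real_of_int T)" if "\<not> b m" for b m
      using val[of b m] that by simp
    moreover have "\<bar>D (\<Phi> (\<Psi> b)) (m * T) (m * T + T)\<bar> \<le> 3 * d * real_of_int T" for b m
      using val[of b m] d T by (cases "b m") auto
    ultimately show "\<exists>\<Psi>. steers D (L * int M) d (\<Phi> \<circ> \<Psi>) \<and>
        (\<forall>b m. \<bar>D (\<Phi> (\<Psi> b)) (m * (L * int M)) (m * (L * int M) + L * int M)\<bar> \<le> 3 * d * real_of_int (L * int M))"
      unfolding steers_def T_def[symmetric] by (intro exI[of _ \<Psi>]) auto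
  qed
qed

text \<open>Iterating the step gives bits for which all sums are small at every scale up to \<open>j\<close>, with
  bounds that depend neither on \<open>j\<close> nor on \<open>D\<close>.\<close>

lemma steering:
  assumes \<delta>: "\<delta> > 0" and C: "C \<ge> 0" and R: "\<And>e. R e \<ge> 0"
  obtains B :: "nat \<Rightarrow> real" where "\<And>k. B k \<ge> 0"
    "\<And>D j. controlled C R D \<Longrightarrow> steers D 1 \<delta> id \<Longrightarrow>
      \<exists>s. \<forall>k\<le>j. \<forall>p q. p \<le> q \<longrightarrow> \<bar>D s p q\<bar> \<le> 3 * \<delta> / 2 ^ Suc k * real_of_int (q - p) + B k"
proof -
  \<comment> \<open>\<open>good k L L'\<close>: from blocks of length \<open>L\<close> steered with means \<open>\<delta> / 2 ^ k\<close> one can pass to blocks of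
    length \<open>L'\<close> steered with half these means.\<close>
  define good where "good k L L' \<longleftrightarrow> L' > 0 \<and> (\<forall>D \<Phi>. controlled C R D \<longrightarrow> steers D L (\<delta> / 2 ^ k) \<Phi> \<longrightarrow>
      (\<exists>\<Psi>. steers D L' (\<delta> / 2 ^ Suc k) (\<Phi> \<circ> \<Psi>) \<and>
        (\<forall>b m. \<bar>D (\<Phi> (\<Psi> b)) (m * L') (m * L' + L')\<bar> \<le> 3 * (\<delta> / 2 ^ Suc k) * real_of_int L')))" for k and L L' :: int
  have "\<exists>L'. good k L L'" if L: "L > 0" for k L
  proof -
    have "\<delta> / 2 ^ Suc k > 0" "2 * (\<delta> / 2 ^ Suc k) \<le> \<delta> / 2 ^ k" using \<delta> by auto
    note step = steering_step[OF L this C R]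
    show ?thesis
    proof (rule step)
      fix M :: nat assume M: "M > 0" and "\<And>D \<Phi>. controlled C R D \<Longrightarrow> steers D L (\<delta> / 2 ^ k) \<Phi> \<Longrightarrow>
        \<exists>\<Psi>. steers D (L * int M) (\<delta> / 2 ^ Suc k) (\<Phi> \<circ> \<Psi>) \<and>
          (\<forall>b m. \<bar>D (\<Phi> (\<Psi> b)) (m * (L * int M)) (m * (L * int M) + L * int M)\<bar>
            \<le> 3 * (\<delta> / 2 ^ Suc k) * real_of_int (L * int M))"
      moreover have "L * int M > 0" using L M by simp
      ultimately have "good k L (L * int M)" unfolding good_def by blast
      thus ?thesis by blast
    qed
  qed
  hence "\<forall>k L. \<exists>L'. L > 0 \<longrightarrow> good k L L'" by blast
  then obtain next_scale where "\<And>k L. L > 0 \<Longrightarrow> good k L (next_scale k L)" by metis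
  moreover define Ls where "Ls = rec_nat (1 :: int) next_scale"
  ultimately have Ls0: "Ls 0 = 1" and LsS: "\<And>k. Ls k > 0 \<Longrightarrow> good k (Ls k) (Ls (Suc k))" by auto
  have pos: "Ls k > 0" for k
    by (induction k) (use Ls0 LsS in \<open>auto simp: good_def\<close>)
  show ?thesis
  proof
    show "2 * C * real_of_int (Ls (Suc k)) \<ge> 0" for k using C pos[of "Suc k"] by simp
    fix D j assume D: "controlled C R D" and st: "steers D 1 \<delta> id"
    have add: "\<And>s i j k. i \<le> j \<Longrightarrow> j \<le> k \<Longrightarrow> D s i k = D s i j + D s j k"
      and bnd: "\<And>s i j. i \<le> j \<Longrightarrow> \<bar>D s i j\<bar> \<le> C * real_of_int (j - i)"
      using D unfolding controlled_def by blast+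
    have "\<exists>\<Phi>. steers D (Ls n) (\<delta> / 2 ^ n) \<Phi> \<and> (\<forall>b. \<forall>k<n. \<forall>m.
      \<bar>D (\<Phi> b) (m * Ls (Suc k)) (m * Ls (Suc k) + Ls (Suc k))\<bar> \<le> 3 * (\<delta> / 2 ^ Suc k) * real_of_int (Ls (Suc k)))" for n
    proof (induction n)
      case 0
      have "steers D (Ls 0) (\<delta> / 2 ^ 0) id" using st by (simp only: Ls0 power_0 div_by_1)
      thus ?case by blast
    next
      case (Suc n)
      then obtain \<Phi> where \<Phi>: "steers D (Ls n) (\<delta> / 2 ^ n) \<Phi>"
        "\<forall>b. \<forall>k<n. \<forall>m. \<bar>D (\<Phi> b) (m * Ls (Suc k)) (m * Ls (Suc k) + Ls (Suc k))\<bar>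
          \<le> 3 * (\<delta> / 2 ^ Suc k) * real_of_int (Ls (Suc k))" by blast
      obtain \<Psi> where \<Psi>: "steers D (Ls (Suc n)) (\<delta> / 2 ^ Suc n) (\<Phi> \<circ> \<Psi>)"
        "\<forall>b m. \<bar>D (\<Phi> (\<Psi> b)) (m * Ls (Suc n)) (m * Ls (Suc n) + Ls (Suc n))\<bar>
          \<le> 3 * (\<delta> / 2 ^ Suc n) * real_of_int (Ls (Suc n))"
        using LsS[OF pos[of n]] D \<Phi>(1) unfolding good_def by blast
      show ?case
      proof (intro exI[of _ "\<Phi> \<circ> \<Psi>"] conjI \<Psi>(1) allI impI)
        fix b k m assume "k < Suc n"
        hence "k < n \<or> k = n" by auto
        thus "\<bar>D ((\<Phi> \<circ> \<Psi>) b) (m * Ls (Suc k)) (m * Ls (Suc k) + Ls (Suc k))\<bar>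
          \<le> 3 * (\<delta> / 2 ^ Suc k) * real_of_int (Ls (Suc k))"
          unfolding o_apply using \<Phi>(2) \<Psi>(2) by blast
      qed
    qed
    from this[of "Suc j"] obtain s where s: "\<And>k m. k \<le> j \<Longrightarrow>
      \<bar>D s (m * Ls (Suc k)) (m * Ls (Suc k) + Ls (Suc k))\<bar> \<le> 3 * (\<delta> / 2 ^ Suc k) * real_of_int (Ls (Suc k))"
      by (auto simp: less_Suc_eq_le)
    have "\<bar>D s p q\<bar> \<le> 3 * \<delta> / 2 ^ Suc k * real_of_int (q - p) + (0 + 2 * C * real_of_int (Ls (Suc k)))"
      if "k \<le> j" "p \<le> q" for k p q
    proof (rule additive_round[of "D s", OF add pos[of "Suc k"] bnd C])
      let ?L = "Ls (Suc k)"
      fix a b :: int assume "a \<le> b"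
      define n where "n = nat (b - a)"
      have b: "b = a + int n" using \<open>a \<le> b\<close> by (simp add: n_def)
      have "D s (a * ?L) (b * ?L) = (\<Sum>i<n. D s ((a + int i) * ?L) ((a + int i) * ?L + ?L))"
        using additive_blocks[of "D s", OF add less_imp_le[OF pos[of "Suc k"]], of "a * ?L" n]
        by (simp add: b algebra_simps)
      also have "\<bar>\<dots>\<bar> \<le> (\<Sum>i<n. 3 * (\<delta> / 2 ^ Suc k) * real_of_int ?L)"
        by (intro order_trans[OF sum_abs sum_mono] s that)
      finally show "\<bar>D s (a * ?L) (b * ?L)\<bar> \<le> 3 * \<delta> / 2 ^ Suc k * real_of_int (b * ?L - a * ?L) + 0"
        by (simp add: b algebra_simps)
    qed (use \<delta> that in auto)
    thus "\<exists>s. \<forall>k\<le>j. \<forall>p q. p \<le> q \<longrightarrow> \<bar>D s p q\<bar> \<le> 3 * \<delta> / 2 ^ Suc k * real_of_int (q - p)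
        + 2 * C * real_of_int (Ls (Suc k))" by auto
  qed
qed


section \<open>Positive entropy from free bits\<close>

text \<open>If \<open>2 ^ p\<close> points of \<open>K\<close> are told apart by the letters at \<open>p * U\<close> consecutive positions,
  for every \<open>p\<close>, then the cover of \<open>K\<close> by the letter at position \<open>0\<close> has entropy at least
  \<open>ln 2 / U\<close>.\<close>

lemma topological_entropy_pos:
  fixes K :: "(int \<Rightarrow> 'a::discrete_topology) set"
  assumes A: "finite A" "\<And>x i. x \<in> K \<Longrightarrow> x i \<in> A"
    and inv: "\<And>x k. x \<in> K \<Longrightarrow> translate k x \<in> K" and U: "U > (0::nat)"
    and words: "\<And>p. \<exists>h :: nat set \<Rightarrow> int \<Rightarrow> 'a. (\<forall>S. h S \<in> K) \<and>
      (\<forall>S S'. S \<subseteq> {..<p} \<longrightarrow> S' \<subseteq> {..<p} \<longrightarrow> (\<forall>i<p * U. h S (int i) = h S' (int i)) \<longrightarrow> S = S')"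
  shows "topological_entropy K left_shift > 0"
proof -
  define \<C> where "\<C> = (\<lambda>a. {x\<in>K. x 0 = a}) ` A"
  have "openin (top_of_set K) {x\<in>K. x 0 = a}" for a
  proof -
    have "open {x :: int \<Rightarrow> 'a. x 0 = a}" by (rule open_if_finite_coordinates[of "{0}"]) auto
    moreover have "{x\<in>K. x 0 = a} = K \<inter> {x. x 0 = a}" by auto
    ultimately show ?thesis by (simp add: openin_open_Int)
  qed
  hence cover: "\<C> \<in> open_covers K" using A(2) by (auto simp: open_covers_def \<C>_def)
  define J where "J = cover_join left_shift K \<C>"
  have fin: "finite (J n)" for n
  proof -
    have "J n \<subseteq> (\<lambda>c. K \<inter> (\<Inter>i<n. (left_shift ^^ i) -` c i)) ` PiE {..<n} (\<lambda>_. \<C>)"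
    proof
      fix D assume "D \<in> J n"
      then obtain c where c: "D = K \<inter> (\<Inter>i<n. (left_shift ^^ i) -` c i)" "\<forall>i<n. c i \<in> \<C>"
        by (auto simp: J_def cover_join_def)
      have "restrict c {..<n} \<in> PiE {..<n} (\<lambda>_. \<C>)" using c(2) by auto
      moreover have "D = K \<inter> (\<Inter>i<n. (left_shift ^^ i) -` restrict c {..<n} i)" using c(1) by auto
      ultimately show "D \<in> (\<lambda>c. K \<inter> (\<Inter>i<n. (left_shift ^^ i) -` c i)) ` PiE {..<n} (\<lambda>_. \<C>)" by blast
    qed
    moreover have "finite (PiE {..<n} (\<lambda>_. \<C>))" using A(1) by (intro finite_PiE) (auto simp: \<C>_def)
    ultimately show ?thesis by (meson finite_imageI finite_subset)
  qed
  have cov: "K \<subseteq> \<Union> (J n)" for n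
  proof
    fix x assume x: "x \<in> K"
    let ?c = "\<lambda>i::nat. {y\<in>K. y 0 = x (int i)}"
    have "x \<in> K \<inter> (\<Inter>i<n. (left_shift ^^ i) -` ?c i)" using x inv by (auto simp: left_shift_funpow)
    moreover have "\<forall>i<n. ?c i \<in> \<C>" unfolding \<C>_def using A(2)[OF x] by simp
    hence "K \<inter> (\<Inter>i<n. (left_shift ^^ i) -` ?c i) \<in> J n"
      unfolding J_def cover_join_def by (intro CollectI exI[of _ ?c] conjI refl)
    ultimately show "x \<in> \<Union> (J n)" by blast
  qed
  have same: "x (int i) = y (int i)" if asm: "D \<in> J n" "x \<in> D" "y \<in> D" "i < n" for D x y i n
  proof -
    obtain c where c: "D = K \<inter> (\<Inter>i<n. (left_shift ^^ i) -` c i)" "\<forall>i<n. c i \<in> \<C>"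
      using asm(1) unfolding J_def cover_join_def by blast
    obtain a where "c i = {x\<in>K. x 0 = a}" using c(2) asm(4) by (auto simp: \<C>_def)
    moreover have "translate (int i) x \<in> c i" "translate (int i) y \<in> c i"
      using asm(2-4) unfolding c(1) left_shift_funpow by blast+
    ultimately show ?thesis by simp
  qed
  have number: "2 ^ p \<le> cover_number K (J (p * U))" for p
  proof -
    have "\<exists>\<D>\<subseteq>J (p * U). finite \<D> \<and> card \<D> = cover_number K (J (p * U)) \<and> K \<subseteq> \<Union>\<D>"
      unfolding cover_number_def
      by (rule LeastI[where P = "\<lambda>m. \<exists>\<D>\<subseteq>J (p * U). finite \<D> \<and> card \<D> = m \<and> K \<subseteq> \<Union>\<D>" and k = "card (J (p * U))"])
         (use fin cov in blast)
    then obtain \<D> where \<D>: "\<D> \<subseteq> J (p * U)" "finite \<D>" "card \<D> = cover_number K (J (p * U))" "K \<subseteq> \<Union>\<D>"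
      by blast
    obtain h where h: "\<And>S. h S \<in> K"
      "\<And>S S'. S \<subseteq> {..<p} \<Longrightarrow> S' \<subseteq> {..<p} \<Longrightarrow> (\<forall>i<p * U. h S (int i) = h S' (int i)) \<Longrightarrow> S = S'"
      using words[of p] by blast
    have "\<exists>D\<in>\<D>. h S \<in> D" for S using h(1)[of S] \<D>(4) by blast
    then obtain d where d: "\<And>S. d S \<in> \<D>" "\<And>S. h S \<in> d S" by metis
    have "inj_on d (Pow {..<p})"
    proof (rule inj_onI)
      fix S S' assume S: "S \<in> Pow {..<p}" "S' \<in> Pow {..<p}" "d S = d S'"
      have "\<forall>i<p * U. h S (int i) = h S' (int i)"
        using same[of "d S" "p * U" "h S" "h S'"] d[of S] d[of S'] S(3) \<D>(1) by auto
      thus "S = S'" using h(2)[of S S'] S by blast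
    qed
    hence "card (Pow {..<p}) \<le> card \<D>" using d(1) \<D>(2) by (intro card_inj_on_le[of d]) auto
    thus ?thesis using \<D>(3) by (simp add: card_Pow)
  qed
  let ?X = "\<lambda>n. ereal (ln (real (cover_number K (J n))) / real n)"
  let ?r = "\<lambda>p. Suc p * U"
  have "ereal (ln 2 / real U) \<le> ?X (?r p)" for p
  proof -
    have "real (Suc p) * ln 2 = ln (2 ^ Suc p :: real)" by (simp only: ln_realpow zero_less_numeral)
    also have "\<dots> \<le> ln (real (cover_number K (J (?r p))))"
    proof -
      have "real (2 ^ Suc p) \<le> real (cover_number K (J (?r p)))"
        using number[of "Suc p"] by (intro of_nat_mono)
      hence le: "2 ^ Suc p \<le> real (cover_number K (J (?r p)))" by simp
      have pos: "0 < (2 ^ Suc p :: real)" by simp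
      show ?thesis using ln_le_cancel_iff[OF pos less_le_trans[OF pos le]] le by blast
    qed
    finally have "real (Suc p) * ln 2 / real (?r p) \<le> ln (real (cover_number K (J (?r p)))) / real (?r p)"
      by (intro divide_right_mono) auto
    moreover have "real (Suc p) * ln 2 / real (?r p) = ln 2 / real U"
      unfolding of_nat_mult by (rule mult_divide_mult_cancel_left) simp
    ultimately show ?thesis by (simp only: ereal_less_eq)
  qed
  hence "ereal (ln 2 / real U) \<le> limsup (?X \<circ> ?r)"
    by (intro le_Limsup) (auto simp: o_def)
  also have "\<dots> \<le> limsup ?X"
    by (rule limsup_subseq_mono) (use U in \<open>auto simp: strict_mono_def\<close>)
  also have "\<dots> = cover_entropy left_shift K \<C>" by (simp add: cover_entropy_def J_def)
  also have "\<dots> \<le> topological_entropy K left_shift"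
    unfolding topological_entropy_def by (rule SUP_upper[OF cover])
  finally show ?thesis using U by (auto intro: less_le_trans[of 0 "ereal (ln 2 / real U)"])
qed


section \<open>A compact set of positive entropy on which all averages vanish\<close>

lemma concatenation_const_length:
  assumes "\<And>n. length (u n) = L" "L > 0"
  shows "concatenation u p = u (p div int L) ! nat (p mod int L)"
proof -
  have ne: "\<And>n. u n \<noteq> []" using assms by (metis list.size(3) less_irrefl)
  have m: "0 \<le> p mod int L" "p mod int L < int L" using assms(2) by auto
  have "nat (p mod int L) < length (u (p div int L))" using m assms(1) by simp
  hence "concatenation u (start u (p div int L) + int (nat (p mod int L))) = u (p div int L) ! nat (p mod int L)"
    using concatenation_eq[of u "nat (p mod int L)" "p div int L"] ne by blast
  moreover have "start u (p div int L) + int (nat (p mod int L)) = p"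
    using start_const_length[of u L "p div int L"] assms(1) m(1) by simp
  ultimately show ?thesis by simp
qed

lemma (in mixing_shift) loop_above_uminus_neq:
  assumes "loop_above f c l" "loop_above (\<lambda>x. - f x) d l'" "c > 0" "d > 0"
  shows "l \<noteq> l'"
proof
  assume eq: "l = l'"
  have loop: "loop l" using assms(1) by (simp add: loop_above_def)
  let ?x = "concatenation (\<lambda>_. l)" and ?L = "real (length l)"
  note x = periodic_point_from_loop[OF loop]
  have agree: "\<forall>k<length l. ?x (0 + int k) = l ! k" using x(3) by simp
  have "c * ?L \<le> orbit_sum f ?x 0 (0 + int (length l))"
    using assms(1) x(1) agree unfolding loop_above_def by blast
  moreover have "d * ?L \<le> orbit_sum (\<lambda>x. - f x) ?x 0 (0 + int (length l))"
    using assms(2) x(1) agree unfolding loop_above_def eq by blast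
  moreover have "c * ?L > 0" "d * ?L > 0" using assms loop_nonempty[OF loop] by auto
  ultimately show False by (simp add: orbit_sum_uminus)
qed

context shift_observable
begin

lemma continuous_orbit_sum: "continuous_on X (\<lambda>x. orbit_sum f x i j)"
  unfolding orbit_sum_def
proof (rule continuous_on_sum)
  fix p
  show "continuous_on X (\<lambda>x. f (translate p x))"
    by (rule continuous_on_compose2[OF cont continuous_on_translate]) (auto intro: translate_mem)
qed

lemma ex_opposite_loops:
  assumes M: "M \<in> invariant_measures X left_shift" "integral\<^sup>L M f > 0"
    and M': "M' \<in> invariant_measures X left_shift" "integral\<^sup>L M' f < 0"
  obtains P Q \<delta> where "\<delta> > 0" "loop_above f \<delta> P" "loop_above (\<lambda>x. - f x) \<delta> Q" "length P = length Q"
proof -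
  interpret neg: shift_observable X A w N "\<lambda>x. - f x" C by (rule shift_observable_uminus)
  define \<delta> where "\<delta> = min (integral\<^sup>L M f) (integral\<^sup>L M' (\<lambda>x. - f x)) / 2"
  have \<delta>: "\<delta> > 0" "\<delta> < integral\<^sup>L M f" "\<delta> < integral\<^sup>L M' (\<lambda>x. - f x)"
    using M(2) M'(2) by (auto simp: \<delta>_def)
  obtain n0 where n0: "\<And>n. n \<ge> n0 \<Longrightarrow> \<exists>l. loop_above f \<delta> l \<and> int (length l) = int n + 2 * N"
    using ex_loop_above[OF M(1) \<delta>(2)] by blast
  obtain n1 where n1: "\<And>n. n \<ge> n1 \<Longrightarrow> \<exists>l. loop_above (\<lambda>x. - f x) \<delta> l \<and> int (length l) = int n + 2 * N"
    using neg.ex_loop_above[OF M'(1) \<delta>(3)] by blast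
  obtain P where P: "loop_above f \<delta> P" "int (length P) = int (max n0 n1) + 2 * N"
    using n0[OF max.cobounded1] by blast
  obtain Q where Q: "loop_above (\<lambda>x. - f x) \<delta> Q" "int (length Q) = int (max n0 n1) + 2 * N"
    using n1[OF max.cobounded2] by blast
  show ?thesis by (rule that[OF \<delta>(1) P(1) Q(1)]) (use P(2) Q(2) in simp)
qed

text \<open>The points are concatenations of two loops \<open>P\<close> and \<open>Q\<close> of equal length, on which the sums are
  positive and negative. In each group of \<open>q + 1\<close> loops, the first one is chosen freely, and a control
  bit decides whether all the others are \<open>P\<close> or \<open>Q\<close>; for large \<open>q\<close> the control bit decides the sign of
  the sum over the group. Whatever the free bits, the control bits can be chosen such that all long
  sums are small, at rates that do not depend on the free bits.\<close>

theorem ex_compact_zero_averages: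
  assumes M: "M \<in> invariant_measures X left_shift" "integral\<^sup>L M f > 0"
    and M': "M' \<in> invariant_measures X left_shift" "integral\<^sup>L M' f < 0"
  obtains K where "K \<subseteq> X" "compact K" "left_shift ` K = K" "topological_entropy K left_shift > 0"
    "\<And>x. x \<in> K \<Longrightarrow> (\<lambda>n. birkhoff_average left_shift f n x) \<longlonglongrightarrow> 0"
proof -
  obtain P Q \<delta> where \<delta>: "\<delta> > 0" and P: "loop_above f \<delta> P" and Q: "loop_above (\<lambda>x. - f x) \<delta> Q"
    and len: "length P = length Q" using ex_opposite_loops[OF assms] by blast
  have loops: "loop P" "loop Q" using P Q by (auto simp: loop_above_def)
  have "P \<noteq> Q" using loop_above_uminus_neq[OF P Q \<delta> \<delta>] .
  \<comment> \<open>a position at which the letters of \<open>P\<close> and \<open>Q\<close> differ, to read off the free bits\<close>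
  then obtain k0 where k0: "k0 < length P" "P ! k0 \<noteq> Q ! k0" using len nth_equalityI by metis
  define l where "l = length P"
  have l: "l > 0" using le_less_trans[OF le0 k0(1)] by (simp only: l_def)
  define W where "W v = (if v then P else Q)" for v
  have W: "loop (W v)" "length (W v) = l" for v using loops len by (auto simp: W_def l_def)
  \<comment> \<open>so large that \<open>q\<close> loops with control bits outweigh the loop with the free bit\<close>
  define q where "q = nat \<lceil>2 * C / \<delta>\<rceil> + 1"
  have q: "C + \<delta> / 2 \<le> real q * \<delta> / 2"
  proof -
    have "2 * C / \<delta> + 1 \<le> real q" unfolding q_def by linarith
    thus ?thesis using \<delta> by (simp add: field_simps)
  qed
  define U where "U = (q + 1) * l"
  have U: "U > 0" using l by (simp add: U_def)
  define u where "u \<gamma> s = (\<lambda>m. W (if m mod int (q + 1) = 0 then \<gamma> (m div int (q + 1)) else s (m div int (q + 1))))"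
    for \<gamma> s :: "int \<Rightarrow> bool"
  define pt where "pt \<gamma> s = concatenation (u \<gamma> s)" for \<gamma> s
  have pt: "pt \<gamma> s \<in> X" for \<gamma> s
    unfolding pt_def by (rule concatenation_mem) (simp add: u_def W)
  have pt_nth: "pt \<gamma> s p = u \<gamma> s (p div int l) ! nat (p mod int l)" for \<gamma> s p
    unfolding pt_def by (rule concatenation_const_length) (auto simp: u_def W l)
  have pt_block: "pt \<gamma> s (m * int l + int k) = u \<gamma> s m ! k" if "k < l" for \<gamma> s m k
    using that unfolding pt_nth by (simp add: div_add1_eq)
  \<comment> \<open>the sum over the groups \<open>i, \<dots>, j - 1\<close>, each of \<open>q + 1\<close> loops and \<open>U\<close> letters\<close>
  define D where "D \<gamma> s i j = orbit_sum f (pt \<gamma> s) (i * int U) (j * int U)" for \<gamma> s i j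
  have ctx_ex: "\<exists>R. R \<ge> 0 \<and> (\<forall>x y i j. x \<in> X \<longrightarrow> y \<in> X \<longrightarrow> i \<le> j \<longrightarrow> (\<forall>k\<in>{i..<j}. x k = y k) \<longrightarrow>
      \<bar>orbit_sum f x i j - orbit_sum f y i j\<bar> \<le> e / real U * real_of_int (j - i) + R)" if "e > 0" for e
  proof -
    have "e / real U > 0" using that U by simp
    from orbit_sum_context[OF this] show ?thesis by metis
  qed
  define R where "R e = (if e > 0 then (SOME R. R \<ge> 0 \<and> (\<forall>x y i j. x \<in> X \<longrightarrow> y \<in> X \<longrightarrow> i \<le> j \<longrightarrow>
      (\<forall>k\<in>{i..<j}. x k = y k) \<longrightarrow>
      \<bar>orbit_sum f x i j - orbit_sum f y i j\<bar> \<le> e / real U * real_of_int (j - i) + R)) else 0)" for e :: real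
  have R: "R e \<ge> 0" for e
    using someI_ex[OF ctx_ex, of e] unfolding R_def by simp
  have ctx: "\<bar>orbit_sum f x i j - orbit_sum f y i j\<bar> \<le> e / real U * real_of_int (j - i) + R e"
    if "e > 0" "x \<in> X" "y \<in> X" "i \<le> j" "\<forall>k\<in>{i..<j}. x k = y k" for e x y i j
    using someI_ex[OF ctx_ex, of e] that unfolding R_def by simp
  have D_controlled: "controlled (C * real U) R (D \<gamma>)" for \<gamma>
    unfolding controlled_def
  proof (intro conjI allI impI)
    fix s i j k assume "i \<le> j" "j \<le> (k :: int)"
    thus "D \<gamma> s i k = D \<gamma> s i j + D \<gamma> s j k"
      unfolding D_def by (intro orbit_sum_append mult_right_mono) auto
  next
    fix s i j assume ij: "i \<le> (j :: int)"
    have "i * int U \<le> j * int U" using ij by (intro mult_right_mono) auto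
    from orbit_sum_le[OF pt this] show "\<bar>D \<gamma> s i j\<bar> \<le> C * real U * real_of_int (j - i)"
      unfolding D_def by (simp add: algebra_simps)
  next
    fix e :: real and s s' i j assume e: "e > 0" and ij: "i \<le> (j :: int)" and s: "\<forall>p\<in>{i..<j}. s p = (s' p :: bool)"
    have le: "i * int U \<le> j * int U" using ij by (intro mult_right_mono) auto
    have "pt \<gamma> s k = pt \<gamma> s' k" if k: "k \<in> {i * int U..<j * int U}" for k
    proof -
      have div: "k div int l div int (q + 1) = k div int U"
        unfolding U_def of_nat_mult by (subst mult.commute) (rule zdiv_zmult2_eq[symmetric], simp)
      have "i \<le> k div int U" using zdiv_mono1[of "i * int U" k "int U"] k U by simp
      moreover have "k div int U < j"
        using k U le_less_trans[OF div_block(1)[of "int U" k], of "j * int U"] by simp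
      ultimately have "s (k div int l div int (q + 1)) = s' (k div int l div int (q + 1))"
        using s unfolding div by auto
      thus ?thesis unfolding pt_nth u_def by simp
    qed
    hence "\<bar>D \<gamma> s i j - D \<gamma> s' i j\<bar> \<le> e / real U * real_of_int (j * int U - i * int U) + R e"
      unfolding D_def by (intro ctx[OF e pt pt le]) auto
    also have "e / real U * real_of_int (j * int U - i * int U) = e * real_of_int (j - i)"
      using U by (simp add: field_simps)
    finally show "\<bar>D \<gamma> s i j - D \<gamma> s' i j\<bar> \<le> e * real_of_int (j - i) + R e" .
  qed
  have group: "D \<gamma> s m (m + 1) = orbit_sum f (pt \<gamma> s) (m * int U) (m * int U + int l) +
      (\<Sum>k<q. orbit_sum f (pt \<gamma> s) (m * int U + int (Suc k) * int l) (m * int U + int (Suc k) * int l + int l))" for \<gamma> s m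
  proof -
    have "D \<gamma> s m (m + 1) = orbit_sum f (pt \<gamma> s) (m * int U) (m * int U + int (Suc q) * int l)"
      by (simp add: D_def U_def algebra_simps)
    also have "\<dots> = (\<Sum>k<Suc q. orbit_sum f (pt \<gamma> s) (m * int U + int k * int l) (m * int U + int k * int l + int l))"
      by (rule additive_blocks) (auto intro: orbit_sum_append)
    finally show ?thesis by (subst (asm) sum.lessThan_Suc_shift) simp
  qed
  have group_nth: "pt \<gamma> s (m * int U + int (Suc k) * int l + int i) = W (s m) ! i"
    if "k < q" "i < l" for \<gamma> s m k i
  proof -
    have "m * int U + int (Suc k) * int l = (m * int (q + 1) + int (Suc k)) * int l"
      by (simp add: U_def algebra_simps)
    moreover have "(m * int (q + 1) + int (Suc k)) mod int (q + 1) = int (Suc k)"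
      using that by (simp add: mod_add_eq[symmetric] del: of_nat_Suc of_nat_add)
    moreover have "(m * int (q + 1) + int (Suc k)) div int (q + 1) = m"
      using that by (simp del: of_nat_Suc of_nat_add)
    ultimately show ?thesis using pt_block[OF that(2), of \<gamma> s "m * int (q + 1) + int (Suc k)"]
      by (simp add: u_def del: of_nat_Suc of_nat_add)
  qed
  have first: "\<bar>orbit_sum f (pt \<gamma> s) (m * int U) (m * int U + int l)\<bar> \<le> C * real l" for \<gamma> s m
    using orbit_sum_le[OF pt, of "m * int U" "m * int U + int l" \<gamma> s] by simp
  define \<delta>' where "\<delta>' = \<delta> / 2 * real l"
  have \<delta>': "\<delta>' > 0" using \<delta> l by (simp add: \<delta>'_def)
  have margin: "\<delta>' \<le> real q * (\<delta> * real l) - C * real l"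
  proof -
    have "\<delta> / 2 \<le> real q * \<delta> - C" using q bound_nonneg \<delta> by (simp add: field_simps)
    hence "\<delta> / 2 * real l \<le> (real q * \<delta> - C) * real l" by (intro mult_right_mono) auto
    thus ?thesis by (simp add: \<delta>'_def algebra_simps)
  qed
  have D_steers: "steers (D \<gamma>) 1 \<delta>' id" for \<gamma>
    unfolding steers_def
  proof (intro conjI allI impI)
    show "blockwise 1 id" by (auto simp: blockwise_def)
  next
    fix b and m :: int assume "b m"
    hence block: "\<delta> * real l \<le> orbit_sum f (pt \<gamma> b) (m * int U + int (Suc k) * int l) (m * int U + int (Suc k) * int l + int l)"
      if "k < q" for k
      using P pt group_nth[OF that] unfolding loop_above_def l_def[symmetric] by (simp add: W_def)
    have "(\<Sum>k<q. \<delta> * real l) \<le> (\<Sum>k<q. orbit_sum f (pt \<gamma> b) (m * int U + int (Suc k) * int l) (m * int U + int (Suc k) * int l + int l))"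
      by (intro sum_mono block) simp
    hence "real q * (\<delta> * real l) \<le> D \<gamma> b m (m + 1) + C * real l"
      using first[of \<gamma> b m] unfolding group by simp
    thus "\<delta>' * real_of_int 1 \<le> D \<gamma> (id b) (m * 1) (m * 1 + 1)" using margin by simp
  next
    fix b and m :: int assume "\<not> b m"
    hence block: "\<delta> * real l \<le> orbit_sum (\<lambda>x. - f x) (pt \<gamma> b) (m * int U + int (Suc k) * int l) (m * int U + int (Suc k) * int l + int l)"
      if "k < q" for k
      using Q pt group_nth[OF that] unfolding loop_above_def len[symmetric] l_def[symmetric] by (simp add: W_def)
    have "(\<Sum>k<q. \<delta> * real l) \<le> (\<Sum>k<q. orbit_sum (\<lambda>x. - f x) (pt \<gamma> b) (m * int U + int (Suc k) * int l) (m * int U + int (Suc k) * int l + int l))"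
      by (intro sum_mono block) simp
    hence "D \<gamma> b m (m + 1) + real q * (\<delta> * real l) \<le> C * real l"
      using first[of \<gamma> b m] unfolding group by (simp add: orbit_sum_uminus sum_negf)
    thus "D \<gamma> (id b) (m * 1) (m * 1 + 1) \<le> - (\<delta>' * real_of_int 1)" using margin by simp
  qed
  have CU: "C * real U \<ge> 0" using bound_nonneg by simp
  obtain B :: "nat \<Rightarrow> real" where B0: "\<And>k. B k \<ge> 0" and
    B: "\<And>D j. controlled (C * real U) R D \<Longrightarrow> steers D 1 \<delta>' id \<Longrightarrow>
      \<exists>s. \<forall>k\<le>j. \<forall>p q. p \<le> q \<longrightarrow> \<bar>D s p q\<bar> \<le> 3 * \<delta>' / 2 ^ Suc k * real_of_int (q - p) + B k"
    by (rule steering[OF \<delta>' CU R]) (rule that)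
  define \<kappa> where "\<kappa> k = 3 * \<delta>' / 2 ^ Suc k" for k :: nat
  have \<kappa>0: "\<kappa> k > 0" for k using \<delta>' by (simp add: \<kappa>_def)
  define E where "E k = B k + 2 * C * real_of_int (int U)" for k
  \<comment> \<open>the points that obey the \<open>k\<close>-th rate, for sums over arbitrary intervals of times\<close>
  define H where "H k = {x\<in>X. \<forall>p q. p \<le> q \<longrightarrow> \<bar>orbit_sum f x p q\<bar> \<le> \<kappa> k * real_of_int (q - p) + E k}" for k
  define K where "K = (\<Inter>k. H k)"
  have H_closed: "closed (H k)" for k
  proof -
    have "H k = (\<Inter>p. \<Inter>q\<in>{p..}. {x\<in>X. \<bar>orbit_sum f x p q\<bar> \<le> \<kappa> k * real_of_int (q - p) + E k})"
      by (auto simp: H_def)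
    moreover have "closed {x\<in>X. \<bar>orbit_sum f x p q\<bar> \<le> \<kappa> k * real_of_int (q - p) + E k}" for p q
      by (intro continuous_on_closed_Collect_le continuous_on_rabs continuous_orbit_sum continuous_on_const closed)
    ultimately show ?thesis by (auto intro!: closed_INT)
  qed
  have H_sub: "H k \<subseteq> X" for k by (auto simp: H_def)
  have ex_point_with_rates: "\<exists>s. pt \<gamma> s \<in> (\<Inter>k\<le>j. H k)" for \<gamma> j
  proof -
    obtain s where s: "\<And>k p q. k \<le> j \<Longrightarrow> p \<le> q \<Longrightarrow> \<bar>D \<gamma> s p q\<bar> \<le> \<kappa> k * real_of_int (q - p) + B k"
      using B[OF D_controlled D_steers, of j \<gamma>] unfolding \<kappa>_def by blast
    have "\<bar>orbit_sum f (pt \<gamma> s) p q\<bar> \<le> \<kappa> k * real_of_int (q - p) + (B k + 2 * C * real_of_int (int U))"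
      if "k \<le> j" "p \<le> q" for k p q
    proof (rule additive_round[OF orbit_sum_append _ orbit_sum_le[OF pt] bound_nonneg])
      fix a b :: int assume ab: "a \<le> b"
      have "1 * real_of_int (b - a) \<le> real U * real_of_int (b - a)"
        using ab U by (intro mult_right_mono) auto
      hence "\<kappa> k * real_of_int (b - a) \<le> \<kappa> k * real_of_int (b * int U - a * int U)"
        using \<kappa>0[of k] by (intro mult_left_mono) (auto simp: algebra_simps)
      thus "\<bar>orbit_sum f (pt \<gamma> s) (a * int U) (b * int U)\<bar> \<le> \<kappa> k * real_of_int (b * int U - a * int U) + B k"
        using s[OF that(1) ab] unfolding D_def by linarith
    qed (use that U \<kappa>0[of k] B0 in auto)
    thus ?thesis using pt by (intro exI[of _ s]) (auto simp: H_def E_def)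
  qed
  \<comment> \<open>By compactness, every sequence of free bits is realized in \<open>K\<close>: for each \<open>j\<close>, some point with
    these bits obeys the rates up to \<open>j\<close>.\<close>
  define F where "F \<gamma> = {x. \<forall>m. x (m * int U + int k0) = W (\<gamma> m) ! k0}" for \<gamma> :: "int \<Rightarrow> bool"
  have pt_F: "pt \<gamma> s \<in> F \<gamma>" for \<gamma> s
  proof -
    have "pt \<gamma> s (m * int U + int k0) = W (\<gamma> m) ! k0" for m
    proof -
      have "pt \<gamma> s (m * int (q + 1) * int l + int k0) = u \<gamma> s (m * int (q + 1)) ! k0"
        using k0(1) by (intro pt_block) (simp add: l_def)
      also have "m * int (q + 1) * int l = m * int U" by (simp add: U_def algebra_simps)
      also have "u \<gamma> s (m * int (q + 1)) = W (\<gamma> m)" by (simp add: u_def del: of_nat_add of_nat_Suc)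
      finally show ?thesis .
    qed
    thus ?thesis by (simp add: F_def)
  qed
  have F_closed: "closed (F \<gamma>)" for \<gamma>
  proof -
    have "closed {x :: int \<Rightarrow> 'a. x (m * int U + int k0) = W (\<gamma> m) ! k0}" for m
      by (rule closed_if_finite_coordinates[of "{m * int U + int k0}"]) auto
    moreover have "F \<gamma> = (\<Inter>m. {x. x (m * int U + int k0) = W (\<gamma> m) ! k0})" by (auto simp: F_def)
    ultimately show ?thesis by auto
  qed
  have realized: "\<exists>x\<in>K. x \<in> F \<gamma>" for \<gamma>
  proof -
    have "X \<inter> (\<Inter>k\<in>UNIV. H k \<inter> F \<gamma>) \<noteq> {}"
    proof (rule compact_imp_fip_image[OF compact])
      show "closed (H k \<inter> F \<gamma>)" for k using H_closed F_closed by auto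
      fix I :: "nat set" assume "finite I"
      then obtain j where j: "\<And>k. k \<in> I \<Longrightarrow> k \<le> j" by (meson finite_nat_set_iff_bounded_le)
      obtain s where "pt \<gamma> s \<in> (\<Inter>k\<le>j. H k)" using ex_point_with_rates by blast
      hence "pt \<gamma> s \<in> X \<inter> (\<Inter>k\<in>I. H k \<inter> F \<gamma>)" using j pt pt_F by blast
      thus "X \<inter> (\<Inter>k\<in>I. H k \<inter> F \<gamma>) \<noteq> {}" by blast
    qed
    thus ?thesis by (auto simp: K_def)
  qed
  have K_inv: "translate k x \<in> K" if "x \<in> K" for x k
  proof -
    have "translate k x \<in> H j" for j
      unfolding H_def
    proof (intro CollectI conjI allI impI)
      have x: "x \<in> H j" using that by (simp add: K_def)
      thus "translate k x \<in> X" using translate_mem by (simp add: H_def)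
      fix p q :: int assume "p \<le> q"
      hence "p + k \<le> q + k" by simp
      with x have "\<bar>orbit_sum f x (p + k) (q + k)\<bar> \<le> \<kappa> j * real_of_int (q + k - (p + k)) + E j"
        unfolding H_def by blast
      thus "\<bar>orbit_sum f (translate k x) p q\<bar> \<le> \<kappa> j * real_of_int (q - p) + E j"
        by (simp add: orbit_sum_translate)
    qed
    thus ?thesis by (simp add: K_def)
  qed
  show ?thesis
  proof
    show sub: "K \<subseteq> X" using H_sub by (auto simp: K_def)
    have "closed K" unfolding K_def using H_closed by auto
    thus "compact K" using compact_Int_closed[OF compact, of K] sub by (simp add: inf.absorb2)
    show "left_shift ` K = K"
    proof
      show "K \<subseteq> left_shift ` K"
      proof
        fix x assume "x \<in> K"
        hence "translate (-1) x \<in> K" by (rule K_inv)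
        thus "x \<in> left_shift ` K" unfolding left_shift_eq_translate by (rule rev_image_eqI) simp
      qed
    qed (auto simp: left_shift_eq_translate intro: K_inv)
    show "topological_entropy K left_shift > 0"
    proof (rule topological_entropy_pos[OF finite_alphabet _ K_inv U])
      show "\<And>x i. x \<in> K \<Longrightarrow> x i \<in> A" using sub letters by blast
      fix p
      have "\<forall>S :: nat set. \<exists>x. x \<in> K \<and> x \<in> F (\<lambda>m. nat m \<in> S)" using realized by blast
      from choice[OF this] obtain h
        where "\<forall>S :: nat set. h S \<in> K \<and> h S \<in> F (\<lambda>m. nat m \<in> S)" ..
      hence h: "h S \<in> K" "h S \<in> F (\<lambda>m. nat m \<in> S)" for S by simp_all
      have "S = S'" if S: "S \<subseteq> {..<p}" "S' \<subseteq> {..<p}" "\<forall>i<p * U. h S (int i) = h S' (int i)" for S S'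
      proof -
        have "m \<in> S \<longleftrightarrow> m \<in> S'" if "m < p" for m
        proof -
          have "m * U + k0 < Suc m * U" using k0(1) by (simp add: U_def l_def)
          also have "\<dots> \<le> p * U" using that by (intro mult_right_mono) auto
          finally have "h S (int (m * U + k0)) = h S' (int (m * U + k0))" using S(3) by blast
          moreover have "h T (int (m * U + k0)) = W (m \<in> T) ! k0" for T
          proof -
            have "h T (int m * int U + int k0) = W (nat (int m) \<in> T) ! k0"
              using h(2)[of T] unfolding F_def by blast
            thus ?thesis by simp
          qed
          ultimately have "W (m \<in> S) ! k0 = W (m \<in> S') ! k0" by simp
          thus ?thesis using k0(2) by (cases "m \<in> S"; cases "m \<in> S'") (simp_all add: W_def)
        qed
        thus ?thesis using S by blast
      qed
      thus "\<exists>h :: nat set \<Rightarrow> int \<Rightarrow> 'a. (\<forall>S. h S \<in> K) \<and>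
        (\<forall>S S'. S \<subseteq> {..<p} \<longrightarrow> S' \<subseteq> {..<p} \<longrightarrow> (\<forall>i<p * U. h S (int i) = h S' (int i)) \<longrightarrow> S = S')"
        using h(1) by blast
    qed
    show "(\<lambda>n. birkhoff_average left_shift f n x) \<longlonglongrightarrow> 0" if x: "x \<in> K" for x
    proof (rule LIMSEQ_I)
      fix e :: real assume e: "e > 0"
      have "(\<lambda>k. 3 * \<delta>' / 2 * (1 / 2) ^ k) \<longlonglongrightarrow> 3 * \<delta>' / 2 * 0"
        by (intro tendsto_mult tendsto_const LIMSEQ_realpow_zero) auto
      hence "(\<lambda>k. \<kappa> k) \<longlonglongrightarrow> 0" by (simp add: \<kappa>_def power_one_over)
      hence "eventually (\<lambda>k. \<kappa> k < e / 2) sequentially" using e by (intro order_tendstoD(2)[of \<kappa> 0]) auto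
      then obtain k where k: "\<kappa> k < e / 2" by (auto simp: eventually_sequentially)
      show "\<exists>n0. \<forall>n\<ge>n0. norm (birkhoff_average left_shift f n x - 0) < e"
      proof (intro exI allI impI)
        fix n assume n: "n \<ge> nat \<lceil>2 * E k / e\<rceil> + 1"
        have n0: "real n > 0" using n by simp
        have "2 * E k / e \<le> real n" using n by linarith
        hence "E k \<le> e / 2 * real n" using e by (simp add: field_simps)
        moreover have "\<bar>orbit_sum f x 0 (int n)\<bar> \<le> \<kappa> k * real_of_int (int n - 0) + E k"
        proof -
          have "x \<in> H k" using x by (simp add: K_def)
          moreover have "0 \<le> int n" by simp
          ultimately show ?thesis unfolding H_def by blast
        qed
        moreover have "\<kappa> k * real n < e / 2 * real n" using k n0 by (intro mult_strict_right_mono)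
        ultimately have "\<bar>orbit_sum f x 0 (int n)\<bar> < e * real n" by (simp add: field_simps)
        thus "norm (birkhoff_average left_shift f n x - 0) < e"
          using n0 by (simp add: orbit_sum_eq_birkhoff_average abs_divide divide_less_eq)
      qed
    qed
  qed
qed

end


section \<open>Ergodicity of the shift on independent identically distributed letters\<close>

context
  fixes N :: "'l measure" and \<Omega> :: "(int \<Rightarrow> 'l) measure"
  assumes N: "prob_space N"
  defines "\<Omega> \<equiv> PiM UNIV (\<lambda>_. N)"
begin

interpretation product_prob_space "\<lambda>_::int. N" UNIV
  by (intro product_prob_spaceI N)

lemma iid_prob_space: "prob_space \<Omega>"
  unfolding \<Omega>_def by (rule P.prob_space_axioms)

interpretation iid: prob_space \<Omega> by (rule iid_prob_space)

lemma space_iid: "\<omega> \<in> space \<Omega> \<longleftrightarrow> (\<forall>i. \<omega> i \<in> space N)"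
  by (auto simp: \<Omega>_def space_PiM PiE_iff)

lemma measurable_iid_translate [measurable]: "translate k \<in> measurable \<Omega> \<Omega>"
  unfolding \<Omega>_def translate_def by (rule measurable_PiM_single') (auto simp: space_PiM PiE_iff)

lemma distr_iid_translate: "distr \<Omega> \<Omega> (translate k) = \<Omega>"
proof -
  have "distr (PiM UNIV (\<lambda>_. N)) (\<Pi>\<^sub>M i\<in>(UNIV::int set). N) (\<lambda>\<omega>. \<lambda>n\<in>UNIV. \<omega> (n + k)) = (\<Pi>\<^sub>M i\<in>UNIV. N)"
    by (rule distr_PiM_reindex) (auto simp: N inj_on_def)
  thus ?thesis by (simp add: \<Omega>_def translate_def[abs_def] restrict_UNIV)
qed

lemma measure_iid_translate:
  assumes "F \<in> sets \<Omega>"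
  shows "iid.prob (translate k -` F \<inter> space \<Omega>) = iid.prob F"
  using measure_distr[OF measurable_iid_translate assms, of k] by (simp add: distr_iid_translate)

text \<open>The event that the letters at the positions in \<open>J\<close> lie in given sets.\<close>

definition cylinder :: "int set \<Rightarrow> (int \<Rightarrow> 'l set) \<Rightarrow> (int \<Rightarrow> 'l) set" where
  "cylinder J E = {\<omega>\<in>space \<Omega>. \<forall>j\<in>J. \<omega> j \<in> E j}"

lemma cylinder_eq_emb: "prod_emb UNIV (\<lambda>_. N) J (Pi\<^sub>E J E) = cylinder J E"
  by (auto simp: cylinder_def prod_emb_def \<Omega>_def space_PiM PiE_iff)

lemma prob_cylinder_Int:
  assumes "finite J" "finite J'" "J \<inter> J' = {}"
    and "\<And>j. j \<in> J \<Longrightarrow> E j \<in> sets N" "\<And>j. j \<in> J' \<Longrightarrow> E' j \<in> sets N"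
  shows "iid.prob (cylinder J E \<inter> cylinder J' E') = iid.prob (cylinder J E) * iid.prob (cylinder J' E')"
proof -
  let ?G = "\<lambda>j. if j \<in> J then E j else E' j"
  have prob: "iid.prob (cylinder J E) = (\<Prod>j\<in>J. measure N (E j))"
    if "finite J" "\<And>j. j \<in> J \<Longrightarrow> E j \<in> sets N" for J and E :: "int \<Rightarrow> 'l set"
    using measure_PiM_emb[of J E] that unfolding cylinder_eq_emb[symmetric] by (simp add: \<Omega>_def)
  have "cylinder J E \<inter> cylinder J' E' = cylinder (J \<union> J') ?G"
    using assms(3) by (auto simp: cylinder_def)
  also have "iid.prob \<dots> = (\<Prod>j\<in>J \<union> J'. measure N (?G j))"
    by (rule prob) (use assms in auto)
  also have "\<dots> = (\<Prod>j\<in>J. measure N (?G j)) * (\<Prod>j\<in>J'. measure N (?G j))"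
    using assms by (intro prod.union_disjoint) auto
  also have "(\<Prod>j\<in>J. measure N (?G j)) = (\<Prod>j\<in>J. measure N (E j))" by simp
  also have "(\<Prod>j\<in>J'. measure N (?G j)) = (\<Prod>j\<in>J'. measure N (E' j))"
    using assms(3) by (intro prod.cong) auto
  finally show ?thesis using prob[of J E] prob[of J' E'] assms by simp
qed

lemma cylinder_sets: "finite J \<Longrightarrow> (\<And>j. j \<in> J \<Longrightarrow> E j \<in> sets N) \<Longrightarrow> cylinder J E \<in> sets \<Omega>"
  unfolding cylinder_eq_emb[symmetric] \<Omega>_def by (rule sets_PiM_I) auto

lemma iid_sets_induct [consumes 1, case_names basic compl union]:
  assumes F: "F \<in> sets \<Omega>"
    and basic: "\<And>J E. finite J \<Longrightarrow> (\<And>j. j \<in> J \<Longrightarrow> E j \<in> sets N) \<Longrightarrow> Q (cylinder J E)"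
    and compl: "\<And>F. F \<in> sets \<Omega> \<Longrightarrow> Q F \<Longrightarrow> Q (space \<Omega> - F)"
    and union: "\<And>F. disjoint_family F \<Longrightarrow> range F \<subseteq> sets \<Omega> \<Longrightarrow> (\<And>i::nat. Q (F i)) \<Longrightarrow> Q (\<Union>i. F i)"
  shows "Q F"
proof -
  have sp: "space \<Omega> = (\<Pi>\<^sub>E i\<in>UNIV. space N)" by (simp add: \<Omega>_def space_PiM)
  have sets: "sets \<Omega> = sigma_sets (\<Pi>\<^sub>E i\<in>UNIV. space N) (prod_algebra UNIV (\<lambda>_. N))"
    unfolding \<Omega>_def by (rule sets_PiM)
  show ?thesis
    using Int_stable_prod_algebra prod_algebra_sets_into_space F[unfolded sets]
  proof (induction rule: sigma_sets_induct_disjoint)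
    case (basic F)
    then obtain J E where "F = prod_emb UNIV (\<lambda>_. N) J (Pi\<^sub>E J E)" "finite J" "\<And>j. j \<in> J \<Longrightarrow> E j \<in> sets N"
      by (rule prod_algebraE) blast
    thus ?case using assms(2)[of J E] by (simp add: cylinder_eq_emb)
  next
    case empty
    have "Q (cylinder {} (\<lambda>_. {}))" by (rule assms(2)) auto
    hence "Q (space \<Omega>)" by (simp add: cylinder_def)
    from compl[OF _ this] show ?case by simp
  next
    case (compl F)
    thus ?case using assms(3)[of F] unfolding sets[symmetric] sp by blast
  next
    case (union F)
    thus ?case using assms(4)[of F] unfolding sets[symmetric] by blast
  qed
qed

text \<open>For two cylinders the events are independent as soon as the positions are disjoint. The events
  \<open>F\<close> for which the limit holds are closed under complements and disjoint unions, for the latter by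
  dominated convergence of series.\<close>

lemma iid_mixing:
  assumes J: "finite J" "\<And>j. j \<in> J \<Longrightarrow> E j \<in> sets N" and F: "F \<in> sets \<Omega>"
  shows "(\<lambda>n. iid.prob (cylinder J E \<inter> (translate (int n) -` F \<inter> space \<Omega>)))
    \<longlonglongrightarrow> iid.prob (cylinder J E) * iid.prob F"
  using F
proof (induction rule: iid_sets_induct)
  case (basic J' E')
  have eq: "translate (int n) -` cylinder J' E' \<inter> space \<Omega> = cylinder ((\<lambda>j. j + int n) ` J') (\<lambda>j. E' (j - int n))" for n
    by (auto simp: cylinder_def space_iid)
  obtain b where b: "\<And>j j'. j \<in> J \<Longrightarrow> j' \<in> J' \<Longrightarrow> j - j' \<le> b"
  proof
    fix j j' assume "j \<in> J" "j' \<in> J'"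
    thus "j - j' \<le> Max ((\<lambda>(j, j'). j - j') ` (J \<times> J'))"
      using J(1) basic(1) by (intro Max_ge) auto
  qed
  have "iid.prob (cylinder J E \<inter> (translate (int n) -` cylinder J' E' \<inter> space \<Omega>)) =
      iid.prob (cylinder J E) * iid.prob (cylinder J' E')" if "n \<ge> nat (b + 1)" for n
  proof -
    have "J \<inter> (\<lambda>j. j + int n) ` J' = {}"
    proof safe
      fix j assume "j + int n \<in> J" "j \<in> J'"
      from b[OF this] that show "j + int n \<in> {}" by simp
    qed
    hence "iid.prob (cylinder J E \<inter> (translate (int n) -` cylinder J' E' \<inter> space \<Omega>)) =
      iid.prob (cylinder J E) * iid.prob (translate (int n) -` cylinder J' E' \<inter> space \<Omega>)"
      unfolding eq using J basic by (intro prob_cylinder_Int) auto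
    thus ?thesis using measure_iid_translate[OF cylinder_sets[OF basic]] by simp
  qed
  thus ?case by (intro tendsto_eventually eventually_sequentiallyI[of "nat (b + 1)"])
next
  case (compl F)
  let ?C = "cylinder J E"
  have C: "?C \<in> sets \<Omega>" using J by (rule cylinder_sets)
  have "iid.prob (?C \<inter> (translate (int n) -` (space \<Omega> - F) \<inter> space \<Omega>)) =
      iid.prob ?C - iid.prob (?C \<inter> (translate (int n) -` F \<inter> space \<Omega>))" for n
  proof -
    have "?C \<inter> (translate (int n) -` (space \<Omega> - F) \<inter> space \<Omega>) = ?C - ?C \<inter> (translate (int n) -` F \<inter> space \<Omega>)"
      by (auto simp: cylinder_def space_iid)
    thus ?thesis using C compl(1) measurable_sets[OF measurable_iid_translate compl(1)]
      by (simp add: iid.finite_measure_Diff)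
  qed
  moreover have "(\<lambda>n. iid.prob ?C - iid.prob (?C \<inter> (translate (int n) -` F \<inter> space \<Omega>)))
      \<longlonglongrightarrow> iid.prob ?C - iid.prob ?C * iid.prob F"
    by (intro tendsto_diff tendsto_const compl)
  moreover have "iid.prob ?C - iid.prob ?C * iid.prob F = iid.prob ?C * iid.prob (space \<Omega> - F)"
    unfolding iid.prob_compl[OF compl(1)] by (simp add: right_diff_distrib)
  ultimately show ?case by (simp only:)
next
  case (union F)
  let ?C = "cylinder J E"
  have C: "?C \<in> sets \<Omega>" using J by (rule cylinder_sets)
  have F: "F i \<in> sets \<Omega>" for i using union by auto
  have T: "translate (int n) -` F i \<inter> space \<Omega> \<in> sets \<Omega>" for n i
    using F by (rule measurable_sets[OF measurable_iid_translate])
  let ?a = "\<lambda>i n. iid.prob (?C \<inter> (translate (int n) -` F i \<inter> space \<Omega>))"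
  have disj: "disjoint_family (\<lambda>i. ?C \<inter> (translate (int n) -` F i \<inter> space \<Omega>))" for n
    unfolding disjoint_family_on_def
  proof (intro ballI impI)
    fix i j :: nat assume "i \<noteq> j"
    hence "F i \<inter> F j = {}" using union(1) by (auto simp: disjoint_family_on_def)
    thus "?C \<inter> (translate (int n) -` F i \<inter> space \<Omega>) \<inter> (?C \<inter> (translate (int n) -` F j \<inter> space \<Omega>)) = {}" by blast
  qed
  have sums: "(\<lambda>i. ?a i n) sums iid.prob (?C \<inter> (translate (int n) -` (\<Union>i. F i) \<inter> space \<Omega>))" for n
  proof -
    have "(\<lambda>i. ?a i n) sums iid.prob (\<Union>i. ?C \<inter> (translate (int n) -` F i \<inter> space \<Omega>))"
      using C T disj by (intro iid.finite_measure_UNION) auto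
    also have "(\<Union>i. ?C \<inter> (translate (int n) -` F i \<inter> space \<Omega>)) = ?C \<inter> (translate (int n) -` (\<Union>i. F i) \<inter> space \<Omega>)"
      by auto
    finally show ?thesis .
  qed
  have sums_F: "(\<lambda>i. iid.prob (F i)) sums iid.prob (\<Union>i. F i)"
    using union by (intro iid.finite_measure_UNION) auto
  have "?a i n \<le> iid.prob (F i)" for i n
  proof -
    have "?a i n \<le> iid.prob (translate (int n) -` F i \<inter> space \<Omega>)"
      using T by (intro iid.finite_measure_mono) auto
    thus ?thesis using measure_iid_translate[OF F] by simp
  qed
  hence bound: "eventually (\<lambda>(i, n). norm (?a i n) \<le> iid.prob (F i)) (at_top \<times>\<^sub>F sequentially)"
    by (intro always_eventually) simp
  have "(\<lambda>n. \<Sum>i. ?a i n) \<longlonglongrightarrow> (\<Sum>i. iid.prob ?C * iid.prob (F i))"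
    by (rule tannerys_theorem[OF union(3) bound sums_summable[OF sums_F], THEN conjunct2, THEN conjunct2]) simp
  moreover have "(\<Sum>i. ?a i n) = iid.prob (?C \<inter> (translate (int n) -` (\<Union>i. F i) \<inter> space \<Omega>))" for n
    using sums by (rule sums_unique[symmetric])
  moreover have "(\<Sum>i. iid.prob ?C * iid.prob (F i)) = iid.prob ?C * iid.prob (\<Union>i. F i)"
    using sums_mult[OF sums_F] by (rule sums_unique[symmetric])
  ultimately show ?case by (simp only:)
qed

text \<open>By mixing, an invariant event is independent of all cylinders, hence of itself.\<close>

lemma iid_ergodic:
  assumes B: "B \<in> sets \<Omega>" "translate 1 -` B \<inter> space \<Omega> = B"
  shows "iid.prob B = 0 \<or> iid.prob B = 1"
proof -
  have inv: "translate (int n) -` B \<inter> space \<Omega> = B" for n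
  proof (induction n)
    case 0
    show ?case using sets.sets_into_space[OF B(1)] by auto
  next
    case (Suc n)
    have "\<omega> \<in> B \<longleftrightarrow> translate (int (Suc n)) \<omega> \<in> B" if "\<omega> \<in> space \<Omega>" for \<omega>
    proof -
      have "translate (int n) \<omega> \<in> space \<Omega>" using that by (simp add: space_iid)
      hence "translate (int n) \<omega> \<in> B \<longleftrightarrow> translate 1 (translate (int n) \<omega>) \<in> B" using B(2) by blast
      moreover have "translate 1 (translate (int n) \<omega>) = translate (int (Suc n)) \<omega>"
        by (simp only: translate_translate of_nat_Suc)
      moreover have "\<omega> \<in> B \<longleftrightarrow> translate (int n) \<omega> \<in> B" using Suc that by blast
      ultimately show ?thesis by simp
    qed
    thus ?case using sets.sets_into_space[OF B(1)] by blast
  qed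
  have indep: "iid.prob (E \<inter> B) = iid.prob E * iid.prob B" if "E \<in> sets \<Omega>" for E
    using that
  proof (induction rule: iid_sets_induct)
    case (basic J E)
    have "(\<lambda>n. iid.prob (cylinder J E \<inter> (translate (int n) -` B \<inter> space \<Omega>)))
        \<longlonglongrightarrow> iid.prob (cylinder J E) * iid.prob B"
      using basic B(1) by (rule iid_mixing)
    thus ?case unfolding inv by (simp add: LIMSEQ_const_iff)
  next
    case (compl E)
    have "(space \<Omega> - E) \<inter> B = B - E \<inter> B" using sets.sets_into_space[OF B(1)] by auto
    hence "iid.prob ((space \<Omega> - E) \<inter> B) = iid.prob B - iid.prob E * iid.prob B"
      using compl B(1) by (simp add: iid.finite_measure_Diff)
    also have "\<dots> = (1 - iid.prob E) * iid.prob B" by (simp add: algebra_simps)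
    finally show ?case using iid.prob_compl[OF compl(1)] by simp
  next
    case (union E)
    have E: "E i \<in> sets \<Omega>" for i using union by auto
    have "(\<lambda>i. iid.prob (E i \<inter> B)) sums iid.prob (\<Union>i. E i \<inter> B)"
      using E B(1) union(1) by (intro iid.finite_measure_UNION) (auto simp: disjoint_family_on_def)
    moreover have "(\<lambda>i. iid.prob (E i) * iid.prob B) sums (iid.prob (\<Union>i. E i) * iid.prob B)"
      using union by (intro sums_mult2 iid.finite_measure_UNION) auto
    moreover have "(\<Union>i. E i \<inter> B) = (\<Union>i. E i) \<inter> B" by auto
    ultimately show ?case unfolding union(3) using sums_unique2 by metis
  qed
  have "iid.prob B = iid.prob B * iid.prob B" using indep[OF B(1)] by simp
  thus ?thesis by auto
qed

end


section \<open>Ergodic measures from towers\<close>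

text \<open>Let \<open>h\<close> map an ergodic measure preserving system to \<open>X\<close> such that one step of that system is
  \<open>\<tau>\<close> steps of the shift. Spreading the mass of \<open>\<omega>\<close> over the first \<open>\<tau> \<omega>\<close> points of the orbit of
  \<open>h \<omega>\<close> and normalizing gives an ergodic shift invariant measure.\<close>

lemma (in mixing_shift) ex_tower_measure:
  fixes \<Omega> :: "'l measure" and h :: "'l \<Rightarrow> int \<Rightarrow> 'a" and \<tau> :: "'l \<Rightarrow> nat"
  assumes \<Omega>: "prob_space \<Omega>"
    and T: "T \<in> measurable \<Omega> \<Omega>" "distr \<Omega> \<Omega> T = \<Omega>"
    and ergodic: "\<And>B. B \<in> sets \<Omega> \<Longrightarrow> T -` B \<inter> space \<Omega> = B \<Longrightarrow> measure \<Omega> B = 0 \<or> measure \<Omega> B = 1"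
    and h: "h \<in> measurable \<Omega> (restrict_space borel X)"
    and \<tau>: "\<tau> \<in> measurable \<Omega> (count_space UNIV)" "\<And>\<omega>. \<omega> \<in> space \<Omega> \<Longrightarrow> \<tau> \<omega> > 0"
      "(\<integral>\<^sup>+\<omega>. \<tau> \<omega> \<partial>\<Omega>) \<noteq> \<infinity>"
    and step: "\<And>\<omega>. \<omega> \<in> space \<Omega> \<Longrightarrow> h (T \<omega>) = translate (int (\<tau> \<omega>)) (h \<omega>)"
  obtains \<mu> where "\<mu> \<in> ergodic_measures X left_shift"
    "\<And>u. u \<in> borel_measurable (restrict_space borel X) \<Longrightarrow>
      (\<integral>\<^sup>+x. u x \<partial>\<mu>) * (\<integral>\<^sup>+\<omega>. \<tau> \<omega> \<partial>\<Omega>) = (\<integral>\<^sup>+\<omega>. (\<Sum>i<\<tau> \<omega>. u (translate (int i) (h \<omega>))) \<partial>\<Omega>)"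
proof -
  interpret prob_space \<Omega> by fact
  interpret cs: sigma_finite_measure "count_space (UNIV :: nat set)"
    by (rule sigma_finite_measure_count_space)
  define Z where "Z = (\<integral>\<^sup>+\<omega>. ennreal (real (\<tau> \<omega>)) \<partial>\<Omega>)"
  have Zfin: "Z \<noteq> \<infinity>" "Z \<noteq> top" "Z < top"
    using \<tau>(3) by (auto simp: Z_def ennreal_of_nat_eq_real_of_nat less_top)
  note [measurable] = h \<tau>(1) T(1)
  have hX: "h \<omega> \<in> X" if "\<omega> \<in> space \<Omega>" for \<omega> using measurable_space[OF h that] by simp
  have Zpos: "Z \<noteq> 0"
  proof -
    have "(\<integral>\<^sup>+\<omega>. 1 \<partial>\<Omega>) \<le> Z"
      unfolding Z_def using \<tau>(2) by (intro nn_integral_mono) (auto simp: Suc_le_eq)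
    thus ?thesis by (auto simp: emeasure_space_1)
  qed
  let ?P = "\<Omega> \<Otimes>\<^sub>M count_space (UNIV :: nat set)"
  define d where "d = (\<lambda>(\<omega>, i). if i < \<tau> \<omega> then 1 / Z else 0)"
  define g where "g = (\<lambda>(\<omega>, i). translate (int i) (h \<omega>))"
  have d [measurable]: "d \<in> borel_measurable ?P" unfolding d_def split_beta
    by (rule measurable_compose_countable[where g = snd and f = "\<lambda>i p. if i < \<tau> (fst p) then 1 / Z else 0"])
       (auto intro!: measurable_compose[OF measurable_compose[OF measurable_fst \<tau>(1)]])
  have g [measurable]: "g \<in> measurable ?P (restrict_space borel X)"
    unfolding g_def split_beta
    by (rule measurable_compose_countable[where g = snd and f = "\<lambda>i p. translate (int i) (h (fst p))"])
       (auto intro!: measurable_compose[OF measurable_fst] measurable_compose[OF h measurable_translate])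
  define \<mu> where "\<mu> = distr (density ?P d) (restrict_space borel X) g"
  have sets_\<mu>: "sets \<mu> = sets (restrict_space borel X)" by (simp add: \<mu>_def)
  have space_\<mu>: "space \<mu> = X" by (simp add: \<mu>_def)
  have meas_u: "(\<lambda>\<omega>. \<Sum>i<\<tau> \<omega>. u (translate (int i) (h \<omega>))) \<in> borel_measurable \<Omega>"
    if u: "u \<in> borel_measurable (restrict_space borel X)" for u :: "_ \<Rightarrow> ennreal"
  proof (rule measurable_compose_countable[where g = \<tau> and f = "\<lambda>n \<omega>. \<Sum>i<n. u (translate (int i) (h \<omega>))"])
    fix n
    show "(\<lambda>\<omega>. \<Sum>i<n. u (translate (int i) (h \<omega>))) \<in> borel_measurable \<Omega>"
      by (intro borel_measurable_sum measurable_compose[OF measurable_compose[OF h measurable_translate] u])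
  qed (rule \<tau>)
  have main: "(\<integral>\<^sup>+x. u x \<partial>\<mu>) = (\<integral>\<^sup>+\<omega>. (\<Sum>i<\<tau> \<omega>. u (translate (int i) (h \<omega>))) \<partial>\<Omega>) / Z"
    if u [measurable]: "u \<in> borel_measurable (restrict_space borel X)" for u :: "_ \<Rightarrow> ennreal"
  proof -
    have "(\<integral>\<^sup>+x. u x \<partial>\<mu>) = (\<integral>\<^sup>+p. d p * u (g p) \<partial>?P)"
      unfolding \<mu>_def by (subst nn_integral_distr, simp, simp) (subst nn_integral_density, auto)
    also have "\<dots> = (\<integral>\<^sup>+\<omega>. \<integral>\<^sup>+i. d (\<omega>, i) * u (g (\<omega>, i)) \<partial>count_space UNIV \<partial>\<Omega>)"
      by (rule cs.nn_integral_fst[symmetric]) measurable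
    also have "\<dots> = (\<integral>\<^sup>+\<omega>. (\<Sum>i<\<tau> \<omega>. u (translate (int i) (h \<omega>))) / Z \<partial>\<Omega>)"
    proof (rule nn_integral_cong)
      fix \<omega>
      have "(\<integral>\<^sup>+i. d (\<omega>, i) * u (g (\<omega>, i)) \<partial>count_space UNIV) = (\<Sum>i. d (\<omega>, i) * u (g (\<omega>, i)))"
        by (rule nn_integral_count_space_nat)
      also have "\<dots> = (\<Sum>i<\<tau> \<omega>. d (\<omega>, i) * u (g (\<omega>, i)))"
        by (rule suminf_finite) (auto simp: d_def)
      also have "\<dots> = (\<Sum>i<\<tau> \<omega>. u (translate (int i) (h \<omega>)) * (1 / Z))"
        by (rule sum.cong) (auto simp: d_def g_def mult.commute)
      also have "\<dots> = (\<Sum>i<\<tau> \<omega>. u (translate (int i) (h \<omega>))) / Z"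
        by (simp add: sum_distrib_right[symmetric] divide_ennreal_def)
      finally show "(\<integral>\<^sup>+i. d (\<omega>, i) * u (g (\<omega>, i)) \<partial>count_space UNIV) = \<dots>" .
    qed
    also have "\<dots> = (\<integral>\<^sup>+\<omega>. (\<Sum>i<\<tau> \<omega>. u (translate (int i) (h \<omega>))) \<partial>\<Omega>) / Z"
      by (rule nn_integral_divide[OF meas_u[OF u]])
    finally show ?thesis .
  qed
  have em: "emeasure \<mu> B = (\<integral>\<^sup>+\<omega>. (\<Sum>i<\<tau> \<omega>. indicator B (translate (int i) (h \<omega>))) \<partial>\<Omega>) / Z"
    if "B \<in> sets (restrict_space borel X)" for B
    using main[of "indicator B"] that sets_\<mu> by simp
  have prob: "prob_space \<mu>"
  proof (rule prob_spaceI)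
    have "emeasure \<mu> X = (\<integral>\<^sup>+\<omega>. (\<Sum>i<\<tau> \<omega>. indicator X (translate (int i) (h \<omega>))) \<partial>\<Omega>) / Z"
      by (rule em) (use sets.top[of \<mu>] space_\<mu> sets_\<mu> in simp)
    also have "(\<integral>\<^sup>+\<omega>. (\<Sum>i<\<tau> \<omega>. indicator X (translate (int i) (h \<omega>))) \<partial>\<Omega>) = Z"
      unfolding Z_def by (rule nn_integral_cong) (simp add: hX translate_mem ennreal_of_nat_eq_real_of_nat)
    finally show "emeasure \<mu> (space \<mu>) = 1" using Zpos Zfin by (simp add: space_\<mu> ennreal_divide_self)
  qed
  have shift_meas: "left_shift \<in> measurable \<mu> \<mu>"
    unfolding left_shift_eq_translate using measurable_translate[of 1] sets_\<mu> by (simp cong: measurable_cong_sets)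
  have "distr \<mu> \<mu> left_shift = \<mu>"
  proof (rule measure_eqI)
    fix B assume "B \<in> sets (distr \<mu> \<mu> left_shift)"
    hence B: "B \<in> sets (restrict_space borel X)" using sets_\<mu> by simp
    hence ind [measurable]: "indicator B \<in> borel_measurable (restrict_space borel X)" by simp
    let ?u = "\<lambda>i \<omega>. indicator B (translate (int i) (h \<omega>)) :: ennreal"
    have m1: "(\<lambda>\<omega>. \<Sum>i<\<tau> \<omega>. ?u i \<omega>) \<in> borel_measurable \<Omega>" by (rule meas_u[OF ind])
    have m2: "(\<lambda>\<omega>. \<Sum>i<\<tau> \<omega>. ?u (Suc i) \<omega>) \<in> borel_measurable \<Omega>"
      using meas_u[OF measurable_compose[OF measurable_translate[of 1] ind]] by (simp add: add.commute)
    have m3: "(\<lambda>\<omega>. indicator B (h \<omega>) :: ennreal) \<in> borel_measurable \<Omega>" by measurable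
    have m4: "(\<lambda>\<omega>. ?u (\<tau> \<omega>) \<omega>) \<in> borel_measurable \<Omega>"
      by (rule measurable_compose_countable[where g = \<tau> and f = "\<lambda>n \<omega>. ?u n \<omega>"])
         (auto intro!: measurable_compose[OF measurable_compose[OF h measurable_translate] ind])
    have "(\<integral>\<^sup>+\<omega>. ?u (\<tau> \<omega>) \<omega> \<partial>\<Omega>) = (\<integral>\<^sup>+\<omega>. indicator B (h (T \<omega>)) \<partial>\<Omega>)"
      by (rule nn_integral_cong) (simp add: step)
    also have "\<dots> = (\<integral>\<^sup>+\<omega>. indicator B (h \<omega>) \<partial>distr \<Omega> \<Omega> T)"
      by (rule nn_integral_distr[symmetric]) (use m3 T in auto)
    finally have end_eq: "(\<integral>\<^sup>+\<omega>. ?u (\<tau> \<omega>) \<omega> \<partial>\<Omega>) = (\<integral>\<^sup>+\<omega>. indicator B (h \<omega>) \<partial>\<Omega>)"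
      by (simp add: T(2))
    have "(\<integral>\<^sup>+\<omega>. indicator B (h \<omega>) \<partial>\<Omega>) \<le> (\<integral>\<^sup>+\<omega>. 1 \<partial>\<Omega>)"
      by (rule nn_integral_mono) (auto simp: indicator_def)
    hence fin: "(\<integral>\<^sup>+\<omega>. indicator B (h \<omega>) \<partial>\<Omega>) \<noteq> \<infinity>" by (auto simp: emeasure_space_1 top_unique)
    \<comment> \<open>Shifting drops the visit at time \<open>0\<close> and adds the one at time \<open>\<tau>\<close>, which is a visit at time
      \<open>0\<close> for \<open>T \<omega>\<close>; both have the same probability.\<close>
    have "(\<integral>\<^sup>+\<omega>. indicator B (h \<omega>) \<partial>\<Omega>) + (\<integral>\<^sup>+\<omega>. (\<Sum>i<\<tau> \<omega>. ?u (Suc i) \<omega>) \<partial>\<Omega>) =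
        (\<integral>\<^sup>+\<omega>. indicator B (h \<omega>) + (\<Sum>i<\<tau> \<omega>. ?u (Suc i) \<omega>) \<partial>\<Omega>)"
      by (rule nn_integral_add[symmetric]) (use m2 m3 in auto)
    also have "\<dots> = (\<integral>\<^sup>+\<omega>. ?u (\<tau> \<omega>) \<omega> + (\<Sum>i<\<tau> \<omega>. ?u i \<omega>) \<partial>\<Omega>)"
    proof (rule nn_integral_cong)
      fix \<omega>
      have "(\<Sum>i<Suc (\<tau> \<omega>). ?u i \<omega>) = ?u 0 \<omega> + (\<Sum>i<\<tau> \<omega>. ?u (Suc i) \<omega>)" by (rule sum.lessThan_Suc_shift)
      thus "indicator B (h \<omega>) + (\<Sum>i<\<tau> \<omega>. ?u (Suc i) \<omega>) = ?u (\<tau> \<omega>) \<omega> + (\<Sum>i<\<tau> \<omega>. ?u i \<omega>)"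
        by (simp add: add.commute)
    qed
    also have "\<dots> = (\<integral>\<^sup>+\<omega>. indicator B (h \<omega>) \<partial>\<Omega>) + (\<integral>\<^sup>+\<omega>. (\<Sum>i<\<tau> \<omega>. ?u i \<omega>) \<partial>\<Omega>)"
      by (subst nn_integral_add) (use m1 m4 end_eq in auto)
    finally have eq: "(\<integral>\<^sup>+\<omega>. (\<Sum>i<\<tau> \<omega>. ?u (Suc i) \<omega>) \<partial>\<Omega>) = (\<integral>\<^sup>+\<omega>. (\<Sum>i<\<tau> \<omega>. ?u i \<omega>) \<partial>\<Omega>)"
      using fin by (simp add: ennreal_add_left_cancel)
    have "emeasure (distr \<mu> \<mu> left_shift) B = (\<integral>\<^sup>+x. indicator B (translate 1 x) \<partial>\<mu>)"
      using nn_integral_distr[OF shift_meas, of "indicator B"] B sets_\<mu>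
      by (simp add: left_shift_eq_translate)
    also have "\<dots> = (\<integral>\<^sup>+\<omega>. (\<Sum>i<\<tau> \<omega>. ?u (Suc i) \<omega>) \<partial>\<Omega>) / Z"
      using main[OF measurable_compose[OF measurable_translate[of 1] ind]] by (simp add: add.commute)
    also have "\<dots> = emeasure \<mu> B" using eq em[OF B] by simp
    finally show "emeasure (distr \<mu> \<mu> left_shift) B = emeasure \<mu> B" .
  qed simp
  hence inv: "\<mu> \<in> invariant_measures X left_shift"
    using prob sets_\<mu> shift_meas by (simp add: invariant_measures_def)
  have "measure \<mu> B = 0 \<or> measure \<mu> B = 1"
    if B: "B \<in> sets \<mu>" "left_shift -` B \<inter> space \<mu> = B" for B
  proof -
    have BX: "B \<in> sets (restrict_space borel X)" using B(1) sets_\<mu> by simp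
    have one: "translate 1 x \<in> B \<longleftrightarrow> x \<in> B" if "x \<in> X" for x
      using B(2) that by (auto simp: space_\<mu> left_shift_eq_translate)
    have all: "translate (int i) x \<in> B \<longleftrightarrow> x \<in> B" if x: "x \<in> X" for i x
    proof (induction i)
      case (Suc i)
      have eq: "translate (int (Suc i)) x = translate 1 (translate (int i) x)"
        by (simp only: translate_translate of_nat_Suc)
      show ?case unfolding eq one[OF translate_mem[OF x]] by (rule Suc)
    qed simp
    define B' where "B' = h -` B \<inter> space \<Omega>"
    have B': "B' \<in> sets \<Omega>" unfolding B'_def by (rule measurable_sets[OF h BX])
    have "T -` B' \<inter> space \<Omega> = B'"
      using measurable_space[OF T(1)] step all hX by (auto simp: B'_def)
    with ergodic[OF B'] have cases: "prob B' = 0 \<or> prob B' = 1" by blast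
    have em_B: "emeasure \<mu> B = (\<integral>\<^sup>+\<omega>. ennreal (real (\<tau> \<omega>)) * indicator B' \<omega> \<partial>\<Omega>) / Z"
      unfolding em[OF BX]
      by (intro arg_cong2[where f = "(/)"] nn_integral_cong refl)
         (auto simp: B'_def all hX indicator_def ennreal_of_nat_eq_real_of_nat)
    from cases show ?thesis
    proof
      assume "prob B' = 0"
      hence "B' \<in> null_sets \<Omega>" using B' by (simp add: null_sets_def emeasure_eq_measure)
      hence "AE \<omega> in \<Omega>. \<omega> \<notin> B'" by (rule AE_not_in)
      hence "(\<integral>\<^sup>+\<omega>. ennreal (real (\<tau> \<omega>)) * indicator B' \<omega> \<partial>\<Omega>) = (\<integral>\<^sup>+\<omega>. 0 \<partial>\<Omega>)"
        by (intro nn_integral_cong_AE) (auto elim: eventually_mono)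
      thus ?thesis using em_B by (simp add: measure_def)
    next
      assume "prob B' = 1"
      hence "AE \<omega> in \<Omega>. \<omega> \<in> B'" using prob_eq_1[OF B'] by simp
      hence "(\<integral>\<^sup>+\<omega>. ennreal (real (\<tau> \<omega>)) * indicator B' \<omega> \<partial>\<Omega>) = Z"
        unfolding Z_def by (intro nn_integral_cong_AE) (auto elim: eventually_mono)
      thus ?thesis using em_B Zpos Zfin by (simp add: measure_def ennreal_divide_self)
    qed
  qed
  with inv have erg: "\<mu> \<in> ergodic_measures X left_shift" by (simp add: ergodic_measures_def)
  show ?thesis
  proof (rule that[OF erg])
    fix u :: "(int \<Rightarrow> 'a) \<Rightarrow> ennreal" assume u: "u \<in> borel_measurable (restrict_space borel X)"
    have "(\<integral>\<^sup>+\<omega>. of_nat (\<tau> \<omega>) \<partial>\<Omega>) = Z" by (simp add: Z_def ennreal_of_nat_eq_real_of_nat)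
    thus "(\<integral>\<^sup>+x. u x \<partial>\<mu>) * (\<integral>\<^sup>+\<omega>. \<tau> \<omega> \<partial>\<Omega>) = (\<integral>\<^sup>+\<omega>. (\<Sum>i<\<tau> \<omega>. u (translate (int i) (h \<omega>))) \<partial>\<Omega>)"
      unfolding main[OF u] using Zpos Zfin by (simp add: ennreal_divide_times ennreal_mult_divide_eq)
  qed
qed


section \<open>An ergodic measure of full support with vanishing integral\<close>

text \<open>A distribution on the natural numbers with positive weights, concentrated on \<open>0\<close> up to a small
  rest even when the other weights are multiplied by \<open>c\<close>.\<close>

lemma ex_pmf_concentrated:
  fixes c :: "nat \<Rightarrow> real"
  assumes c: "\<And>n. c n \<ge> 1" and e: "e > 0" "e \<le> 1 / 2"
  obtains q :: "nat pmf" where "\<And>n. pmf q n > 0"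
    "(\<integral>\<^sup>+n. ennreal (if n = 0 then 0 else c n) \<partial>measure_pmf q) = ennreal e"
proof -
  define v where "v n = e * (1 / 2) ^ Suc n / c (Suc n)" for n
  have v0: "v n > 0" for n using e c[of "Suc n"] by (simp add: v_def)
  have geo: "(\<lambda>n. e * (1 / 2) ^ Suc n) sums e"
    using sums_mult[OF power_half_series, of e] by simp
  have le: "v n \<le> e * (1 / 2) ^ Suc n" for n
  proof -
    have "e * (1 / 2) ^ Suc n / c (Suc n) \<le> e * (1 / 2) ^ Suc n / 1"
      using e c[of "Suc n"] by (intro divide_left_mono) auto
    thus ?thesis by (simp add: v_def)
  qed
  have sm: "summable v"
    by (rule summable_comparison_test'[OF sums_summable[OF geo], of 0])
       (use le v0 in \<open>simp add: abs_of_pos\<close>)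
  define s where "s = suminf v"
  have s: "v sums s" unfolding s_def using sm by (rule summable_sums)
  have "s \<le> e" by (rule sums_le[OF le s geo])
  define f where "f n = (case n of 0 \<Rightarrow> 1 - s | Suc k \<Rightarrow> v k)" for n
  have f0: "f n > 0" for n using v0 \<open>s \<le> e\<close> e by (auto simp: f_def split: nat.splits)
  have f1: "(\<integral>\<^sup>+n. ennreal (f n) \<partial>count_space UNIV) = 1"
  proof -
    have "f sums (s + f 0)"
      by (rule sums_Suc) (use s in \<open>simp add: f_def\<close>)
    hence "f sums 1" by (simp add: f_def)
    thus ?thesis
      unfolding nn_integral_count_space_nat using suminf_ennreal_eq[OF less_imp_le[OF f0]] by simp
  qed
  define q where "q = embed_pmf f"
  have q: "pmf q n = f n" for n
    unfolding q_def by (rule pmf_embed_pmf[OF less_imp_le[OF f0] f1])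
  show ?thesis
  proof
    show "pmf q n > 0" for n by (simp add: q f0)
    let ?g = "\<lambda>n. f n * (if n = 0 then 0 else c n)"
    have "?g (Suc n) = e * (1 / 2) ^ Suc n" for n using c[of "Suc n"] by (simp add: f_def v_def)
    hence "(\<lambda>n. ?g (Suc n)) = (\<lambda>n. e * (1 / 2) ^ Suc n)" by (rule ext)
    hence "(\<lambda>n. ?g (Suc n)) sums e" using geo by (simp only:)
    hence "?g sums (e + ?g 0)" by (rule sums_Suc)
    hence "?g sums e" by simp
    moreover have "0 \<le> ?g n" for n using f0[of n] c[of n] by simp
    ultimately have "(\<Sum>n. ennreal (?g n)) = ennreal e" by (intro suminf_ennreal_eq)
    moreover have "ennreal (pmf q n) * ennreal (if n = 0 then 0 else c n) = ennreal (?g n)" for n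
      using f0[of n] c[of n] by (simp add: q ennreal_mult)
    ultimately show "(\<integral>\<^sup>+n. ennreal (if n = 0 then 0 else c n) \<partial>measure_pmf q) = ennreal e"
      by (simp only: nn_integral_measure_pmf nn_integral_count_space_nat)
  qed
qed

lemma measurable_start:
  assumes "\<And>i. (\<lambda>\<omega>. W \<omega> i) \<in> measurable \<Omega> (count_space UNIV)"
  shows "(\<lambda>\<omega>. start (W \<omega>) n) \<in> measurable \<Omega> (count_space UNIV)"
proof (induction n rule: int_induct[where k = 0])
  case base
  show ?case by simp
next
  case (step1 n)
  have "(\<lambda>\<omega>. m + int (length (W \<omega> n))) \<in> measurable \<Omega> (count_space UNIV)" for m
    by (rule measurable_compose[OF assms]) simp
  from measurable_compose_countable[where f = "\<lambda>m \<omega>. m + int (length (W \<omega> n))", OF this step1(2)]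
  show ?case by (simp add: start_Suc)
next
  case (step2 n)
  have "(\<lambda>\<omega>. m - int (length (W \<omega> (n - 1)))) \<in> measurable \<Omega> (count_space UNIV)" for m
    by (rule measurable_compose[OF assms]) simp
  from measurable_compose_countable[where f = "\<lambda>m \<omega>. m - int (length (W \<omega> (n - 1)))", OF this step2(2)]
  moreover have "start (W \<omega>) n - int (length (W \<omega> (n - 1))) = start (W \<omega>) (n - 1)" for \<omega>
    using start_Suc[of "W \<omega>" "n - 1"] by simp
  ultimately show ?case by simp
qed

lemma measurable_concatenation:
  assumes W: "\<And>i. (\<lambda>\<omega>. W \<omega> i) \<in> measurable \<Omega> (count_space UNIV)"
    and ne: "\<And>\<omega> i. \<omega> \<in> space \<Omega> \<Longrightarrow> W \<omega> i \<noteq> []"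
  shows "{\<omega>\<in>space \<Omega>. concatenation (W \<omega>) j = a} \<in> sets \<Omega>"
proof -
  have "{\<omega>\<in>space \<Omega>. concatenation (W \<omega>) j = a} =
    (\<Union>n::int. \<Union>k::nat. {\<omega>\<in>space \<Omega>. start (W \<omega>) n = j - int k} \<inter>
      {\<omega>\<in>space \<Omega>. k < length (W \<omega> n) \<and> W \<omega> n ! k = a})" (is "?L = ?R")
  proof (intro set_eqI iffI)
    fix \<omega> assume \<omega>: "\<omega> \<in> ?L"
    obtain n where n: "start (W \<omega>) n \<le> j" "j < start (W \<omega>) (n + 1)"
      using ex_block[of "W \<omega>" j] ne \<omega> by auto
    define k where "k = nat (j - start (W \<omega>) n)"
    have k: "j = start (W \<omega>) n + int k" "k < length (W \<omega> n)"
      using n by (auto simp: k_def start_Suc)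
    have "concatenation (W \<omega>) j = W \<omega> n ! k"
      unfolding k(1) by (rule concatenation_eq) (use ne \<omega> k in auto)
    hence "W \<omega> n ! k = a" using \<omega> by simp
    thus "\<omega> \<in> ?R" using k \<omega> by (intro UN_I[of n] UN_I[of k]) auto
  next
    fix \<omega> assume "\<omega> \<in> ?R"
    then obtain n k where \<omega>: "\<omega> \<in> space \<Omega>" "start (W \<omega>) n = j - int k" "k < length (W \<omega> n)" "W \<omega> n ! k = a"
      by blast
    have "concatenation (W \<omega>) (start (W \<omega>) n + int k) = W \<omega> n ! k"
      by (rule concatenation_eq) (use ne \<omega> in auto)
    thus "\<omega> \<in> ?L" using \<omega> by simp
  qed
  moreover have "{\<omega>\<in>space \<Omega>. start (W \<omega>) n = j - int k} \<in> sets \<Omega>" for n k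
    using measurable_sets[OF measurable_start[of W \<Omega> n, OF W], of "{j - int k}"]
    by (simp add: vimage_def Int_def conj_commute)
  moreover have "{\<omega>\<in>space \<Omega>. k < length (W \<omega> n) \<and> W \<omega> n ! k = a} \<in> sets \<Omega>" for n k
    using measurable_sets[OF W[of n], of "{l. k < length l \<and> l ! k = a}"]
    by (simp add: vimage_def Int_def conj_commute)
  ultimately show ?thesis by auto
qed

text \<open>A letter of a concatenation depends on finitely many of the words.\<close>

lemma concatenation_cong:
  assumes ne: "\<And>n. u n \<noteq> []" "\<And>n. v n \<noteq> []"
    and n: "start u n \<le> j" "j < start u (n + 1)" and eq: "\<And>i. i \<in> {-\<bar>n\<bar>..\<bar>n\<bar>} \<Longrightarrow> v i = u i"
  shows "concatenation v j = concatenation u j"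
proof -
  have "start v n = start u n"
    unfolding start_def by (intro arg_cong2[where f = "(-)"] sum.cong refl) (auto simp: eq)
  moreover have vn: "v n = u n" by (rule eq) auto
  ultimately have "start v n \<le> j" "j < start v (n + 1)" using n by (simp_all add: start_Suc)
  hence "block_at v j = n" using ne(2) by (intro block_at_eqI)
  moreover have "block_at u j = n" using ne(1) n by (intro block_at_eqI)
  ultimately show ?thesis using \<open>start v n = start u n\<close> vn by (simp add: concatenation_def)
qed

context shift_observable
begin

text \<open>If the words of a sequence of concatenations are eventually constant, then \<open>f\<close> converges along it.\<close>

lemma tendsto_concatenation:
  assumes u: "\<And>n. loop (u n)" "\<And>m n. loop (v m n)"
    and ev: "\<And>n. eventually (\<lambda>m. v m n = u n) sequentially"
  shows "(\<lambda>m. f (translate p (concatenation (v m)))) \<longlonglongrightarrow> f (translate p (concatenation u))"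
proof (rule LIMSEQ_I)
  have ne: "\<And>n. u n \<noteq> []" "\<And>m n. v m n \<noteq> []" using u loop_nonempty by blast+
  have coord: "eventually (\<lambda>m. concatenation (v m) j = concatenation u j) sequentially" for j
  proof -
    obtain n where n: "start u n \<le> j" "j < start u (n + 1)" using ex_block[of u j] ne by auto
    have "eventually (\<lambda>m. \<forall>i\<in>{-\<bar>n\<bar>..\<bar>n\<bar>}. v m i = u i) sequentially"
      using ev by (intro eventually_ball_finite) auto
    thus ?thesis
    proof (rule eventually_mono)
      fix m assume "\<forall>i\<in>{-\<bar>n\<bar>..\<bar>n\<bar>}. v m i = u i"
      thus "concatenation (v m) j = concatenation u j"
        by (intro concatenation_cong[OF ne(1) ne(2) n]) blast
    qed
  qed
  fix e :: real assume "e > 0"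
  then obtain r :: nat where r: "\<And>x y. x \<in> X \<Longrightarrow> y \<in> X \<Longrightarrow> (\<forall>i\<in>{-int r..int r}. x i = y i) \<Longrightarrow> \<bar>f x - f y\<bar> < e"
    using uniformly_continuous by blast
  have "eventually (\<lambda>m. \<forall>i\<in>{-int r..int r}. concatenation (v m) (i + p) = concatenation u (i + p)) sequentially"
    using coord by (intro eventually_ball_finite) auto
  then obtain m0 where m0: "\<And>m i. m \<ge> m0 \<Longrightarrow> i \<in> {-int r..int r} \<Longrightarrow> concatenation (v m) (i + p) = concatenation u (i + p)"
    unfolding eventually_sequentially by blast
  show "\<exists>m0. \<forall>m\<ge>m0. norm (f (translate p (concatenation (v m))) - f (translate p (concatenation u))) < e"
  proof (intro exI allI impI)
    fix m assume "m \<ge> m0"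
    thus "norm (f (translate p (concatenation (v m))) - f (translate p (concatenation u))) < e"
      unfolding real_norm_def
      by (intro r translate_mem concatenation_mem u) (simp add: m0)
  qed
qed

text \<open>Loops are concatenated independently: a loop drawn at random is, up to a small probability,
  \<open>P\<close> or \<open>Q\<close>, depending on whether a uniform variable is below \<open>\<theta>\<close>, but it is any given loop with
  positive probability. As \<open>\<theta>\<close> varies, the mean of the sum of \<open>f\<close> over one loop changes continuously
  from a negative to a positive value, and the tower measure for the \<open>\<theta>\<close> where it vanishes has the
  required properties.\<close>

theorem ex_ergodic_zero_integral:
  assumes M: "M \<in> invariant_measures X left_shift" "integral\<^sup>L M f > 0"
    and M': "M' \<in> invariant_measures X left_shift" "integral\<^sup>L M' f < 0"
  obtains \<mu> where "\<mu> \<in> ergodic_measures X left_shift" "measure_support \<mu> = X" "integral\<^sup>L \<mu> f = 0"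
proof -
  obtain P Q \<delta> where \<delta>: "\<delta> > 0" and P: "loop_above f \<delta> P" and Q: "loop_above (\<lambda>x. - f x) \<delta> Q"
    and len: "length P = length Q" using ex_opposite_loops[OF assms] by blast
  have loops: "loop P" "loop Q" using P Q by (auto simp: loop_above_def)
  define LL where "LL = {l. loop l}"
  have "LL \<subseteq> lists A"
  proof
    fix l assume "l \<in> LL"
    then obtain x where "x \<in> X" "\<forall>k<length l. x (int k) = l ! k" by (auto simp: LL_def loop_def)
    hence "\<forall>k<length l. l ! k \<in> A" using letters by metis
    thus "l \<in> lists A" by (auto simp: in_set_conv_nth)
  qed
  from countable_subset[OF this countable_lists[OF countable_finite[OF finite_alphabet]]]
  have LL: "countable LL" "LL \<noteq> {}" using loops(1) by (auto simp: LL_def)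
  \<comment> \<open>The index \<open>0\<close> is reserved for the choice between \<open>P\<close> and \<open>Q\<close>.\<close>
  define Lp where "Lp n = from_nat_into LL (n - 1)" for n
  have Lp: "loop (Lp n)" for n using from_nat_into[OF LL(2)] by (auto simp: Lp_def LL_def)
  have Lp_surj: "\<exists>n>0. Lp n = l" if "loop l" for l
  proof -
    obtain n where "from_nat_into LL n = l" using from_nat_into_surj[OF LL(1)] \<open>loop l\<close> by (auto simp: LL_def)
    thus ?thesis by (intro exI[of _ "Suc n"]) (simp add: Lp_def)
  qed
  have Lp_len: "real (length (Lp n)) \<ge> 1" for n
    using loop_nonempty[OF Lp[of n]] by (cases "Lp n") auto
  define l where "l = real (length P)"
  have l: "l \<ge> 1" using loop_nonempty[OF loops(1)] by (cases P) (auto simp: l_def)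
  define D where "D = \<delta> * l + C"
  have D: "D > 0" "\<delta> * l \<le> D" "0 < \<delta> * l" using \<delta> l bound_nonneg by (auto simp: D_def add_pos_nonneg)
  \<comment> \<open>the mean length of the other loops is small enough not to affect signs\<close>
  define e where "e = \<delta> * l / (2 * D)"
  have e: "e > 0" "e \<le> 1 / 2" "D * e = \<delta> * l / 2" using D by (auto simp: e_def field_simps)
  obtain q :: "nat pmf" where q: "\<And>n. pmf q n > 0"
    "(\<integral>\<^sup>+n. ennreal (if n = 0 then 0 else real (length (Lp n))) \<partial>measure_pmf q) = ennreal e"
    using ex_pmf_concentrated[of "\<lambda>n. real (length (Lp n))" e] Lp_len e by blast
  \<comment> \<open>A random letter consists of the index of a loop and a uniform variable in \<open>[0, 1]\<close>.\<close>
  define U where "U = restrict_space lborel {0..1::real}"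
  have U: "prob_space U"
    by (rule prob_spaceI) (simp add: U_def space_restrict_space emeasure_restrict_space)
  interpret U: prob_space U by (rule U)
  define N' where "N' = measure_pmf q \<Otimes>\<^sub>M U"
  have N': "prob_space N'" unfolding N'_def by (intro prob_space_pair U prob_space_measure_pmf)
  have space_N': "u \<in> space N' \<longleftrightarrow> 0 \<le> snd u \<and> snd u \<le> 1" for u
    by (cases u) (simp add: N'_def space_pair_measure U_def space_restrict_space)
  have fst_meas: "fst \<in> measurable N' (count_space UNIV)"
  proof -
    have "fst \<in> measurable N' (measure_pmf q)" unfolding N'_def by (rule measurable_fst)
    also have "measurable N' (measure_pmf q) = measurable N' (count_space UNIV)"
      by (rule measurable_cong_sets) auto
    finally show ?thesis .
  qed
  have "(\<lambda>x. x) \<in> measurable U borel" unfolding U_def by (rule measurable_restrict_space1) simp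
  from measurable_compose[OF measurable_snd this]
  have snd_meas: "snd \<in> borel_measurable N'" by (simp add: N'_def)
  have AE_snd: "AE u in N'. snd u \<noteq> \<theta>" for \<theta>
  proof (rule AE_I')
    have "emeasure N' (UNIV \<times> ({0..1} \<inter> {\<theta>})) = emeasure (measure_pmf q) UNIV * emeasure U ({0..1} \<inter> {\<theta>})"
      unfolding N'_def by (rule U.emeasure_pair_measure_Times) (auto simp: U_def sets_restrict_space)
    also have "emeasure U ({0..1} \<inter> {\<theta>}) = emeasure lborel ({0..1} \<inter> {\<theta>})"
      unfolding U_def by (rule emeasure_restrict_space) auto
    also have "\<dots> \<le> emeasure lborel {\<theta>}" by (rule emeasure_mono) auto
    hence "emeasure lborel ({0..1} \<inter> {\<theta>}) = 0" by simp
    finally show "UNIV \<times> ({0..1} \<inter> {\<theta>}) \<in> null_sets N'"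
      by (auto simp: null_sets_def N'_def U_def sets_restrict_space intro!: pair_measureI)
    show "{u\<in>space N'. \<not> snd u \<noteq> \<theta>} \<subseteq> UNIV \<times> ({0..1} \<inter> {\<theta>})"
      using space_N' by auto
  qed
  define g where "g \<theta> u = (if fst u = 0 then (if snd u < \<theta> then P else Q) else Lp (fst u))"
    for \<theta> and u :: "nat \<times> real"
  have g_loop: "loop (g \<theta> u)" for \<theta> u using loops Lp by (auto simp: g_def)
  have g_meas: "g \<theta> \<in> measurable N' (count_space UNIV)" for \<theta>
  proof -
    have "{u\<in>space N'. snd u < \<theta>} \<in> sets N'" using snd_meas by measurable
    hence "(\<lambda>u. if n = 0 then (if snd u < \<theta> then P else Q) else Lp n) \<in> measurable N' (count_space UNIV)" for n :: nat
      by (cases "n = 0") (auto intro!: measurable_If)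
    from measurable_compose_countable[OF this fst_meas] show ?thesis by (simp add: g_def[abs_def])
  qed
  define \<Omega> where "\<Omega> = PiM (UNIV :: int set) (\<lambda>_. N')"
  have \<Omega>: "prob_space \<Omega>" unfolding \<Omega>_def by (rule iid_prob_space[OF N'])
  interpret prob_space \<Omega> by (rule \<Omega>)
  have space_\<Omega>: "\<omega> i \<in> space N'" if "\<omega> \<in> space \<Omega>" for \<omega> i
    using that by (auto simp: \<Omega>_def space_PiM PiE_iff)
  have comp: "(\<lambda>\<omega>. \<omega> i) \<in> measurable \<Omega> N'" for i unfolding \<Omega>_def by simp
  have first_letter: "(\<integral>\<^sup>+\<omega>. F (fst (\<omega> 0)) \<partial>\<Omega>) = (\<integral>\<^sup>+n. F n \<partial>measure_pmf q)" for F :: "nat \<Rightarrow> ennreal"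
  proof -
    have F: "(\<lambda>u. F (fst u)) \<in> borel_measurable N'" by (rule measurable_compose[OF fst_meas]) simp
    have "(\<integral>\<^sup>+\<omega>. F (fst (\<omega> 0)) \<partial>\<Omega>) = (\<integral>\<^sup>+u. F (fst u) \<partial>distr \<Omega> N' (\<lambda>\<omega>. \<omega> 0))"
      by (rule nn_integral_distr[symmetric, OF comp]) (simp add: F)
    also have "distr \<Omega> N' (\<lambda>\<omega>. \<omega> 0) = N'" unfolding \<Omega>_def by (rule distr_PiM_component) (auto intro: N')
    also have "(\<integral>\<^sup>+u. F (fst u) \<partial>N') = (\<integral>\<^sup>+n. F n \<partial>distr N' (measure_pmf q) fst)"
      by (rule nn_integral_distr[symmetric]) (auto simp: N'_def)
    also have "distr N' (measure_pmf q) fst = measure_pmf q" unfolding N'_def by (rule U.distr_pair_fst)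
    finally show ?thesis .
  qed
  define \<tau> where "\<tau> \<omega> = (if fst (\<omega> 0) = 0 then length P else length (Lp (fst (\<omega> 0))))" for \<omega> :: "int \<Rightarrow> nat \<times> real"
  define W where "W \<theta> \<omega> i = g \<theta> (\<omega> i)" for \<theta> and \<omega> :: "int \<Rightarrow> nat \<times> real" and i :: int
  have W_loop: "loop (W \<theta> \<omega> i)" for \<theta> \<omega> i by (simp add: W_def g_loop)
  have W_ne: "W \<theta> \<omega> i \<noteq> []" for \<theta> \<omega> i using loop_nonempty[OF W_loop] .
  have W_len: "length (W \<theta> \<omega> 0) = \<tau> \<omega>" for \<theta> \<omega> by (simp add: W_def g_def \<tau>_def len)
  have W_meas: "(\<lambda>\<omega>. W \<theta> \<omega> i) \<in> measurable \<Omega> (count_space UNIV)" for \<theta> i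
    unfolding W_def by (rule measurable_compose[OF comp g_meas])
  have \<tau>_meas: "\<tau> \<in> measurable \<Omega> (count_space UNIV)"
    unfolding \<tau>_def by (rule measurable_compose[OF measurable_compose[OF comp fst_meas]]) simp
  have \<tau>_pos: "\<tau> \<omega> > 0" for \<omega> using W_ne[of 0 \<omega> 0] W_len[of 0 \<omega>] by (metis length_greater_0_conv)
  define h where "h \<theta> \<omega> = concatenation (W \<theta> \<omega>)" for \<theta> \<omega>
  have h_mem: "h \<theta> \<omega> \<in> X" for \<theta> \<omega> unfolding h_def by (rule concatenation_mem[OF W_loop])
  have h_meas: "h \<theta> \<in> measurable \<Omega> (restrict_space borel X)" for \<theta>
    by (rule measurable_into_shift[OF h_mem]) (unfold h_def, rule measurable_concatenation[OF W_meas W_ne])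
  have h_step: "h \<theta> (translate 1 \<omega>) = translate (int (\<tau> \<omega>)) (h \<theta> \<omega>)" for \<theta> \<omega>
  proof -
    have "h \<theta> (translate 1 \<omega>) = concatenation (\<lambda>n. W \<theta> \<omega> (n + 1))" by (simp add: h_def W_def[abs_def])
    also have "\<dots> = translate (start (W \<theta> \<omega>) 1) (concatenation (W \<theta> \<omega>))"
      by (rule concatenation_translate[OF W_ne])
    also have "start (W \<theta> \<omega>) 1 = int (\<tau> \<omega>)" using start_Suc[of "W \<theta> \<omega>" 0] by (simp add: W_len)
    finally show ?thesis by (simp only: h_def)
  qed
  have h_nth: "h \<theta> \<omega> (int k) = W \<theta> \<omega> 0 ! k" if "k < \<tau> \<omega>" for \<theta> \<omega> k
    using concatenation_eq[of "W \<theta> \<omega>" k 0] W_ne that by (simp add: h_def W_len)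
  \<comment> \<open>the length of the first loop if its index is not \<open>0\<close>\<close>
  define rest where "rest \<omega> = (if fst (\<omega> 0) = 0 then 0 else real (length (Lp (fst (\<omega> 0)))))" for \<omega> :: "int \<Rightarrow> nat \<times> real"
  have rest_meas: "rest \<in> borel_measurable \<Omega>"
    unfolding rest_def by (rule measurable_compose[OF measurable_compose[OF comp fst_meas]]) simp
  have rest_nn: "(\<integral>\<^sup>+\<omega>. ennreal (rest \<omega>) \<partial>\<Omega>) = ennreal e"
    using first_letter[of "\<lambda>n. ennreal (if n = 0 then 0 else real (length (Lp n)))"] q(2) by (simp add: rest_def)
  have rest_int: "integrable \<Omega> rest"
    by (rule integrableI_nonneg) (use rest_meas rest_nn in \<open>auto simp: rest_def\<close>)
  have rest_exp: "expectation rest = e"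
    using integral_eq_nn_integral[of rest \<Omega>] rest_meas rest_nn e(1) by (simp add: rest_def)
  have \<tau>_eq: "real (\<tau> \<omega>) \<le> l + rest \<omega>" for \<omega> using l by (simp add: \<tau>_def rest_def l_def)
  have \<tau>_int: "integrable \<Omega> (\<lambda>\<omega>. real (\<tau> \<omega>))"
  proof (rule Bochner_Integration.integrable_bound[of \<Omega> "\<lambda>\<omega>. l + rest \<omega>"])
    show "integrable \<Omega> (\<lambda>\<omega>. l + rest \<omega>)" using rest_int by simp
    show "(\<lambda>\<omega>. real (\<tau> \<omega>)) \<in> borel_measurable \<Omega>" by (rule measurable_compose[OF \<tau>_meas]) simp
    show "AE \<omega> in \<Omega>. norm (real (\<tau> \<omega>)) \<le> norm (l + rest \<omega>)" 
    proof (rule AE_I2)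
      fix \<omega>
      show "norm (real (\<tau> \<omega>)) \<le> norm (l + rest \<omega>)"
        using \<tau>_eq[of \<omega>] by simp
    qed
  qed
  define Z where "Z \<theta> \<omega> = orbit_sum f (h \<theta> \<omega>) 0 (int (\<tau> \<omega>))" for \<theta> \<omega>
  have Z_meas: "Z \<theta> \<in> borel_measurable \<Omega>" for \<theta>
  proof -
    have "(\<lambda>\<omega>. \<Sum>p\<in>{0..<int n}. f (translate p (h \<theta> \<omega>))) \<in> borel_measurable \<Omega>" for n
      by (intro borel_measurable_sum measurable_compose[OF h_meas measurable_observable(2)]) simp
    from measurable_compose_countable[OF this \<tau>_meas] show ?thesis by (simp add: Z_def[abs_def] orbit_sum_def)
  qed
  have Z_bound: "\<bar>Z \<theta> \<omega>\<bar> \<le> C * real (\<tau> \<omega>)" for \<theta> \<omega>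
    using orbit_sum_le[OF h_mem, of 0 "int (\<tau> \<omega>)"] by (simp add: Z_def)
  have Z_int: "integrable \<Omega> (Z \<theta>)" for \<theta>
    by (rule Bochner_Integration.integrable_bound[OF integrable_mult_right[OF \<tau>_int, of C] Z_meas])
       (use Z_bound[of \<theta>] bound_nonneg in \<open>simp add: abs_mult\<close>)
  \<comment> \<open>For \<open>\<theta> = 2\<close> the index \<open>0\<close> always gives \<open>P\<close>, for \<open>\<theta> = -1\<close> always \<open>Q\<close>.\<close>
  have Z_rest: "Z \<theta> \<omega> \<ge> \<delta> * l - D * rest \<omega> \<and> - Z \<theta> \<omega> \<ge> \<delta> * l - D * rest \<omega>" if "fst (\<omega> 0) \<noteq> 0" for \<theta> \<omega>
  proof -
    have \<tau>: "rest \<omega> = real (\<tau> \<omega>)" "real (\<tau> \<omega>) \<ge> 1" using that Lp_len by (auto simp: rest_def \<tau>_def)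
    have "\<delta> * l * 1 \<le> \<delta> * l * real (\<tau> \<omega>)" using D \<tau>(2) by (intro mult_left_mono) auto
    hence "\<delta> * l - D * rest \<omega> \<le> - (C * real (\<tau> \<omega>))" by (simp add: D_def \<tau>(1) algebra_simps)
    thus ?thesis using Z_bound[of \<theta> \<omega>] by linarith
  qed
  have Z_high: "Z 2 \<omega> \<ge> \<delta> * l - D * rest \<omega>" if \<omega>: "\<omega> \<in> space \<Omega>" for \<omega>
  proof (cases "fst (\<omega> 0) = 0")
    case True
    have "snd (\<omega> 0) \<le> 1" using space_\<Omega>[OF \<omega>, of 0] by (simp add: space_N')
    hence W0: "W 2 \<omega> 0 = P" using True by (simp add: W_def g_def)
    hence \<tau>: "\<tau> \<omega> = length P" using W_len[of 2 \<omega>] by simp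
    have "\<forall>k<length P. h 2 \<omega> (0 + int k) = P ! k" using h_nth[of _ \<omega> 2] W0 \<tau> by simp
    hence "\<delta> * l \<le> orbit_sum f (h 2 \<omega>) 0 (0 + int (length P))"
      using P h_mem[of 2 \<omega>] unfolding loop_above_def l_def by blast
    thus ?thesis using True by (simp add: Z_def \<tau> rest_def)
  qed (use Z_rest in blast)
  have Z_low: "- Z (-1) \<omega> \<ge> \<delta> * l - D * rest \<omega>" if \<omega>: "\<omega> \<in> space \<Omega>" for \<omega>
  proof (cases "fst (\<omega> 0) = 0")
    case True
    have "snd (\<omega> 0) \<ge> 0" using space_\<Omega>[OF \<omega>, of 0] by (simp add: space_N')
    hence W0: "W (-1) \<omega> 0 = Q" using True by (simp add: W_def g_def)
    hence \<tau>: "\<tau> \<omega> = length Q" using W_len[of "-1" \<omega>] by simp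
    have "\<forall>k<length Q. h (-1) \<omega> (0 + int k) = Q ! k" using h_nth[of _ \<omega> "-1"] W0 \<tau> by simp
    hence "\<delta> * real (length Q) \<le> orbit_sum (\<lambda>x. - f x) (h (-1) \<omega>) 0 (0 + int (length Q))"
      using Q h_mem[of "-1" \<omega>] unfolding loop_above_def by blast
    thus ?thesis using True by (simp add: Z_def \<tau> rest_def l_def len orbit_sum_uminus)
  qed (use Z_rest in blast)
  have rest_mean: "expectation (\<lambda>\<omega>. \<delta> * l - D * rest \<omega>) = \<delta> * l / 2"
    using rest_int rest_exp e(3) by (simp add: prob_space)
  have int': "integrable \<Omega> (\<lambda>\<omega>. \<delta> * l - D * rest \<omega>)" using rest_int by simp
  have high: "expectation (Z 2) \<ge> 0"
    using integral_mono[OF int' Z_int[of 2] Z_high] rest_mean D by simp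
  have low: "expectation (Z (-1)) \<le> 0"
    using integral_mono[OF int' integrable_minus[OF Z_int[of "-1"]] Z_low] rest_mean D by simp
  have "isCont (\<lambda>\<theta>. expectation (Z \<theta>)) \<theta>" for \<theta>
  proof (rule continuous_at_sequentiallyI)
    fix t :: "nat \<Rightarrow> real" assume t: "t \<longlonglongrightarrow> \<theta>"
    show "(\<lambda>m. expectation (Z (t m))) \<longlonglongrightarrow> expectation (Z \<theta>)"
    proof (rule integral_dominated_convergence[where w = "\<lambda>\<omega>. C * real (\<tau> \<omega>)"])
      show "integrable \<Omega> (\<lambda>\<omega>. C * real (\<tau> \<omega>))" using \<tau>_int by simp
      show "AE \<omega> in \<Omega>. norm (Z (t m) \<omega>) \<le> C * real (\<tau> \<omega>)" for m using Z_bound by simp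
      \<comment> \<open>If no uniform variable equals \<open>\<theta>\<close>, then each word is eventually the one for \<open>\<theta>\<close>.\<close>
      have "AE \<omega> in \<Omega>. snd (\<omega> i) \<noteq> \<theta>" for i
        unfolding \<Omega>_def by (rule AE_PiM_component) (auto intro: N' AE_snd)
      hence "AE \<omega> in \<Omega>. \<forall>i. snd (\<omega> i) \<noteq> \<theta>" by (simp add: AE_all_countable)
      thus "AE \<omega> in \<Omega>. (\<lambda>m. Z (t m) \<omega>) \<longlonglongrightarrow> Z \<theta> \<omega>"
      proof (rule AE_mp, intro AE_I2 impI)
        fix \<omega> :: "int \<Rightarrow> nat \<times> real" assume \<omega>: "\<forall>i. snd (\<omega> i) \<noteq> \<theta>"
        have "eventually (\<lambda>m. W (t m) \<omega> i = W \<theta> \<omega> i) sequentially" for i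
        proof (cases "snd (\<omega> i) < \<theta>")
          case True
          from order_tendstoD(1)[OF t True] show ?thesis
            by (rule eventually_mono) (use True in \<open>simp add: W_def g_def\<close>)
        next
          case False
          hence "\<theta> < snd (\<omega> i)" using \<omega> by (metis linorder_cases)
          from order_tendstoD(2)[OF t this] show ?thesis
            by (rule eventually_mono) (use False in \<open>simp add: W_def g_def\<close>)
        qed
        thus "(\<lambda>m. Z (t m) \<omega>) \<longlonglongrightarrow> Z \<theta> \<omega>"
          unfolding Z_def orbit_sum_def h_def by (intro tendsto_sum tendsto_concatenation W_loop)
      qed
    qed (use Z_meas in auto)
  qed
  hence "continuous_on {-1..2} (\<lambda>\<theta>. expectation (Z \<theta>))"
    by (intro continuous_at_imp_continuous_on) auto
  from IVT'[OF low high _ this] obtain \<theta> where \<theta>: "expectation (Z \<theta>) = 0" by auto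
  have \<tau>_nn: "(\<integral>\<^sup>+\<omega>. \<tau> \<omega> \<partial>\<Omega>) = ennreal (expectation (\<lambda>\<omega>. real (\<tau> \<omega>)))"
    using nn_integral_eq_integral[OF \<tau>_int] by (simp add: ennreal_of_nat_eq_real_of_nat)
  have T: "translate 1 \<in> measurable \<Omega> \<Omega>" "distr \<Omega> \<Omega> (translate 1) = \<Omega>"
    unfolding \<Omega>_def by (rule measurable_iid_translate[OF N'], rule distr_iid_translate[OF N'])
  have erg: "prob B = 0 \<or> prob B = 1" if "B \<in> sets \<Omega>" "translate 1 -` B \<inter> space \<Omega> = B" for B
    using iid_ergodic[OF N', of B] that unfolding \<Omega>_def by blast
  have pos: "\<tau> \<omega> > 0" and step: "h \<theta> (translate 1 \<omega>) = translate (int (\<tau> \<omega>)) (h \<theta> \<omega>)"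
    if "\<omega> \<in> space \<Omega>" for \<omega> by (rule \<tau>_pos, rule h_step)
  have fin: "(\<integral>\<^sup>+\<omega>. \<tau> \<omega> \<partial>\<Omega>) \<noteq> \<infinity>" using \<tau>_nn by simp
  obtain \<mu> where \<mu>: "\<mu> \<in> ergodic_measures X left_shift"
    "\<And>u. u \<in> borel_measurable (restrict_space borel X) \<Longrightarrow>
      (\<integral>\<^sup>+x. u x \<partial>\<mu>) * (\<integral>\<^sup>+\<omega>. \<tau> \<omega> \<partial>\<Omega>) = (\<integral>\<^sup>+\<omega>. (\<Sum>i<\<tau> \<omega>. u (translate (int i) (h \<theta> \<omega>))) \<partial>\<Omega>)"
    by (rule ex_tower_measure[where T = "translate 1" and h = "h \<theta>" and \<tau> = \<tau>,
          OF \<Omega> T erg h_meas \<tau>_meas pos fin step]) (assumption, assumption, assumption, assumption, rule that)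
  have inv: "\<mu> \<in> invariant_measures X left_shift" using \<mu>(1) by (simp add: ergodic_measures_def)
  note inv' = invariant_measuresD[OF inv]
  interpret \<mu>: prob_space \<mu> by (rule inv'(3))
  define E where "E = expectation (\<lambda>\<omega>. real (\<tau> \<omega>))"
  have E: "E > 0"
  proof -
    have "expectation (\<lambda>_. 1 :: real) \<le> E"
      unfolding E_def using \<tau>_int \<tau>_pos by (intro integral_mono) (auto simp: Suc_le_eq)
    thus ?thesis by (simp add: prob_space)
  qed
  show ?thesis
  proof (rule that[OF \<mu>(1)])
    have nonneg: "0 \<le> f y + C" if "y \<in> X" for y using bound[OF that] by linarith
    have f_meas: "f \<in> borel_measurable (restrict_space borel X)" by (rule measurable_observable(1)) simp
    \<comment> \<open>the constant \<open>C\<close> makes the integrand nonnegative\<close>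
    have "(\<integral>\<^sup>+x. ennreal (f x + C) \<partial>\<mu>) * ennreal E = (\<integral>\<^sup>+\<omega>. (\<Sum>i<\<tau> \<omega>. ennreal (f (translate (int i) (h \<theta> \<omega>)) + C)) \<partial>\<Omega>)"
      using \<mu>(2)[of "\<lambda>x. ennreal (f x + C)"] f_meas by (simp add: \<tau>_nn E_def)
    also have "\<dots> = (\<integral>\<^sup>+\<omega>. ennreal (Z \<theta> \<omega> + C * real (\<tau> \<omega>)) \<partial>\<Omega>)"
    proof (rule nn_integral_cong)
      fix \<omega>
      have "(\<Sum>i<\<tau> \<omega>. ennreal (f (translate (int i) (h \<theta> \<omega>)) + C)) =
          ennreal (\<Sum>i<\<tau> \<omega>. f (translate (int i) (h \<theta> \<omega>)) + C)"
        by (intro sum_ennreal nonneg translate_mem h_mem)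
      also have "(\<Sum>i<\<tau> \<omega>. f (translate (int i) (h \<theta> \<omega>)) + C) = Z \<theta> \<omega> + C * real (\<tau> \<omega>)"
      proof -
        have "(\<Sum>i<\<tau> \<omega>. f (translate (int i) (h \<theta> \<omega>))) = Z \<theta> \<omega>"
          unfolding Z_def orbit_sum_def by (rule sum.reindex_bij_witness[of _ nat int]) auto
        thus ?thesis by (simp add: sum.distrib mult.commute)
      qed
      finally show "(\<Sum>i<\<tau> \<omega>. ennreal (f (translate (int i) (h \<theta> \<omega>)) + C)) = ennreal (Z \<theta> \<omega> + C * real (\<tau> \<omega>))" .
    qed
    also have "\<dots> = ennreal (expectation (\<lambda>\<omega>. Z \<theta> \<omega> + C * real (\<tau> \<omega>)))"
    proof (rule nn_integral_eq_integral)
      show "integrable \<Omega> (\<lambda>\<omega>. Z \<theta> \<omega> + C * real (\<tau> \<omega>))" using Z_int \<tau>_int by simp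
      show "AE \<omega> in \<Omega>. 0 \<le> Z \<theta> \<omega> + C * real (\<tau> \<omega>)"
      proof (rule AE_I2)
        fix \<omega>
        show "0 \<le> Z \<theta> \<omega> + C * real (\<tau> \<omega>)" using Z_bound[of \<theta> \<omega>] by linarith
      qed
    qed
    also have "expectation (\<lambda>\<omega>. Z \<theta> \<omega> + C * real (\<tau> \<omega>)) = C * E"
      using Z_int \<tau>_int \<theta> by (simp add: E_def)
    also have "ennreal (C * E) = ennreal C * ennreal E" using bound_nonneg E by (simp add: ennreal_mult)
    finally have nn: "(\<integral>\<^sup>+x. ennreal (f x + C) \<partial>\<mu>) = ennreal C"
      using E by (simp add: ennreal_mult_cancel_left mult.commute[of _ "ennreal E"])
    have int_f: "integrable \<mu> f" using integrable_observable[OF inv, of 0] by simp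
    have "(\<integral>x. f x + C \<partial>\<mu>) = enn2real (\<integral>\<^sup>+x. ennreal (f x + C) \<partial>\<mu>)"
    proof (rule integral_eq_nn_integral)
      show "(\<lambda>x. f x + C) \<in> borel_measurable \<mu>" using int_f by auto
      show "AE x in \<mu>. 0 \<le> f x + C"
        using nonneg inv'(2) by (intro AE_I2) simp
    qed
    thus "integral\<^sup>L \<mu> f = 0" using int_f bound_nonneg by (simp add: nn \<mu>.prob_space)
    show "measure_support \<mu> = X"
    proof
      show "measure_support \<mu> \<subseteq> X" using inv'(2) by (auto simp: measure_support_def)
      show "X \<subseteq> measure_support \<mu>"
      proof
        fix x assume x: "x \<in> X"
        have "emeasure \<mu> (V \<inter> space \<mu>) > 0" if V: "open V" "x \<in> V" for V
        proof -
          obtain r :: nat where r: "\<And>y. (\<forall>i\<in>{-int r..int r}. y i = x i) \<Longrightarrow> y \<in> V"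
            using open_contains_cylinder[OF V] by blast
          obtain l0 where l0: "loop l0" "int (length l0) = int (2 * r + 1) + 2 * N"
              "\<And>k. k < 2 * r + 1 \<Longrightarrow> l0 ! (nat N + k) = translate (- int r) x (int k)"
            using ex_loop[OF translate_mem[OF x], of "2 * r + 1" "- int r"] by blast
          \<comment> \<open>The window of \<open>x\<close> at \<open>[-r, r]\<close> occurs whenever the first loop is \<open>l0\<close>.\<close>
          obtain m where m: "m > 0" "Lp m = l0" using Lp_surj[OF l0(1)] by blast
          have Npos: "N > 0" using gap window_pos by simp
          let ?B = "V \<inter> space \<mu>"
          have B: "?B \<in> sets (restrict_space borel X)"
            unfolding inv'(2) sets_restrict_space Int_commute[of V X] using V(1) by (intro imageI borel_open)
          have "indicator {m} (fst (\<omega> 0)) \<le> (\<Sum>i<\<tau> \<omega>. indicator ?B (translate (int i) (h \<theta> \<omega>)) :: ennreal)" for \<omega>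
          proof (cases "fst (\<omega> 0) = m")
            case True
            have \<tau>: "\<tau> \<omega> = length l0" "W \<theta> \<omega> 0 = l0" using True m by (auto simp: \<tau>_def W_def g_def)
            define i0 where "i0 = nat N + r"
            have i0: "i0 < \<tau> \<omega>" using l0(2) Npos by (simp add: \<tau> i0_def)
            have "translate (int i0) (h \<theta> \<omega>) i = x i" if i: "i \<in> {-int r..int r}" for i
            proof -
              define k where "k = nat (i + int r)"
              have k: "k < 2 * r + 1" "int k = i + int r" using i by (auto simp: k_def)
              have "nat N + k < \<tau> \<omega>" using k(1) l0(2) Npos by (simp add: \<tau>)
              hence "h \<theta> \<omega> (int (nat N + k)) = l0 ! (nat N + k)"
                unfolding \<tau>(2)[symmetric] by (rule h_nth)
              also have "\<dots> = x i" using l0(3)[OF k(1)] k(2) by simp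
              also have "int (nat N + k) = i + int i0" using k(2) by (simp add: i0_def)
              finally show ?thesis by simp
            qed
            hence "translate (int i0) (h \<theta> \<omega>) \<in> ?B"
              using r translate_mem[OF h_mem] inv'(2) by auto
            hence "1 \<le> (indicator ?B (translate (int i0) (h \<theta> \<omega>)) :: ennreal)" by simp
            also have "\<dots> \<le> (\<Sum>i<\<tau> \<omega>. indicator ?B (translate (int i) (h \<theta> \<omega>)))"
              using i0 by (intro member_le_sum) auto
            finally show ?thesis using True by simp
          qed simp
          hence "(\<integral>\<^sup>+\<omega>. indicator {m} (fst (\<omega> 0)) \<partial>\<Omega>) \<le> (\<integral>\<^sup>+\<omega>. (\<Sum>i<\<tau> \<omega>. indicator ?B (translate (int i) (h \<theta> \<omega>))) \<partial>\<Omega>)"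
            by (intro nn_integral_mono)
          also have "\<dots> = (\<integral>\<^sup>+x. indicator ?B x \<partial>\<mu>) * (\<integral>\<^sup>+\<omega>. \<tau> \<omega> \<partial>\<Omega>)"
            by (rule \<mu>(2)[symmetric]) (use B in simp)
          also have "(\<integral>\<^sup>+x. indicator ?B x \<partial>\<mu>) = emeasure \<mu> ?B"
            using B inv'(1) by (intro nn_integral_indicator) simp
          also have "(\<integral>\<^sup>+\<omega>. indicator {m} (fst (\<omega> 0)) \<partial>\<Omega>) = ennreal (pmf q m)"
            unfolding first_letter by (simp add: emeasure_pmf_single)
          finally show ?thesis using q(1)[of m] by (auto simp: zero_less_iff_neq_zero)
        qed
        thus "x \<in> measure_support \<mu>" using x inv'(2) by (auto simp: measure_support_def)
      qed
    qed
  qed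
qed

end


section \<open>Subshifts of finite type\<close>

text \<open>A window that is longer than all forbidden words detects them, and mixing gives one gap \<open>N\<close> for
  all pairs of windows because there are only finitely many.\<close>

lemma mixing_sft_is_mixing_shift:
  fixes X :: "(int \<Rightarrow> 'a::discrete_topology) set"
  assumes sft: "subshift_of_finite_type X" and mixing: "topologically_mixing_on X left_shift"
  shows "\<exists>A w N. mixing_shift X A w N"
proof -
  obtain A F where A: "finite A" "finite F" and ne: "X \<noteq> {}"
    and X: "X = {x. range x \<subseteq> A \<and> (\<forall>v\<in>F. \<not> occurs_in v x)}"
    using sft unfolding subshift_of_finite_type_def by blast
  define w where "w = int (Suc (Max (insert 0 (length ` F))))"
  have w: "w > 0" by (simp add: w_def)
  have F: "int (length v) < w" if "v \<in> F" for v
  proof -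
    have "length v \<le> Max (insert 0 (length ` F))" using that A(2) by (intro Max_ge) auto
    thus ?thesis by (simp add: w_def)
  qed
  have trans: "translate k x \<in> X" if x: "x \<in> X" for x k
  proof -
    have "\<not> occurs_in v (translate k x)" if v: "v \<in> F" for v
    proof
      assume "occurs_in v (translate k x)"
      then obtain i where "\<forall>j<length v. x (i + int j + k) = v ! j" by (auto simp: occurs_in_def)
      hence "\<forall>j<length v. x ((i + k) + int j) = v ! j" by (simp add: algebra_simps)
      hence "occurs_in v x" unfolding occurs_in_def by blast
      thus False using x v X by blast
    qed
    moreover have "range (translate k x) \<subseteq> A" using x X by auto
    ultimately show ?thesis using X by blast
  qed
  have local: "x \<in> X" if window: "\<And>i. \<exists>y\<in>X. \<forall>k\<in>{0..<w}. x (i + k) = y k" for x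
  proof -
    have "x i \<in> A" for i
    proof -
      obtain y where y: "y \<in> X" "\<forall>k\<in>{0..<w}. x (i + k) = y k" using window by blast
      have "x (i + 0) = y 0" using bspec[OF y(2), of 0] w by simp
      thus ?thesis using y(1) X by auto
    qed
    moreover have "\<not> occurs_in v x" if v: "v \<in> F" for v
    proof
      assume "occurs_in v x"
      then obtain i where i: "\<And>k. k < length v \<Longrightarrow> x (i + int k) = v ! k" by (auto simp: occurs_in_def)
      obtain y where y: "y \<in> X" "\<forall>k\<in>{0..<w}. x (i + k) = y k" using window by blast
      have "y (0 + int k) = v ! k" if "k < length v" for k
        using y(2) F[OF v] i[OF that] that by auto
      hence "occurs_in v y" unfolding occurs_in_def by blast
      thus False using y(1) v X by blast
    qed
    ultimately show ?thesis using X by blast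
  qed
  define cyl where "cyl x = {z\<in>X. \<forall>k\<in>{0..<w}. z k = x k}" for x
  have open_cyl: "openin (top_of_set X) (cyl x)" for x
  proof -
    have "open {z. \<forall>k\<in>{0..<w}. z k = x k}" by (rule open_if_finite_coordinates[of "{0..<w}"]) auto
    moreover have "cyl x = X \<inter> {z. \<forall>k\<in>{0..<w}. z k = x k}" by (auto simp: cyl_def)
    ultimately show ?thesis by (simp add: openin_open_Int)
  qed
  have fin: "finite (cyl ` X)"
  proof -
    have "finite ((\<lambda>x. restrict x {0..<w}) ` X)"
      by (rule finite_subset[of _ "PiE {0..<w} (\<lambda>_. A)"])
         (use X A(1) in \<open>auto intro!: finite_PiE\<close>)
    moreover have "cyl ` X = cyl ` (\<lambda>x. restrict x {0..<w}) ` X"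
      unfolding image_image by (rule image_cong) (auto simp: cyl_def)
    ultimately show ?thesis by simp
  qed
  define n0 where "n0 U V = (SOME n0. \<forall>n\<ge>n0. (left_shift ^^ n) ` U \<inter> V \<noteq> {})"
    for U V :: "(int \<Rightarrow> 'a) set"
  have n0: "\<forall>n\<ge>n0 U V. (left_shift ^^ n) ` U \<inter> V \<noteq> {}" if UV: "U \<in> cyl ` X" "V \<in> cyl ` X" for U V
  proof -
    obtain x y where x: "x \<in> X" "U = cyl x" and y: "y \<in> X" "V = cyl y" using UV by blast
    have "x \<in> U" "y \<in> V" using x y by (auto simp: cyl_def)
    hence "openin (top_of_set X) U \<and> openin (top_of_set X) V \<and> U \<noteq> {} \<and> V \<noteq> {}"
      using open_cyl x(2) y(2) by auto
    with mixing[unfolded topologically_mixing_on_def, THEN spec[of _ U], THEN spec[of _ V]]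
    have "\<exists>n0. \<forall>n\<ge>n0. (left_shift ^^ n) ` U \<inter> V \<noteq> {}" by (rule mp)
    from someI_ex[OF this] show ?thesis unfolding n0_def .
  qed
  define N where "N = Max (insert (nat w) ((\<lambda>(U, V). n0 U V) ` (cyl ` X \<times> cyl ` X)))"
  have finN: "finite (insert (nat w) ((\<lambda>(U, V). n0 U V) ` (cyl ` X \<times> cyl ` X)))" using fin by simp
  have connect: "\<exists>z\<in>X. (\<forall>k\<in>{0..<w}. z k = x k) \<and> (\<forall>k\<in>{0..<w}. z (int N + k) = y k)"
    if xy: "x \<in> X" "y \<in> X" for x y
  proof -
    have "n0 (cyl x) (cyl y) \<le> N"
      unfolding N_def using xy by (intro Max_ge[OF finN] insertI2 image_eqI[of _ _ "(cyl x, cyl y)"]) auto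
    moreover have "cyl x \<in> cyl ` X" "cyl y \<in> cyl ` X" using xy by simp_all
    ultimately have "translate (int N) ` cyl x \<inter> cyl y \<noteq> {}"
      using n0[of "cyl x" "cyl y"] unfolding left_shift_funpow by blast
    then obtain z where "z \<in> cyl x" "translate (int N) z \<in> cyl y" by blast
    thus ?thesis by (intro bexI[of _ z]) (auto simp: cyl_def add.commute)
  qed
  have "w \<le> int N" using Max_ge[OF finN, of "nat w"] by (simp add: N_def)
  have "mixing_shift X A w (int N)"
  proof
    show "x i \<in> A" if "x \<in> X" for x i using that X by auto
  qed (fact A ne trans w local \<open>w \<le> int N\<close> connect)+
  thus ?thesis by blast
qed

theorem proposition4:
  fixes \<Sigma> :: "(int \<Rightarrow> 'a::discrete_topology) set"
    and \<phi> :: "(int \<Rightarrow> 'a) \<Rightarrow> real"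
    and \<alpha> \<beta> :: real
  assumes sft: "subshift_of_finite_type \<Sigma>"
    and mixing: "topologically_mixing_on \<Sigma> left_shift"
    and cont: "continuous_on \<Sigma> \<phi>"
    and alpha: "\<alpha> = (INF \<mu>\<in>invariant_measures \<Sigma> left_shift. integral\<^sup>L \<mu> \<phi>)"
    and beta: "\<beta> = (SUP \<mu>\<in>invariant_measures \<Sigma> left_shift. integral\<^sup>L \<mu> \<phi>)"
  shows "(\<exists>\<mu>\<in>invariant_measures \<Sigma> left_shift. integral\<^sup>L \<mu> \<phi> = \<beta>)
    \<and> \<alpha> = Inf (periodic_orbit_averages \<Sigma> left_shift \<phi>)
    \<and> \<beta> = Sup (periodic_orbit_averages \<Sigma> left_shift \<phi>)
    \<and> (\<forall>t\<in>{\<alpha><..<\<beta>}.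
        (\<exists>K\<subseteq>\<Sigma>. compact K \<and> left_shift ` K = K \<and> topological_entropy K left_shift > 0 \<and>
           (\<forall>x\<in>K. (\<lambda>n. birkhoff_average left_shift \<phi> n x) \<longlonglongrightarrow> t))
      \<and> (\<exists>\<mu>\<in>ergodic_measures \<Sigma> left_shift. measure_support \<mu> = \<Sigma> \<and> integral\<^sup>L \<mu> \<phi> = t))"
proof -
  obtain A w N where "mixing_shift \<Sigma> A w N" using mixing_sft_is_mixing_shift[OF sft mixing] by blast
  then interpret mixing_shift \<Sigma> A w N .
  obtain C where C: "\<And>x. x \<in> \<Sigma> \<Longrightarrow> \<bar>\<phi> x\<bar> \<le> C"
    using compact_imp_bounded[OF compact_continuous_image[OF cont compact]] by (auto simp: bounded_iff)
  interpret shift_observable \<Sigma> A w N \<phi> C by unfold_locales (use cont C in auto)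
  have "(\<exists>K\<subseteq>\<Sigma>. compact K \<and> left_shift ` K = K \<and> topological_entropy K left_shift > 0 \<and>
           (\<forall>x\<in>K. (\<lambda>n. birkhoff_average left_shift \<phi> n x) \<longlonglongrightarrow> t)) \<and>
        (\<exists>\<mu>\<in>ergodic_measures \<Sigma> left_shift. measure_support \<mu> = \<Sigma> \<and> integral\<^sup>L \<mu> \<phi> = t)"
    if t: "\<alpha> < t" "t < \<beta>" for t
  proof -
    \<comment> \<open>Subtracting \<open>t\<close> reduces both claims to \<open>t = 0\<close>.\<close>
    interpret centered: shift_observable \<Sigma> A w N "\<lambda>x. \<phi> x - t" "C + \<bar>t\<bar>"
      by unfold_locales (auto intro!: continuous_intros cont order_trans[OF abs_triangle_ineq4] C)
    have int_t: "integral\<^sup>L \<mu> (\<lambda>x. \<phi> x - t) = integral\<^sup>L \<mu> \<phi> - t"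
      if "\<mu> \<in> invariant_measures \<Sigma> left_shift" for \<mu>
    proof -
      interpret \<mu>: prob_space \<mu> using that by (rule invariant_measuresD)
      show ?thesis using integrable_observable[OF that, of 0] by (simp add: \<mu>.prob_space)
    qed
    have "\<exists>\<mu>\<in>invariant_measures \<Sigma> left_shift. t < integral\<^sup>L \<mu> \<phi>"
      using t(2) unfolding beta less_cSUP_iff[OF invariant_measures_nonempty bdd_above_integrals] .
    then obtain M where M: "M \<in> invariant_measures \<Sigma> left_shift" "integral\<^sup>L M (\<lambda>x. \<phi> x - t) > 0"
      using int_t by force
    have bdd: "bdd_below ((\<lambda>\<mu>. integral\<^sup>L \<mu> \<phi>) ` invariant_measures \<Sigma> left_shift)"
      by (rule bdd_belowI[of _ "- C"]) (use integral_bound in \<open>force simp: abs_le_iff\<close>)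
    have "\<exists>\<mu>\<in>invariant_measures \<Sigma> left_shift. integral\<^sup>L \<mu> \<phi> < t"
      using t(1) unfolding alpha cINF_less_iff[OF invariant_measures_nonempty bdd] .
    then obtain M' where M': "M' \<in> invariant_measures \<Sigma> left_shift" "integral\<^sup>L M' (\<lambda>x. \<phi> x - t) < 0"
      using int_t by force
    obtain K where K: "K \<subseteq> \<Sigma>" "compact K" "left_shift ` K = K" "topological_entropy K left_shift > 0"
      "\<And>x. x \<in> K \<Longrightarrow> (\<lambda>n. birkhoff_average left_shift (\<lambda>x. \<phi> x - t) n x) \<longlonglongrightarrow> 0"
      using centered.ex_compact_zero_averages[OF M M'] by blast
    have avg: "(\<lambda>n. birkhoff_average left_shift \<phi> n x) \<longlonglongrightarrow> t" if "x \<in> K" for x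
    proof -
      have "(\<lambda>n. birkhoff_average left_shift (\<lambda>x. \<phi> x - t) n x + t) \<longlonglongrightarrow> 0 + t"
        by (intro tendsto_add K(5) that tendsto_const)
      moreover have "eventually (\<lambda>n. birkhoff_average left_shift (\<lambda>x. \<phi> x - t) n x + t =
          birkhoff_average left_shift \<phi> n x) sequentially"
        using eventually_gt_at_top[of 0]
        by eventually_elim (simp add: birkhoff_average_def sum_subtractf field_simps)
      ultimately show ?thesis by (simp add: Lim_transform_eventually)
    qed
    obtain \<mu> where \<mu>: "\<mu> \<in> ergodic_measures \<Sigma> left_shift" "measure_support \<mu> = \<Sigma>"
      "integral\<^sup>L \<mu> (\<lambda>x. \<phi> x - t) = 0"
      using centered.ex_ergodic_zero_integral[OF M M'] by blast
    have "\<mu> \<in> invariant_measures \<Sigma> left_shift" using \<mu>(1) by (simp add: ergodic_measures_def)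
    from int_t[OF this] \<mu>(3) have "integral\<^sup>L \<mu> \<phi> = t" by simp
    thus ?thesis using K(1-4) avg \<mu>(1,2) by blast
  qed
  thus ?thesis
    using ex_maximizing_measure Sup_integrals_eq_Sup_periodic Inf_integrals_eq_Inf_periodic
    unfolding alpha beta by auto
qed

end
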